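(* Let $\mathcal X$ be the Wiener algebra (the algebra of functions on the circle $\mathbb T$ with absolutely convergent Fourier series), or the algebra of Dini-continuous functions on $\mathbb T$. Let $F\in\mathcal X$ and let $T_F$ be the Toeplitz operator with symbol $F$ on $H^2$. Suppose that there exists an open disk $D$, contained in the unbounded connected component of $\mathbb C\setminus\sigma(T_F)$, such that $0\in\partial D$. Then $T_F$ is embeddable into a $C_0$-semigroup of operators on $H^2$.
   Context: A function $f\in C(\mathbb T)$ is Dini-continuous if $\int_0^1\frac{w_f(t)}{t}\,dt<\infty$, where $w_f(t)=\sup\{|f(z)-f(z')|: z,z'\in\mathbb T,\ |z-z'|\le t\}$. $H^2$ is the Hardy space of the unit disk, $P_+$ the Riesz projection of $L^2(\mathbb T)$ onto $H^2$, $T_Ff=P_+(Ff)$, and $\sigma(T_F)$ is its spectrum. A $C_0$-semigroup on a Banach space $X$ is a family $(T_t)_{t>0}$ of bounded operators with $T_tT_s=T_{t+s}$ for $t,s>0$ and $\|T_tx-x\|\to0$ as $t\to0^+$ for every $x\in X$. $T$ is embeddable into a $C_0$-semigroup if there is a $C_0$-semigroup $(T_t)_{t>0}$ with $T_1=T$. *)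

theory Defs
  imports "HOL-Analysis.Analysis"
begin

class complex_banach = banach +
  fixes scaleC :: "complex \<Rightarrow> 'a \<Rightarrow> 'a" (infixr \<open>*\<^sub>C\<close> 75)
  assumes scaleC_add_right: "a *\<^sub>C (x + y) = a *\<^sub>C x + a *\<^sub>C y"
    and scaleC_add_left: "(a + b) *\<^sub>C x = a *\<^sub>C x + b *\<^sub>C x"
    and scaleC_scaleC: "a *\<^sub>C b *\<^sub>C x = (a * b) *\<^sub>C x"
    and scaleR_eq_scaleC: "r *\<^sub>R x = of_real r *\<^sub>C x"
    and norm_scaleC: "norm (a *\<^sub>C x) = cmod a * norm x"

lemma scaleC_zero_right [simp]: "c *\<^sub>C (0 :: 'a::complex_banach) = 0"
  using norm_scaleC[of c "0 :: 'a"] by simp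

definition bounded_clinear :: "('a::complex_banach \<Rightarrow> 'b::complex_banach) \<Rightarrow> bool"
  where "bounded_clinear A \<longleftrightarrow> bounded_linear A \<and> (\<forall>c x. A (c *\<^sub>C x) = c *\<^sub>C A x)"

definition op_spectrum :: "('a::complex_banach \<Rightarrow> 'a) \<Rightarrow> complex set"
  where "op_spectrum A =
    {c. \<not> (\<exists>B. bounded_clinear B \<and> B \<circ> (\<lambda>x. A x - c *\<^sub>C x) = id \<and> (\<lambda>x. A x - c *\<^sub>C x) \<circ> B = id)}"

text \<open>
  Only the values of the family at positive times matter.
\<close>

definition c0_semigroup :: "(real \<Rightarrow> 'a::complex_banach \<Rightarrow> 'a) \<Rightarrow> bool"
  where "c0_semigroup T \<longleftrightarrow>
    (\<forall>t>0. bounded_clinear (T t)) \<and>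
    (\<forall>t>0. \<forall>s>0. T t \<circ> T s = T (t + s)) \<and>
    (\<forall>x. ((\<lambda>t. norm (T t x - x)) \<longlongrightarrow> 0) (at_right 0))"

definition c0_embeddable :: "('a::complex_banach \<Rightarrow> 'a) \<Rightarrow> bool"
  where "c0_embeddable A \<longleftrightarrow> (\<exists>T. c0_semigroup T \<and> T 1 = A)"

text \<open>
  Normalised arc length. Its space is the unit circle itself, so measurability with respect to it,
  and every integral, only depends on the values of a function on the circle.
\<close>

definition circle :: "complex measure"
  where "circle = distr (uniform_measure lborel {0..<2 * pi}) (restrict_space borel (sphere 0 1)) cis"

lemma space_circle: "space circle = sphere 0 1"
  and sets_circle [measurable_cong]: "sets circle = sets (restrict_space borel (sphere 0 1))"
  by (simp_all add: circle_def space_restrict_space)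

lemma measurable_cis_circle:
  "cis \<in> uniform_measure lborel {0..<2 * pi} \<rightarrow>\<^sub>M restrict_space borel (sphere 0 1)"
proof (rule measurable_restrict_space2)
  have "cis \<in> borel_measurable borel"
    by (intro borel_measurable_continuous_onI continuous_intros)
  then show "cis \<in> borel_measurable (uniform_measure lborel {0..<2 * pi})"
    by (simp cong: measurable_cong_sets)
qed simp

lemma emeasure_circle: "emeasure circle (space circle) = 1"
proof -
  have "emeasure circle (space circle)
      = emeasure (uniform_measure lborel {0..<2 * pi}) (cis -` sphere 0 1 \<inter> UNIV)"
    unfolding space_circle unfolding circle_def
    by (subst emeasure_distr[OF measurable_cis_circle]) (auto simp: sets_restrict_space)
  also have "cis -` sphere 0 1 \<inter> UNIV = UNIV"
    by auto
  also have "emeasure (uniform_measure lborel {0..<2 * pi}) UNIV = 1"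
    by (simp add: ennreal_divide_self)
  finally show ?thesis .
qed

interpretation circle: finite_measure circle
  by standard (simp add: emeasure_circle)

definition square_integrable :: "(complex \<Rightarrow> complex) \<Rightarrow> bool"
  where "square_integrable f \<longleftrightarrow>
    f \<in> borel_measurable circle \<and> integrable circle (\<lambda>z. (cmod (f z))\<^sup>2)"

lemma square_integrable_inner:
  assumes "square_integrable f" "square_integrable g"
  shows "integrable circle (\<lambda>z. f z \<bullet> g z)"
proof (rule Bochner_Integration.integrable_bound)
  show "integrable circle (\<lambda>z. (cmod (f z))\<^sup>2 + (cmod (g z))\<^sup>2)"
    using assms by (auto simp: square_integrable_def)
  have "\<bar>f z \<bullet> g z\<bar> \<le> (cmod (f z))\<^sup>2 + (cmod (g z))\<^sup>2" for z
  proof -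
    have "\<bar>f z \<bullet> g z\<bar> \<le> cmod (f z) * cmod (g z)"
      by (rule Cauchy_Schwarz_ineq2)
    also have "\<dots> \<le> (cmod (f z))\<^sup>2 + (cmod (g z))\<^sup>2"
      using sum_squares_bound[of "cmod (f z)" "cmod (g z)"] mult_nonneg_nonneg[of "cmod (f z)" "cmod (g z)"]
      by (simp add: mult.assoc del: mult_nonneg_nonneg)
    finally show ?thesis .
  qed
  then show "AE z in circle. norm (f z \<bullet> g z) \<le> norm ((cmod (f z))\<^sup>2 + (cmod (g z))\<^sup>2)"
    by simp
qed (use assms in \<open>auto simp: square_integrable_def\<close>)

lemma square_integrable_0: "square_integrable (\<lambda>_. 0)"
  by (simp add: square_integrable_def)

lemma square_integrable_cmult:
  assumes "square_integrable f"
  shows "square_integrable (\<lambda>z. c * f z)"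
  using assms by (auto simp: square_integrable_def norm_mult power_mult_distrib)

lemma square_integrable_add:
  assumes "square_integrable f" "square_integrable g"
  shows "square_integrable (\<lambda>z. f z + g z)"
proof -
  have "(cmod (f z + g z))\<^sup>2 = (cmod (f z))\<^sup>2 + 2 * (f z \<bullet> g z) + (cmod (g z))\<^sup>2" for z
    by (simp add: power2_norm_eq_inner inner_add_left inner_add_right inner_commute)
  then show ?thesis
    using assms square_integrable_inner[OF assms] by (auto simp: square_integrable_def)
qed

lemma square_integrable_mult_bounded:
  assumes F: "F \<in> borel_measurable circle" "AE z in circle. cmod (F z) \<le> C"
    and f: "square_integrable f"
  shows "square_integrable (\<lambda>z. F z * f z)"
  unfolding square_integrable_def
proof
  have [measurable]: "f \<in> borel_measurable circle" "F \<in> borel_measurable circle"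
    using f F by (auto simp: square_integrable_def)
  show "(\<lambda>z. F z * f z) \<in> borel_measurable circle" by measurable
  show "integrable circle (\<lambda>z. (cmod (F z * f z))\<^sup>2)"
  proof (rule Bochner_Integration.integrable_bound)
    show "integrable circle (\<lambda>z. C\<^sup>2 * (cmod (f z))\<^sup>2)"
      using f by (auto simp: square_integrable_def)
    show "AE z in circle. norm ((cmod (F z * f z))\<^sup>2) \<le> norm (C\<^sup>2 * (cmod (f z))\<^sup>2)"
      using F(2) by eventually_elim (auto simp: norm_mult power_mult_distrib intro!: mult_right_mono power_mono)
  qed measurable
qed

text \<open>
  The Hilbert space of square integrable functions on the circle modulo equality almost everywhere.
  The inner product below is the real part of the usual complex one; it induces the usual norm.
\<close>

quotient_type circle_L2 = "complex \<Rightarrow> complex" /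
  partial: "\<lambda>f g. square_integrable f \<and> square_integrable g \<and> (AE z in circle. f z = g z)"
proof (rule part_equivpI)
  show "\<exists>f. square_integrable f \<and> square_integrable f \<and> (AE z in circle. f z = f z)"
    using square_integrable_0 by auto
  show "symp (\<lambda>f g. square_integrable f \<and> square_integrable g \<and> (AE z in circle. f z = g z))"
    by (auto simp: symp_def eq_commute)
  show "transp (\<lambda>f g. square_integrable f \<and> square_integrable g \<and> (AE z in circle. f z = g z))"
    by (auto simp: transp_def elim: eventually_elim2)
qed

instantiation circle_L2 :: real_inner
begin

lift_definition zero_circle_L2 :: circle_L2 is "\<lambda>_. 0"
  by (simp add: square_integrable_0)

lift_definition plus_circle_L2 :: "circle_L2 \<Rightarrow> circle_L2 \<Rightarrow> circle_L2" is "\<lambda>f g z. f z + g z"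
  by (auto intro: square_integrable_add)

lift_definition uminus_circle_L2 :: "circle_L2 \<Rightarrow> circle_L2" is "\<lambda>f z. - f z"
  using square_integrable_cmult[of _ "-1"] by auto

definition minus_circle_L2 :: "circle_L2 \<Rightarrow> circle_L2 \<Rightarrow> circle_L2"
  where "f - g = f + (- g)" for f g :: circle_L2

lift_definition scaleR_circle_L2 :: "real \<Rightarrow> circle_L2 \<Rightarrow> circle_L2" is "\<lambda>r f z. of_real r * f z"
  by (auto intro: square_integrable_cmult)

lift_definition inner_circle_L2 :: "circle_L2 \<Rightarrow> circle_L2 \<Rightarrow> real" is "\<lambda>f g. \<integral>z. f z \<bullet> g z \<partial>circle"
  by (intro integral_cong_AE) (auto simp: square_integrable_def)

definition norm_circle_L2 :: "circle_L2 \<Rightarrow> real"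
  where "norm f = sqrt (f \<bullet> f)" for f :: circle_L2

definition sgn_circle_L2 :: "circle_L2 \<Rightarrow> circle_L2"
  where "sgn f = inverse (norm f) *\<^sub>R f" for f :: circle_L2

definition dist_circle_L2 :: "circle_L2 \<Rightarrow> circle_L2 \<Rightarrow> real"
  where "dist f g = norm (f - g)" for f g :: circle_L2

definition uniformity_circle_L2 :: "(circle_L2 \<times> circle_L2) filter"
  where "uniformity_circle_L2 = (INF e\<in>{0 <..}. principal {(x, y). dist x y < e})"

definition open_circle_L2 :: "circle_L2 set \<Rightarrow> bool"
  where "open_circle_L2 U = (\<forall>x\<in>U. eventually (\<lambda>(x', y). x' = x \<longrightarrow> y \<in> U) uniformity)"

instance
proof
  fix f g h :: circle_L2 and r s :: real and U :: "circle_L2 set"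
  show "f + g + h = f + (g + h)"
    by transfer (auto simp: add.assoc intro!: square_integrable_add)
  show "f + g = g + f"
    by transfer (auto simp: add.commute intro!: square_integrable_add)
  show "0 + f = f"
    by transfer auto
  show "- f + f = 0"
    by transfer (auto simp: square_integrable_0)
  show "f - g = f + - g"
    by (rule minus_circle_L2_def)
  show "r *\<^sub>R (f + g) = r *\<^sub>R f + r *\<^sub>R g"
    by transfer (auto simp: ring_distribs intro!: square_integrable_add square_integrable_cmult)
  show "(r + s) *\<^sub>R f = r *\<^sub>R f + s *\<^sub>R f"
    by transfer (auto simp: ring_distribs intro!: square_integrable_add square_integrable_cmult)
  show "r *\<^sub>R s *\<^sub>R f = (r * s) *\<^sub>R f"
    by transfer (auto simp: mult.assoc intro!: square_integrable_cmult)
  show "1 *\<^sub>R f = f"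
    by transfer auto
  show "sgn f = inverse (norm f) *\<^sub>R f"
    by (rule sgn_circle_L2_def)
  show "dist f g = norm (f - g)"
    by (rule dist_circle_L2_def)
  show "uniformity = (INF e\<in>{0 <..}. principal {(x :: circle_L2, y). dist x y < e})"
    by (rule uniformity_circle_L2_def)
  show "open U = (\<forall>x\<in>U. eventually (\<lambda>(x', y). x' = x \<longrightarrow> y \<in> U) uniformity)"
    by (rule open_circle_L2_def)
  show "f \<bullet> g = g \<bullet> f"
    by transfer (simp add: inner_commute)
  show "(f + g) \<bullet> h = f \<bullet> h + g \<bullet> h"
    by transfer (simp add: inner_add_left square_integrable_inner)
  show "(r *\<^sub>R f) \<bullet> g = r * (f \<bullet> g)"
    by transfer (simp flip: scaleR_conv_of_real)
  show "0 \<le> f \<bullet> f"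
    by transfer simp
  show "f \<bullet> f = 0 \<longleftrightarrow> f = 0"
  proof transfer
    fix f assume f: "square_integrable f \<and> square_integrable f \<and> (AE z in circle. f z = f z)"
    then have "(\<integral>z. f z \<bullet> f z \<partial>circle) = 0 \<longleftrightarrow> (AE z in circle. f z \<bullet> f z = 0)"
      by (intro integral_nonneg_eq_0_iff_AE) (auto intro: square_integrable_inner)
    then show "(\<integral>z. f z \<bullet> f z \<partial>circle) = 0 \<longleftrightarrow>
        square_integrable f \<and> square_integrable (\<lambda>_. 0) \<and> (AE z in circle. f z = 0)"
      using f by (simp add: square_integrable_0)
  qed
  show "norm f = sqrt (f \<bullet> f)"
    by (rule norm_circle_L2_def)
qed

end

lemma norm_circle_L2_abs:
  assumes "square_integrable f"
  shows "norm (abs_circle_L2 f) = sqrt (\<integral>z. (cmod (f z))\<^sup>2 \<partial>circle)"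
  using assms
  by (simp add: norm_circle_L2_def inner_circle_L2.abs_eq eq_onp_def power2_norm_eq_inner)

lemma diff_circle_L2_abs:
  assumes "square_integrable f" "square_integrable g"
  shows "abs_circle_L2 f - abs_circle_L2 g = abs_circle_L2 (\<lambda>z. f z - g z)"
  using assms square_integrable_cmult[OF assms(2), of "-1"]
  by (simp add: minus_circle_L2_def uminus_circle_L2.abs_eq plus_circle_L2.abs_eq)

lemma abs_circle_L2_cases:
  obtains f where "square_integrable f" "F = abs_circle_L2 f"
  using Quotient3_abs_rep[OF Quotient3_circle_L2] Quotient3_rep_reflp[OF Quotient3_circle_L2]
  by metis

lemma square_integrable_const: "square_integrable (\<lambda>_. c)"
  by (simp add: square_integrable_def)

lemma square_integrable_L1:
  assumes f: "square_integrable f"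
  shows "integrable circle f" "(\<integral>z. cmod (f z) \<partial>circle) \<le> norm (abs_circle_L2 f)"
proof -
  let ?g = "\<lambda>z. of_real (cmod (f z)) :: complex"
  have g: "square_integrable ?g"
    using f by (auto simp: square_integrable_def)
  have eq: "?g z \<bullet> 1 = cmod (f z)" for z
    by (simp add: inner_complex_def)
  have "integrable circle (\<lambda>z. cmod (f z))"
    using square_integrable_inner[OF g square_integrable_const[of 1]] by (simp add: eq)
  then show "integrable circle f"
    using f by (subst (asm) integrable_norm_iff) (auto simp: square_integrable_def)
  have "(\<integral>z. cmod (f z) \<partial>circle) = abs_circle_L2 ?g \<bullet> abs_circle_L2 (\<lambda>_. 1)"
    using g square_integrable_const[of 1] by (simp add: inner_circle_L2.abs_eq eq_onp_def eq)
  also have "\<dots> \<le> norm (abs_circle_L2 ?g) * norm (abs_circle_L2 (\<lambda>_. 1))"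
    by (rule norm_cauchy_schwarz)
  also have "norm (abs_circle_L2 (\<lambda>_. 1)) = 1"
    by (simp add: norm_circle_L2_abs square_integrable_const measure_def emeasure_circle)
  also have "norm (abs_circle_L2 ?g) = norm (abs_circle_L2 f)"
    using f g by (simp add: norm_circle_L2_abs)
  finally show "(\<integral>z. cmod (f z) \<partial>circle) \<le> norm (abs_circle_L2 f)"
    by simp
qed

instance circle_L2 :: banach
proof
  fix X :: "nat \<Rightarrow> circle_L2"
  assume X: "Cauchy X"
  have "\<exists>x. square_integrable x \<and> X n = abs_circle_L2 x" for n
    by (metis abs_circle_L2_cases)
  then obtain x where x: "\<And>n. square_integrable (x n)" and Xx: "\<And>n. X n = abs_circle_L2 (x n)"
    by metis
  have x_diff: "square_integrable (\<lambda>z. x i z - x j z)" for i j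
    using square_integrable_add[OF x square_integrable_cmult[OF x, of "-1"], of i j] by simp
  have X_diff: "X i - X j = abs_circle_L2 (\<lambda>z. x i z - x j z)" for i j
    by (simp add: Xx x diff_circle_L2_abs)
  have [measurable]: "x i \<in> borel_measurable circle" for i
    using x by (simp add: square_integrable_def)
  obtain r where r: "strict_mono r" and cauchy: "AE z in circle. Cauchy (\<lambda>i. x (r i) z)"
  proof (rule cauchy_L1_AE_cauchy_subseq)
    show "integrable circle (x n)" for n
      by (intro square_integrable_L1 x)
    fix e :: real
    assume "e > 0"
    then obtain N where N: "\<And>i j. i \<ge> N \<Longrightarrow> j \<ge> N \<Longrightarrow> norm (X i - X j) < e"
      using X by (metis CauchyD)
    then show "\<exists>N. \<forall>i\<ge>N. \<forall>j\<ge>N. (\<integral>z. norm (x i z - x j z) \<partial>circle) < e"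
      using square_integrable_L1(2)[OF x_diff] unfolding X_diff by (meson le_less_trans)
  qed
  define g where "g z = lim (\<lambda>k. x (r k) z)" for z
  have g_meas [measurable]: "g \<in> borel_measurable circle"
    unfolding g_def by measurable
  have lim: "AE z in circle. (\<lambda>k. x (r k) z) \<longlonglongrightarrow> g z"
    using cauchy unfolding g_def
    by eventually_elim (simp add: Cauchy_convergent convergent_LIMSEQ_iff[symmetric])
  have bound: "\<exists>N. \<forall>n\<ge>N. (\<integral>\<^sup>+z. ennreal ((cmod (x n z - g z))\<^sup>2) \<partial>circle) \<le> ennreal (e\<^sup>2)" if "e > 0" for e
  proof -
    obtain N where N: "\<And>i j. i \<ge> N \<Longrightarrow> j \<ge> N \<Longrightarrow> norm (X i - X j) < e"
      using X \<open>e > 0\<close> by (metis CauchyD)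
    have "(\<integral>\<^sup>+z. ennreal ((cmod (x n z - g z))\<^sup>2) \<partial>circle) \<le> ennreal (e\<^sup>2)" if "n \<ge> N" for n
    proof -
      have "(\<integral>\<^sup>+z. ennreal ((cmod (x n z - g z))\<^sup>2) \<partial>circle)
          = (\<integral>\<^sup>+z. liminf (\<lambda>k. ennreal ((cmod (x n z - x (r k) z))\<^sup>2)) \<partial>circle)"
      proof (rule nn_integral_cong_AE)
        show "AE z in circle. ennreal ((cmod (x n z - g z))\<^sup>2)
            = liminf (\<lambda>k. ennreal ((cmod (x n z - x (r k) z))\<^sup>2))"
          using lim
        proof eventually_elim
          case (elim z)
          have "(\<lambda>k. ennreal ((cmod (x n z - x (r k) z))\<^sup>2)) \<longlonglongrightarrow> ennreal ((cmod (x n z - g z))\<^sup>2)"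
            by (intro tendsto_intros elim)
          then show ?case
            by (intro lim_imp_Liminf[symmetric]) auto
        qed
      qed
      also have "\<dots> \<le> liminf (\<lambda>k. \<integral>\<^sup>+z. ennreal ((cmod (x n z - x (r k) z))\<^sup>2) \<partial>circle)"
        by (rule nn_integral_liminf) measurable
      also have "\<dots> \<le> liminf (\<lambda>k. ennreal (e\<^sup>2))"
      proof (rule Liminf_mono)
        show "\<forall>\<^sub>F k in sequentially. (\<integral>\<^sup>+z. ennreal ((cmod (x n z - x (r k) z))\<^sup>2) \<partial>circle) \<le> ennreal (e\<^sup>2)"
        proof (rule eventually_sequentiallyI)
          fix k assume "k \<ge> N"
          then have "r k \<ge> N"
            using seq_suble[OF r, of k] by linarith
          then have "(norm (X n - X (r k)))\<^sup>2 \<le> e\<^sup>2"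
            using N[of n "r k"] \<open>n \<ge> N\<close> by (intro power_mono) auto
          moreover have "(norm (X n - X (r k)))\<^sup>2 = (\<integral>z. (cmod (x n z - x (r k) z))\<^sup>2 \<partial>circle)"
            unfolding X_diff by (simp add: norm_circle_L2_abs[OF x_diff])
          ultimately show "(\<integral>\<^sup>+z. ennreal ((cmod (x n z - x (r k) z))\<^sup>2) \<partial>circle) \<le> ennreal (e\<^sup>2)"
            using x_diff[of n "r k"]
            by (subst nn_integral_eq_integral) (auto simp: square_integrable_def intro!: ennreal_leI)
        qed
      qed
      also have "\<dots> = ennreal (e\<^sup>2)"
        by (simp add: Liminf_const)
      finally show ?thesis .
    qed
    then show ?thesis by blast
  qed
  have sq: "square_integrable (\<lambda>z. x n z - g z)"
    if "(\<integral>\<^sup>+z. ennreal ((cmod (x n z - g z))\<^sup>2) \<partial>circle) \<le> ennreal (e\<^sup>2)" for n e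
    unfolding square_integrable_def
    using that by (auto intro!: integrableI_bounded simp: le_less_trans)
  obtain N1 where "\<forall>n\<ge>N1. (\<integral>\<^sup>+z. ennreal ((cmod (x n z - g z))\<^sup>2) \<partial>circle) \<le> ennreal (1\<^sup>2)"
    using bound[of 1] by auto
  then have "square_integrable (\<lambda>z. x N1 z - g z)"
    by (intro sq[of N1 1]) auto
  from square_integrable_add[OF x[of N1] square_integrable_cmult[OF this, of "-1"]]
  have g: "square_integrable g"
    by simp
  have "X \<longlonglongrightarrow> abs_circle_L2 g"
  proof (rule LIMSEQ_I)
    fix e :: real assume "e > 0"
    then obtain N where N: "\<And>n. n \<ge> N \<Longrightarrow> (\<integral>\<^sup>+z. ennreal ((cmod (x n z - g z))\<^sup>2) \<partial>circle) \<le> ennreal ((e/2)\<^sup>2)"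
      using bound[of "e/2"] by auto
    have "norm (X n - abs_circle_L2 g) < e" if "n \<ge> N" for n
    proof -
      have s: "square_integrable (\<lambda>z. x n z - g z)"
        using sq N that by blast
      have "(norm (X n - abs_circle_L2 g))\<^sup>2 = (\<integral>z. (cmod (x n z - g z))\<^sup>2 \<partial>circle)"
        by (simp add: Xx diff_circle_L2_abs x g norm_circle_L2_abs s)
      moreover have "ennreal (\<integral>z. (cmod (x n z - g z))\<^sup>2 \<partial>circle) \<le> ennreal ((e/2)\<^sup>2)"
        using N[OF that] s by (subst nn_integral_eq_integral[symmetric]) (auto simp: square_integrable_def)
      ultimately have "(norm (X n - abs_circle_L2 g))\<^sup>2 \<le> (e/2)\<^sup>2"
        by (simp add: ennreal_le_iff)
      then have "norm (X n - abs_circle_L2 g) \<le> e/2"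
        using \<open>e > 0\<close> by (simp add: power2_le_iff_abs_le)
      then show ?thesis using \<open>e > 0\<close> by simp
    qed
    then show "\<exists>N. \<forall>n\<ge>N. norm (X n - abs_circle_L2 g) < e" by blast
  qed
  then show "convergent X"
    by (rule convergentI)
qed

instantiation circle_L2 :: complex_banach
begin

lift_definition scaleC_circle_L2 :: "complex \<Rightarrow> circle_L2 \<Rightarrow> circle_L2" is "\<lambda>c f z. c * f z"
  by (auto intro: square_integrable_cmult)

instance
proof
  fix f g :: circle_L2 and a b :: complex and r :: real
  show "a *\<^sub>C (f + g) = a *\<^sub>C f + a *\<^sub>C g"
    by transfer (auto simp: ring_distribs intro!: square_integrable_add square_integrable_cmult)
  show "(a + b) *\<^sub>C f = a *\<^sub>C f + b *\<^sub>C f"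
    by transfer (auto simp: ring_distribs intro!: square_integrable_add square_integrable_cmult)
  show "a *\<^sub>C b *\<^sub>C f = (a * b) *\<^sub>C f"
    by transfer (auto simp: mult.assoc intro!: square_integrable_cmult)
  show "r *\<^sub>R f = of_real r *\<^sub>C f"
    by transfer (auto intro!: square_integrable_cmult)
  obtain h where h: "square_integrable h" "f = abs_circle_L2 h"
    by (rule abs_circle_L2_cases)
  show "norm (a *\<^sub>C f) = cmod a * norm f"
    using h by (simp add: scaleC_circle_L2.abs_eq norm_circle_L2_abs square_integrable_cmult
        norm_mult power_mult_distrib real_sqrt_mult)
qed

end

lemma borel_measurable_circle_continuous:
  fixes f :: "complex \<Rightarrow> complex"
  shows "continuous_on (sphere 0 1) f \<Longrightarrow> f \<in> borel_measurable circle"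
  by (simp add: borel_measurable_continuous_on_restrict cong: measurable_cong_sets[OF sets_circle refl])

lemma borel_measurable_circle_powi [measurable]: "(\<lambda>z. z powi n) \<in> borel_measurable circle"
  by (intro borel_measurable_circle_continuous continuous_intros) auto

definition fourier_coeff :: "(complex \<Rightarrow> complex) \<Rightarrow> int \<Rightarrow> complex"
  where "fourier_coeff f n = (\<integral>z. f z * z powi (- n) \<partial>circle)"

lift_definition coeff_L2 :: "circle_L2 \<Rightarrow> int \<Rightarrow> complex" is fourier_coeff
proof (rule ext, goal_cases)
  case (1 f g n)
  then have [measurable]: "f \<in> borel_measurable circle" "g \<in> borel_measurable circle"
    by (auto simp: square_integrable_def)
  show ?case
    unfolding fourier_coeff_def by (rule integral_cong_AE) (use 1 in auto)
qed

lemma norm_circle_powi: "z \<in> space circle \<Longrightarrow> cmod (z powi n) = 1"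
  by (simp add: space_circle norm_power_int)

lemma square_integrable_powi: "square_integrable (\<lambda>z. z powi n)"
  using square_integrable_mult_bounded[OF borel_measurable_circle_powi _ square_integrable_const[of 1], of n 1]
  by (simp add: norm_circle_powi)

lift_definition powi_L2 :: "int \<Rightarrow> circle_L2" is "\<lambda>n z. z powi n"
  by (simp add: square_integrable_powi)

lemma coeff_L2_inner: "coeff_L2 f n = Complex (f \<bullet> powi_L2 n) (f \<bullet> \<i> *\<^sub>C powi_L2 n)"
proof (transfer fixing: n)
  fix f assume f: "square_integrable f \<and> square_integrable f \<and> (AE z in circle. f z = f z)"
  then have fi: "integrable circle (\<lambda>z. f z * z powi (- n))"
    by (intro square_integrable_L1)
       (use square_integrable_mult_bounded[OF borel_measurable_circle_powi, of "-n" 1 f]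
        in \<open>auto simp: norm_circle_powi mult.commute\<close>)
  have cnj: "z powi (- n) = cnj (z powi n)" if "z \<in> space circle" for z
  proof -
    have "inverse z = cnj z"
      using that complex_norm_square[of z] by (intro inverse_unique) (simp add: space_circle)
    then show ?thesis
      by (simp add: power_int_minus power_int_inverse flip: power_int_inverse)
  qed
  have "f z \<bullet> z powi n = Re (f z * z powi (- n))" "f z \<bullet> (\<i> * z powi n) = Im (f z * z powi (- n))"
    if "z \<in> space circle" for z
    unfolding cnj[OF that] by (simp_all add: inner_complex_def del: complex_cnj_power_int)
  then have "(\<integral>z. f z \<bullet> z powi n \<partial>circle) = (\<integral>z. Re (f z * z powi (- n)) \<partial>circle)"
    "(\<integral>z. f z \<bullet> (\<i> * z powi n) \<partial>circle) = (\<integral>z. Im (f z * z powi (- n)) \<partial>circle)"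
    by (auto intro!: Bochner_Integration.integral_cong)
  then show "fourier_coeff f n =
      Complex (\<integral>z. f z \<bullet> z powi n \<partial>circle) (\<integral>z. f z \<bullet> (\<i> * z powi n) \<partial>circle)"
    using integral_Re[OF fi] integral_Im[OF fi]
    by (simp only: fourier_coeff_def complex_surj[symmetric])
qed

lemma tendsto_coeff_L2: "(f \<longlongrightarrow> g) F \<Longrightarrow> ((\<lambda>x. coeff_L2 (f x) n) \<longlongrightarrow> coeff_L2 g n) F"
  unfolding coeff_L2_inner by (intro tendsto_intros)

lemma coeff_L2_add: "coeff_L2 (f + g) n = coeff_L2 f n + coeff_L2 g n"
  by (simp add: coeff_L2_inner inner_add_left complex_eq_iff)

lemma coeff_L2_scaleC: "coeff_L2 (c *\<^sub>C f) n = c * coeff_L2 f n"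
  by (transfer fixing: c n) (simp add: fourier_coeff_def mult.assoc)

lemma coeff_L2_0 [simp]: "coeff_L2 0 n = 0"
  by (simp add: coeff_L2_inner complex_eq_iff)

lemma coeff_L2_minus: "coeff_L2 (- f) n = - coeff_L2 f n"
  by (simp add: coeff_L2_inner complex_eq_iff)

lemma coeff_L2_diff: "coeff_L2 (f - g) n = coeff_L2 f n - coeff_L2 g n"
  by (simp add: coeff_L2_inner inner_diff_left complex_eq_iff)

lemma coeff_L2_scaleR: "coeff_L2 (r *\<^sub>R f) n = r *\<^sub>R coeff_L2 f n"
  by (simp add: coeff_L2_inner complex_eq_iff)

lemma inner_scaleC_powi_L2: "f \<bullet> c *\<^sub>C powi_L2 n = coeff_L2 f n \<bullet> c"
proof -
  have "c *\<^sub>C powi_L2 n = Re c *\<^sub>R powi_L2 n + Im c *\<^sub>R (\<i> *\<^sub>C powi_L2 n)"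
    unfolding scaleR_eq_scaleC scaleC_scaleC scaleC_add_left[symmetric]
    by (simp add: complex_eq[of c, symmetric] mult.commute)
  then show ?thesis
    by (simp add: coeff_L2_inner inner_complex_def inner_add_right mult.commute)
qed

lemma integral_circle_powi: "(\<integral>z. z powi n \<partial>circle) = (if n = 0 then 1 else 0)"
proof (cases "n = 0")
  case True
  then show ?thesis by (simp add: measure_def emeasure_circle)
next
  case False
  have "(\<integral>z. z powi n \<partial>circle) = (\<integral>t. cis (of_int n * t) \<partial>uniform_measure lborel {0..<2 * pi})"
    unfolding circle_def cis_power_int[symmetric]
    by (rule integral_distr[OF measurable_cis_circle])
       (use borel_measurable_circle_powi in \<open>simp cong: measurable_cong_sets[OF sets_circle refl]\<close>)
  also have "\<dots> = (1 / (2 * pi)) *\<^sub>R (\<integral>t. indicator {0..<2 * pi} t *\<^sub>R cis (of_int n * t) \<partial>lborel)"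
  proof -
    have eq: "uniform_measure lborel {0..<2 * pi}
        = density lborel (\<lambda>t. ennreal (indicator {0..<2 * pi} t / (2 * pi)))"
      unfolding uniform_measure_def
      by (intro density_cong) (auto simp: indicator_def divide_ennreal[symmetric] ennreal_1[symmetric] simp del: ennreal_1)
    have [measurable]: "(\<lambda>t. cis (of_int n * t)) \<in> borel_measurable borel"
      by (intro borel_measurable_continuous_onI continuous_intros)
    show ?thesis
      unfolding eq
      by (subst integral_density) (auto simp flip: integral_scaleR_right intro!: Bochner_Integration.integral_cong)
  qed
  also have "(\<integral>t. indicator {0..<2 * pi} t *\<^sub>R cis (of_int n * t) \<partial>lborel)
      = (\<integral>t. indicator {0..2 * pi} t *\<^sub>R cis (of_int n * t) \<partial>lborel)"
  proof (rule integral_cong_AE)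
    show "AE t in lborel. indicator {0..<2 * pi} t *\<^sub>R cis (of_int n * t) =
        indicator {0..2 * pi} t *\<^sub>R cis (of_int n * t)"
      using AE_lborel_singleton[of "2 * pi"] by eventually_elim (auto simp: indicator_def)
    have [measurable]: "(\<lambda>t. cis (of_int n * t)) \<in> borel_measurable borel"
      by (intro borel_measurable_continuous_onI continuous_intros)
    show "(\<lambda>t. indicator {0..<2 * pi} t *\<^sub>R cis (of_int n * t)) \<in> borel_measurable lborel"
      "(\<lambda>t. indicator {0..2 * pi} t *\<^sub>R cis (of_int n * t)) \<in> borel_measurable lborel"
      by measurable
  qed
  also have "\<dots> = cis (of_int n * (2 * pi)) / (\<i> * of_int n) - cis (of_int n * 0) / (\<i> * of_int n)"
  proof (rule integral_FTC_Icc)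
    fix t :: real
    show "((\<lambda>t. cis (of_int n * t) / (\<i> * of_int n)) has_vector_derivative cis (of_int n * t))
        (at t within {0..2 * pi})"
      using False
      by (auto intro!: derivative_eq_intros simp: has_vector_derivative_def scaleR_conv_of_real field_simps)
  qed (auto intro!: continuous_intros)
  also have "\<dots> = 0"
    using cis_multiple_2pi[of "of_int n"] by (simp add: mult_ac)
  finally show ?thesis using False by simp
qed

lemma coeff_L2_powi: "coeff_L2 (powi_L2 m) n = (if m = n then 1 else 0)"
proof (transfer fixing: m n)
  have "(\<integral>z. z powi m * z powi (- n) \<partial>circle) = (\<integral>z. z powi (m - n) \<partial>circle)"
  proof (rule Bochner_Integration.integral_cong)
    fix z assume "z \<in> space circle"
    then have "z \<noteq> 0" by (auto simp: space_circle)
    then show "z powi m * z powi (- n) = z powi (m - n)"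
      by (simp add: power_int_diff power_int_minus divide_inverse)
  qed simp
  then show "fourier_coeff (\<lambda>z. z powi m) n = (if m = n then 1 else 0)"
    by (simp add: fourier_coeff_def integral_circle_powi)
qed

text \<open>
  The Hardy space, in the usual identification of an analytic function on the disk with its
  boundary function: the square integrable functions on the circle whose Fourier coefficients of
  negative index vanish.
\<close>

typedef hardy2 = "{f :: circle_L2. \<forall>n<0. coeff_L2 f n = 0}"
  by (rule exI[of _ 0]) simp

setup_lifting type_definition_hardy2

instantiation hardy2 :: real_inner
begin

lift_definition zero_hardy2 :: hardy2 is 0
  by simp

lift_definition plus_hardy2 :: "hardy2 \<Rightarrow> hardy2 \<Rightarrow> hardy2" is "(+)"
  by (simp add: coeff_L2_add)

lift_definition uminus_hardy2 :: "hardy2 \<Rightarrow> hardy2" is uminus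
  by (simp add: coeff_L2_minus)

lift_definition minus_hardy2 :: "hardy2 \<Rightarrow> hardy2 \<Rightarrow> hardy2" is "(-)"
  by (simp add: coeff_L2_diff)

lift_definition scaleR_hardy2 :: "real \<Rightarrow> hardy2 \<Rightarrow> hardy2" is scaleR
  by (simp add: coeff_L2_scaleR)

lift_definition inner_hardy2 :: "hardy2 \<Rightarrow> hardy2 \<Rightarrow> real" is inner .

lift_definition norm_hardy2 :: "hardy2 \<Rightarrow> real" is norm .

lift_definition sgn_hardy2 :: "hardy2 \<Rightarrow> hardy2" is sgn
  by (simp add: sgn_div_norm coeff_L2_scaleR)

lift_definition dist_hardy2 :: "hardy2 \<Rightarrow> hardy2 \<Rightarrow> real" is dist .

definition uniformity_hardy2 :: "(hardy2 \<times> hardy2) filter"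
  where "uniformity_hardy2 = (INF e\<in>{0 <..}. principal {(x, y). dist x y < e})"

definition open_hardy2 :: "hardy2 set \<Rightarrow> bool"
  where "open_hardy2 U = (\<forall>x\<in>U. eventually (\<lambda>(x', y). x' = x \<longrightarrow> y \<in> U) uniformity)"

instance
proof
  fix f g h :: hardy2 and r s :: real and U :: "hardy2 set"
  show "f + g + h = f + (g + h)"
    by transfer (rule add.assoc)
  show "f + g = g + f"
    by transfer (rule add.commute)
  show "0 + f = f"
    by transfer (rule add_0_left)
  show "- f + f = 0"
    by transfer (rule left_minus)
  show "f - g = f + - g"
    by transfer (rule diff_conv_add_uminus)
  show "r *\<^sub>R (f + g) = r *\<^sub>R f + r *\<^sub>R g"
    by transfer (rule scaleR_add_right)
  show "(r + s) *\<^sub>R f = r *\<^sub>R f + s *\<^sub>R f"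
    by transfer (rule scaleR_add_left)
  show "r *\<^sub>R s *\<^sub>R f = (r * s) *\<^sub>R f"
    by transfer (rule scaleR_scaleR)
  show "1 *\<^sub>R f = f"
    by transfer (rule scaleR_one)
  show "sgn f = inverse (norm f) *\<^sub>R f"
    by transfer (rule sgn_div_norm)
  show "dist f g = norm (f - g)"
    by transfer (rule dist_norm)
  show "uniformity = (INF e\<in>{0 <..}. principal {(x :: hardy2, y). dist x y < e})"
    by (rule uniformity_hardy2_def)
  show "open U = (\<forall>x\<in>U. eventually (\<lambda>(x', y). x' = x \<longrightarrow> y \<in> U) uniformity)"
    by (rule open_hardy2_def)
  show "f \<bullet> g = g \<bullet> f"
    by transfer (rule inner_commute)
  show "(f + g) \<bullet> h = f \<bullet> h + g \<bullet> h"
    by transfer (rule inner_add_left)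
  show "(r *\<^sub>R f) \<bullet> g = r * (f \<bullet> g)"
    by transfer (rule inner_scaleR_left)
  show "0 \<le> f \<bullet> f"
    by transfer (rule inner_ge_zero)
  show "f \<bullet> f = 0 \<longleftrightarrow> f = 0"
    by transfer (rule inner_eq_zero_iff)
  show "norm f = sqrt (f \<bullet> f)"
    by transfer (rule norm_eq_sqrt_inner)
qed

end

lemma Rep_hardy2_coeff: "n < 0 \<Longrightarrow> coeff_L2 (Rep_hardy2 f) n = 0"
  using Rep_hardy2[of f] by simp

lemma tendsto_Rep_hardy2_iff:
  "((\<lambda>x. Rep_hardy2 (f x)) \<longlongrightarrow> Rep_hardy2 g) A \<longleftrightarrow> (f \<longlongrightarrow> g) A"
  unfolding tendsto_dist_iff[of "\<lambda>x. Rep_hardy2 (f x)"] tendsto_dist_iff[of f] dist_hardy2.rep_eq ..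

instance hardy2 :: banach
proof
  fix X :: "nat \<Rightarrow> hardy2"
  assume "Cauchy X"
  then have "Cauchy (\<lambda>n. Rep_hardy2 (X n))"
    by (simp add: Cauchy_def dist_hardy2.rep_eq)
  then obtain L where L: "(\<lambda>n. Rep_hardy2 (X n)) \<longlonglongrightarrow> L"
    using Cauchy_convergent convergent_def by blast
  have "coeff_L2 L k = 0" if "k < 0" for k
    using tendsto_coeff_L2[OF L, of k] that by (simp add: Rep_hardy2_coeff LIMSEQ_const_iff)
  then have "Rep_hardy2 (Abs_hardy2 L) = L"
    by (simp add: Abs_hardy2_inverse)
  then have "X \<longlonglongrightarrow> Abs_hardy2 L"
    using L tendsto_Rep_hardy2_iff[of X "Abs_hardy2 L"] by simp
  then show "convergent X"
    by (rule convergentI)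
qed

instantiation hardy2 :: complex_banach
begin

lift_definition scaleC_hardy2 :: "complex \<Rightarrow> hardy2 \<Rightarrow> hardy2" is scaleC
  by (simp add: coeff_L2_scaleC)

instance
proof
  fix f g :: hardy2 and a b :: complex and r :: real
  show "a *\<^sub>C (f + g) = a *\<^sub>C f + a *\<^sub>C g"
    by transfer (rule scaleC_add_right)
  show "(a + b) *\<^sub>C f = a *\<^sub>C f + b *\<^sub>C f"
    by transfer (rule scaleC_add_left)
  show "a *\<^sub>C b *\<^sub>C f = (a * b) *\<^sub>C f"
    by transfer (rule scaleC_scaleC)
  show "r *\<^sub>R f = of_real r *\<^sub>C f"
    by transfer (rule scaleR_eq_scaleC)
  show "norm (a *\<^sub>C f) = cmod a * norm f"
    by transfer (rule norm_scaleC)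
qed

end

lift_definition powi_hardy2 :: "nat \<Rightarrow> hardy2" is "\<lambda>n. powi_L2 (int n)"
  by (simp add: coeff_L2_powi)

text \<open>
  The series converges for every square integrable function (\<open>summable_riesz_proj\<close> below), and
  its sum keeps exactly the Fourier coefficients of nonnegative index (\<open>coeff_riesz_proj\<close>).
\<close>

definition riesz_proj :: "circle_L2 \<Rightarrow> hardy2"
  where "riesz_proj f = (\<Sum>n. coeff_L2 f (int n) *\<^sub>C powi_hardy2 n)"

lemma norm_scaleC_powi_hardy2: "norm (c *\<^sub>C powi_hardy2 n) = cmod c"
proof -
  have "(norm (powi_L2 k))\<^sup>2 = 1" for k
  proof -
    have "powi_L2 k = 1 *\<^sub>C powi_L2 k"
      using scaleR_eq_scaleC[of 1 "powi_L2 k"] by simp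
    then have "(norm (powi_L2 k))\<^sup>2 = powi_L2 k \<bullet> 1 *\<^sub>C powi_L2 k"
      by (simp only: power2_norm_eq_inner)
    also have "\<dots> = 1"
      by (simp add: inner_scaleC_powi_L2 coeff_L2_powi)
    finally show ?thesis .
  qed
  then have "norm (powi_hardy2 n) = 1"
    unfolding norm_hardy2.rep_eq powi_hardy2.rep_eq
    by (metis norm_ge_zero one_power2 power2_eq_imp_eq zero_le_one)
  then show ?thesis by (simp add: norm_scaleC)
qed

lemma inner_scaleC_powi_hardy2: "f \<bullet> c *\<^sub>C powi_hardy2 n = coeff_L2 (Rep_hardy2 f) (int n) \<bullet> c"
  by (simp add: inner_hardy2.rep_eq scaleC_hardy2.rep_eq powi_hardy2.rep_eq inner_scaleC_powi_L2)

lemma sum_powi_hardy2_norm: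
  assumes "finite I"
  shows "(norm (\<Sum>n\<in>I. c n *\<^sub>C powi_hardy2 n))\<^sup>2 = (\<Sum>n\<in>I. (cmod (c n))\<^sup>2)"
proof -
  have "pairwise (\<lambda>i j. orthogonal (c i *\<^sub>C powi_hardy2 i) (c j *\<^sub>C powi_hardy2 j)) I"
    by (auto simp: pairwise_def orthogonal_def inner_scaleC_powi_hardy2 scaleC_hardy2.rep_eq
        powi_hardy2.rep_eq coeff_L2_scaleC coeff_L2_powi)
  from norm_sum_Pythagorean[OF assms this] show ?thesis
    by (simp add: norm_scaleC_powi_hardy2)
qed

lemma Rep_hardy2_sum: "Rep_hardy2 (\<Sum>n\<in>I. f n) = (\<Sum>n\<in>I. Rep_hardy2 (f n))"
  by (induction I rule: infinite_finite_induct) (simp_all add: zero_hardy2.rep_eq plus_hardy2.rep_eq)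

lemma bessel_inequality:
  assumes "finite I"
  shows "(\<Sum>n\<in>I. (cmod (coeff_L2 f (int n)))\<^sup>2) \<le> (norm f)\<^sup>2"
proof -
  let ?p = "\<Sum>n\<in>I. coeff_L2 f (int n) *\<^sub>C powi_hardy2 n"
  have p: "Rep_hardy2 ?p = (\<Sum>n\<in>I. coeff_L2 f (int n) *\<^sub>C powi_L2 (int n))"
    by (simp add: Rep_hardy2_sum scaleC_hardy2.rep_eq powi_hardy2.rep_eq)
  have "f \<bullet> Rep_hardy2 ?p = (\<Sum>n\<in>I. (cmod (coeff_L2 f (int n)))\<^sup>2)"
    by (simp add: p inner_sum_right inner_scaleC_powi_L2 power2_norm_eq_inner)
  also have "\<dots> = (norm ?p)\<^sup>2"
    by (simp add: sum_powi_hardy2_norm[OF assms])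
  finally have eq: "f \<bullet> Rep_hardy2 ?p = (norm ?p)\<^sup>2" .
  have "(norm ?p)\<^sup>2 \<le> norm f * norm ?p"
    using norm_cauchy_schwarz[of f "Rep_hardy2 ?p"] by (simp add: eq norm_hardy2.rep_eq)
  then have "norm ?p \<le> norm f"
    by (cases "norm ?p = 0") (auto simp: power2_eq_square mult_le_cancel_right)
  then show ?thesis
    unfolding sum_powi_hardy2_norm[OF assms, symmetric] by (intro power_mono) auto
qed

lemma summable_riesz_proj: "summable (\<lambda>n. coeff_L2 f (int n) *\<^sub>C powi_hardy2 n)"
proof -
  have sq: "summable (\<lambda>n. (cmod (coeff_L2 f (int n)))\<^sup>2)"
    by (rule summableI_nonneg_bounded[where x = "(norm f)\<^sup>2"]) (auto intro: bessel_inequality)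
  show ?thesis
    unfolding summable_Cauchy
  proof (intro allI impI)
    fix e :: real assume "e > 0"
    then obtain N where N: "\<And>m n. m \<ge> N \<Longrightarrow> norm (\<Sum>i=m..<n. (cmod (coeff_L2 f (int i)))\<^sup>2) < e\<^sup>2"
      using sq unfolding summable_Cauchy by (meson zero_less_power)
    have "norm (\<Sum>i=m..<n. coeff_L2 f (int i) *\<^sub>C powi_hardy2 i) < e" if "m \<ge> N" for m n
    proof -
      have "(norm (\<Sum>i=m..<n. coeff_L2 f (int i) *\<^sub>C powi_hardy2 i))\<^sup>2 < e\<^sup>2"
        unfolding sum_powi_hardy2_norm[OF finite_atLeastLessThan]
        using N[OF that, of n] by simp
      then show ?thesis
        using \<open>e > 0\<close> by (rule power2_less_imp_less[OF _ less_imp_le])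
    qed
    then show "\<exists>N. \<forall>m\<ge>N. \<forall>n. norm (\<Sum>i=m..<n. coeff_L2 f (int i) *\<^sub>C powi_hardy2 i) < e"
      by blast
  qed
qed

lemma coeff_riesz_proj:
  "coeff_L2 (Rep_hardy2 (riesz_proj f)) n = (if n \<ge> 0 then coeff_L2 f n else 0)"
proof (cases "n \<ge> 0")
  case True
  then obtain k where n: "n = int k" by (metis nonneg_int_cases)
  let ?s = "\<lambda>N. \<Sum>i<N. coeff_L2 f (int i) *\<^sub>C powi_hardy2 i"
  have "?s \<longlonglongrightarrow> riesz_proj f"
    unfolding riesz_proj_def using summable_riesz_proj by (rule summable_LIMSEQ)
  then have "(\<lambda>N. Rep_hardy2 (?s N)) \<longlonglongrightarrow> Rep_hardy2 (riesz_proj f)"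
    by (simp only: tendsto_Rep_hardy2_iff)
  from tendsto_coeff_L2[OF this, of n]
  have lim: "(\<lambda>N. coeff_L2 (Rep_hardy2 (?s N)) n) \<longlonglongrightarrow> coeff_L2 (Rep_hardy2 (riesz_proj f)) n" .
  have "coeff_L2 (Rep_hardy2 (?s N)) n = (if k < N then coeff_L2 f n else 0)" for N
    by (induction N) (auto simp: n less_Suc_eq zero_hardy2.rep_eq plus_hardy2.rep_eq coeff_L2_add scaleC_hardy2.rep_eq
        powi_hardy2.rep_eq coeff_L2_scaleC coeff_L2_powi)
  then have "coeff_L2 (Rep_hardy2 (?s N)) n = coeff_L2 f n" if "N \<ge> Suc k" for N
    using that by simp
  then have "(\<lambda>N. coeff_L2 (Rep_hardy2 (?s N)) n) \<longlonglongrightarrow> coeff_L2 f n"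
    by (intro tendsto_eventually eventually_sequentiallyI)
  with lim show ?thesis
    using True by (simp add: LIMSEQ_unique)
qed (simp add: Rep_hardy2_coeff)

lemma bounded_clinear_riesz_proj: "bounded_clinear riesz_proj"
  unfolding bounded_clinear_def
proof (intro conjI allI)
  have scale: "riesz_proj (c *\<^sub>C f) = c *\<^sub>C riesz_proj f" for c f
  proof -
    have bl: "bounded_linear (\<lambda>x :: hardy2. c *\<^sub>C x)"
      by (rule bounded_linear_intro[where K = "cmod c"])
         (simp_all add: scaleC_add_right scaleR_eq_scaleC scaleC_scaleC norm_scaleC mult.commute)
    show ?thesis
      unfolding riesz_proj_def
      by (subst bounded_linear.suminf[OF bl summable_riesz_proj])
         (simp add: coeff_L2_scaleC scaleC_scaleC)
  qed
  then show "riesz_proj (c *\<^sub>C f) = c *\<^sub>C riesz_proj f" for c f .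
  show "bounded_linear riesz_proj"
  proof (rule bounded_linear_intro[where K = 1])
    show "riesz_proj (f + g) = riesz_proj f + riesz_proj g" for f g
      unfolding riesz_proj_def
      by (subst suminf_add[OF summable_riesz_proj summable_riesz_proj])
         (simp add: coeff_L2_add scaleC_add_left)
    show "riesz_proj (r *\<^sub>R f) = r *\<^sub>R riesz_proj f" for r f
      by (simp add: scaleR_eq_scaleC scale)
    show "norm (riesz_proj f) \<le> norm f * 1" for f
    proof (rule LIMSEQ_le_const2)
      show "(\<lambda>N. norm (\<Sum>i<N. coeff_L2 f (int i) *\<^sub>C powi_hardy2 i)) \<longlonglongrightarrow> norm (riesz_proj f)"
        unfolding riesz_proj_def by (intro tendsto_norm summable_LIMSEQ summable_riesz_proj)
      have "norm (\<Sum>i<N. coeff_L2 f (int i) *\<^sub>C powi_hardy2 i) \<le> norm f" for N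
        by (rule power2_le_imp_le) (auto simp: sum_powi_hardy2_norm bessel_inequality)
      then show "\<exists>N. \<forall>n\<ge>N. norm (\<Sum>i<n. coeff_L2 f (int i) *\<^sub>C powi_hardy2 i) \<le> norm f * 1"
        by simp
    qed
  qed
qed

definition ess_bounded :: "(complex \<Rightarrow> complex) \<Rightarrow> bool"
  where "ess_bounded F \<longleftrightarrow> F \<in> borel_measurable circle \<and> (\<exists>C. AE z in circle. cmod (F z) \<le> C)"

lemma square_integrable_mult_ess_bounded:
  "ess_bounded F \<Longrightarrow> square_integrable f \<Longrightarrow> square_integrable (\<lambda>z. F z * f z)"
  unfolding ess_bounded_def using square_integrable_mult_bounded by blast

text \<open>
  Multiplication by a bounded symbol; the value 0 for other symbols is only there to make the
  operation total. Continuous symbols are covered by \<open>ess_bounded_continuous\<close>.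
\<close>

lift_definition mult_L2 :: "(complex \<Rightarrow> complex) \<Rightarrow> circle_L2 \<Rightarrow> circle_L2"
  is "\<lambda>F f. if ess_bounded F then (\<lambda>z. F z * f z) else (\<lambda>_. 0)"
  by (auto simp: square_integrable_0 intro: square_integrable_mult_ess_bounded elim: eventually_mono)

definition toeplitz :: "(complex \<Rightarrow> complex) \<Rightarrow> hardy2 \<Rightarrow> hardy2"
  where "toeplitz F f = riesz_proj (mult_L2 F (Rep_hardy2 f))"

lemma ess_bounded_continuous:
  assumes "continuous_on (sphere 0 1) F"
  shows "ess_bounded F"
proof -
  have "compact (F ` sphere 0 1)"
    using assms by (intro compact_continuous_image) auto
  then obtain C where "\<And>z. z \<in> sphere 0 1 \<Longrightarrow> cmod (F z) \<le> C"
    by (meson bounded_iff compact_imp_bounded imageI)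
  then show ?thesis
    unfolding ess_bounded_def using borel_measurable_circle_continuous[OF assms]
    by (auto intro!: exI[of _ C] simp: space_circle)
qed

lemma bounded_clinear_toeplitz: "bounded_clinear (toeplitz F)"
proof (cases "ess_bounded F")
  case False
  then have "mult_L2 F f = 0" for f
    by transfer (auto simp: square_integrable_0)
  then have "toeplitz F f = 0" for f
    using bounded_clinear_riesz_proj by (simp add: toeplitz_def bounded_clinear_def linear_simps)
  then have "toeplitz F = (\<lambda>_. 0)" by blast
  then show ?thesis
    using bounded_clinear_riesz_proj by (simp add: bounded_clinear_def scaleC_zero_right)
next
  case True
  then obtain C where F: "F \<in> borel_measurable circle" and C: "AE z in circle. cmod (F z) \<le> C"
    by (auto simp: ess_bounded_def)
  have sq: "square_integrable (\<lambda>z. F z * f z)" if "square_integrable f" for f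
    by (rule square_integrable_mult_bounded[OF F C that])
  have add: "mult_L2 F (f + g) = mult_L2 F f + mult_L2 F g" for f g
  proof -
    obtain u v where "square_integrable u" "f = abs_circle_L2 u" "square_integrable v" "g = abs_circle_L2 v"
      by (metis abs_circle_L2_cases)
    then show ?thesis
      by (simp add: mult_L2.abs_eq plus_circle_L2.abs_eq True sq square_integrable_add ring_distribs)
  qed
  have scale: "mult_L2 F (c *\<^sub>C f) = c *\<^sub>C mult_L2 F f" for c f
  proof -
    obtain u where "square_integrable u" "f = abs_circle_L2 u"
      by (rule abs_circle_L2_cases)
    then show ?thesis
      by (simp add: mult_L2.abs_eq scaleC_circle_L2.abs_eq True sq square_integrable_cmult mult.left_commute)
  qed
  have norm: "norm (mult_L2 F f) \<le> norm f * \<bar>C\<bar>" for f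
  proof -
    obtain h where h: "square_integrable h" "f = abs_circle_L2 h"
      by (rule abs_circle_L2_cases)
    have "(\<integral>z. (cmod (F z * h z))\<^sup>2 \<partial>circle) \<le> (\<integral>z. \<bar>C\<bar>\<^sup>2 * (cmod (h z))\<^sup>2 \<partial>circle)"
    proof (rule integral_mono_AE)
      show "AE z in circle. (cmod (F z * h z))\<^sup>2 \<le> \<bar>C\<bar>\<^sup>2 * (cmod (h z))\<^sup>2"
        using C by eventually_elim (auto simp: norm_mult power_mult_distrib intro!: mult_right_mono power_mono)
    qed (use h sq in \<open>auto simp: square_integrable_def\<close>)
    then have "sqrt (\<integral>z. (cmod (F z * h z))\<^sup>2 \<partial>circle) \<le> sqrt (\<bar>C\<bar>\<^sup>2 * (\<integral>z. (cmod (h z))\<^sup>2 \<partial>circle))"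
      by simp
    then show ?thesis
      using h sq[OF h(1)]
      by (simp add: mult_L2.abs_eq True norm_circle_L2_abs real_sqrt_mult mult.commute[of _ "\<bar>C\<bar>"])
  qed
  interpret P: bounded_linear riesz_proj
    using bounded_clinear_riesz_proj by (simp add: bounded_clinear_def)
  have P_scale: "riesz_proj (c *\<^sub>C f) = c *\<^sub>C riesz_proj f" for c f
    using bounded_clinear_riesz_proj by (simp add: bounded_clinear_def)
  have M: "bounded_linear (mult_L2 F)"
    by (rule bounded_linear_intro[where K = "\<bar>C\<bar>"]) (simp_all add: add scale scaleR_eq_scaleC norm)
  have R: "bounded_linear Rep_hardy2"
    by (rule bounded_linear_intro[where K = 1])
       (simp_all add: plus_hardy2.rep_eq scaleR_hardy2.rep_eq norm_hardy2.rep_eq)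
  have "bounded_linear (\<lambda>f. riesz_proj (mult_L2 F (Rep_hardy2 f)))"
    by (rule bounded_linear_compose[OF P.bounded_linear_axioms bounded_linear_compose[OF M R]])
  then show ?thesis
    unfolding bounded_clinear_def toeplitz_def[abs_def]
    by (simp add: scaleC_hardy2.rep_eq scale P_scale)
qed

text \<open>
  Pointwise equality with the Fourier series on the whole circle rules out functions that agree
  with an absolutely convergent Fourier series only almost everywhere.
\<close>

definition wiener_algebra :: "(complex \<Rightarrow> complex) set"
  where "wiener_algebra = {F. (\<lambda>n. cmod (fourier_coeff F n)) summable_on UNIV \<and>
    (\<forall>z\<in>sphere 0 1. ((\<lambda>n. fourier_coeff F n * z powi n) has_sum F z) UNIV)}"

definition modulus_of_continuity :: "(complex \<Rightarrow> complex) \<Rightarrow> real \<Rightarrow> real"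
  where "modulus_of_continuity f t =
    Sup {cmod (f z - f z') | z z'. z \<in> sphere 0 1 \<and> z' \<in> sphere 0 1 \<and> cmod (z - z') \<le> t}"

definition dini_algebra :: "(complex \<Rightarrow> complex) set"
  where "dini_algebra = {F. continuous_on (sphere 0 1) F \<and>
    (\<integral>\<^sup>+t\<in>{0<..<1}. ennreal (modulus_of_continuity F t / t) \<partial>lborel) < \<infinity>}"

end

theory Submission
  imports Defs "HOL-Library.Nat_Bijection"
begin

text \<open>
  Let \<open>a\<close> be the centre and \<open>r\<close> the radius of the disk, so that \<open>\<bar>a\<bar> = r\<close> because 0 lies on its
  boundary, and write \<open>T\<close> for the Toeplitz operator with symbol \<open>F\<close>. The point \<open>a\<close> is outside the
  spectrum, hence
  \<open>T = (T - a) (1 - Q)\<close> with \<open>Q = - a (T - a)\<^sup>-\<^sup>1\<close>.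
  Both factors have real powers, and these commute; their product is the semigroup.

  The factor \<open>T - a\<close>. As \<open>\<mu>\<close> moves inside the unbounded component of the resolvent set, \<open>T - \<mu>\<close> changes
  by factors \<open>1 - X\<close> with \<open>\<parallel>X\<parallel> < 1\<close>, whose powers are binomial series; for large \<open>\<mu>\<close> the operator
  \<open>T - \<mu>\<close> is itself a scalar times such a factor. So \<open>T - a\<close> lies on a norm continuous one-parameter
  group inside the bicommutant of \<open>T\<close> (\<open>has_powers_shift\<close>).

  The factor \<open>1 - Q\<close>. The coefficients of the binomial series are absolutely summable for every
  exponent \<open>t > 0\<close>, so \<open>(1 - Q)\<^sup>t\<close> makes sense as soon as \<open>Q\<close> is power bounded, and \<open>Q\<close> is in fact
  similar to a contraction. The values of \<open>F\<close> on the circle belong to the spectrum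
  (\<open>range_subset_op_spectrum_toeplitz\<close>), so \<open>F\<close> avoids the unbounded component and \<open>F - a = exp g\<close>
  with a continuous \<open>g\<close> (\<open>continuous_log_unbounded_component\<close>). Suppose that \<open>g = u + v\<close> with \<open>u\<close>
  bounded analytic and \<open>v\<close> bounded antianalytic. Then the Toeplitz operator of \<open>F - a\<close> is
  \<open>T(exp v) T(exp u)\<close> and its inverse is \<open>T(exp (-u)) T(exp (-v))\<close>, whereas \<open>T(1 / (F - a))\<close> is the
  product of the same two operators in the other order. Conjugation with \<open>T(exp u)\<close> therefore turns
  \<open>Q\<close> into the Toeplitz operator with symbol \<open>\<psi> = - a / (F - a)\<close>, and \<open>\<bar>\<psi>\<bar> \<le> 1\<close> because \<open>F\<close> stays
  outside the disk (\<open>c0_embeddable_toeplitz_if_log_splits\<close>).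

  Strong continuity at 0 amounts to the density of the range of \<open>1 - T(\<psi>)\<close>. By the mean ergodic argument
  (\<open>dense_range_one_minus_contraction\<close>) this holds if \<open>T(\<psi>)\<close> fixes no vector. A fixed vector \<open>f\<close>
  satisfies \<open>\<psi> f = f\<close>, so it vanishes on the open set of the circle where \<open>F \<noteq> 0\<close>, and a function in
  the Hardy space that vanishes on an arc is zero (\<open>hardy2_eq_0_if_vanishes_on_open\<close>).

  The splitting \<open>g = u + v\<close> is where the regularity of \<open>F\<close> enters. In the Wiener algebra \<open>g\<close> has again an
  absolutely convergent Fourier series, by an estimate in the style of Newman's proof of Wiener's
  lemma (\<open>splits_analytic_log_wiener\<close>). If \<open>F\<close> is Dini-continuous then so is \<open>g\<close>, and the Riesz
  projection of a Dini-continuous function is bounded (\<open>splits_analytic_log_dini\<close>).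

  If \<open>F\<close> vanishes on the whole circle there is no dense range to work with. In that case \<open>T = 0\<close>, and a
  nilpotent semigroup does the job (\<open>c0_embeddable_zero_hardy2\<close>).
\<close>

section \<open>Binomial series in Banach algebras\<close>

text \<open>
  The power \<open>(1 - X)\<^sup>t\<close>. The sort asks for a unit without \<open>\<parallel>1\<parallel> = 1\<close> or \<open>1 \<noteq> 0\<close>, so that it covers the
  bounded operators on an arbitrary Banach space, the zero space included.
\<close>

definition binomial_series :: "'e :: {real_normed_algebra, monoid_mult, banach} \<Rightarrow> real \<Rightarrow> 'e"
  where "binomial_series X t = (\<Sum>n. (t gchoose n) *\<^sub>R (- X) ^ n)"

definition binomial_summable :: "'e :: {real_normed_algebra, monoid_mult, banach} \<Rightarrow> real \<Rightarrow> bool"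
  where "binomial_summable X t \<longleftrightarrow> summable (\<lambda>n. norm ((t gchoose n) *\<^sub>R (- X) ^ n))"

text \<open>
  The Cauchy product of the two series has the coefficients \<open>(s + t) gchoose n\<close> by Vandermonde's identity.
\<close>

lemma binomial_series_add:
  assumes "binomial_summable X s" "binomial_summable X t"
  shows "binomial_series X (s + t) = binomial_series X s * binomial_series X t"
proof -
  let ?b = "\<lambda>t n. (t gchoose n) *\<^sub>R (- X) ^ n"
  have "(\<lambda>n. \<Sum>i\<le>n. ?b s i * ?b t (n - i)) sums ((\<Sum>n. ?b s n) * (\<Sum>n. ?b t n))"
    using assms by (intro Cauchy_product_sums) (simp_all add: binomial_summable_def)
  moreover have "(\<Sum>i\<le>n. ?b s i * ?b t (n - i)) = ?b (s + t) n" for n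
  proof -
    have "(\<Sum>i\<le>n. ?b s i * ?b t (n - i)) = (\<Sum>i\<le>n. ((s gchoose i) * (t gchoose (n - i))) *\<^sub>R (- X) ^ n)"
      by (intro sum.cong refl) (simp flip: power_add)
    also have "\<dots> = (\<Sum>i\<in>{0..n}. (s gchoose i) * (t gchoose (n - i))) *\<^sub>R (- X) ^ n"
      by (simp add: atLeast0AtMost scaleR_left.sum)
    finally show ?thesis by (simp only: gbinomial_Vandermonde)
  qed
  ultimately show ?thesis
    by (simp add: binomial_series_def sums_iff)
qed

lemma binomial_series_0: "binomial_series X 0 = 1"
proof -
  have "(\<Sum>n. ((0::real) gchoose n) *\<^sub>R (- X) ^ n) = (\<Sum>n\<in>{0}. ((0::real) gchoose n) *\<^sub>R (- X) ^ n)"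
    by (rule suminf_finite) (auto simp: gbinomial_0_left)
  then show ?thesis by (simp add: binomial_series_def)
qed

lemma gbinomial_1_eq_0: "n \<ge> 2 \<Longrightarrow> (1 :: real) gchoose n = 0"
  using binomial_gbinomial[of 1 n, where 'a = real] by (simp add: binomial_eq_0)

lemma binomial_series_1: "binomial_series X 1 = 1 - X"
proof -
  have "(\<Sum>n. ((1::real) gchoose n) *\<^sub>R (- X) ^ n) = (\<Sum>n\<in>{0,1}. ((1::real) gchoose n) *\<^sub>R (- X) ^ n)"
    by (rule suminf_finite) (auto intro!: gbinomial_1_eq_0)
  then show ?thesis by (simp add: binomial_series_def)
qed

lemma binomial_series_commute:
  assumes "binomial_summable X t" "S * X = X * S"
  shows "S * binomial_series X t = binomial_series X t * S"
proof -
  have sm: "summable (\<lambda>n. (t gchoose n) *\<^sub>R (- X) ^ n)"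
    using assms(1) unfolding binomial_summable_def by (rule summable_norm_cancel)
  have "S * (- X) ^ n = (- X) ^ n * S" for n
    by (rule power_commuting_commutes[symmetric]) (simp add: assms(2))
  then have "S * ((t gchoose n) *\<^sub>R (- X) ^ n) = ((t gchoose n) *\<^sub>R (- X) ^ n) * S" for n
    by simp
  then show ?thesis
    unfolding binomial_series_def by (simp only: suminf_mult[OF sm, symmetric] suminf_mult2[OF sm])
qed

lemma norm_power_le_monoid:
  fixes X :: "'e :: {real_normed_algebra, monoid_mult}"
  shows "norm (X ^ n) \<le> norm (1 :: 'e) * norm X ^ n"
proof (induction n)
  case (Suc n)
  have "norm (X ^ Suc n) = norm (X ^ n * X)" by (simp add: power_commutes)
  also have "\<dots> \<le> norm (X ^ n) * norm X" by (rule norm_mult_ineq)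
  also have "\<dots> \<le> (norm (1 :: 'e) * norm X ^ n) * norm X"
    by (intro mult_right_mono Suc.IH) simp
  finally show ?case by (simp add: mult_ac)
qed simp

lemma binomial_summable_norm_lt_1:
  fixes X :: "'e :: {real_normed_algebra, monoid_mult, banach}"
  assumes "norm X < 1"
  shows "binomial_summable X t"
  unfolding binomial_summable_def
proof (rule summable_comparison_test')
  have "summable (\<lambda>n. norm ((t gchoose n) * (norm X) ^ n))"
    using assms by (intro abs_summable_in_conv_radius) (simp add: conv_radius_gchoose)
  then show "summable (\<lambda>n. norm (1 :: 'e) * norm ((t gchoose n) * (norm X) ^ n))"
    by (rule summable_mult)
  show "norm (norm ((t gchoose n) *\<^sub>R (- X) ^ n)) \<le> norm (1 :: 'e) * norm ((t gchoose n) * (norm X) ^ n)"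
    if "n \<ge> 0" for n
  proof -
    have "\<bar>t gchoose n\<bar> * norm ((- X) ^ n) \<le> \<bar>t gchoose n\<bar> * (norm (1 :: 'e) * norm X ^ n)"
      using norm_power_le_monoid[of "- X" n] by (intro mult_left_mono) simp_all
    then show ?thesis by (simp add: abs_mult mult_ac)
  qed
qed

text \<open>
  Each step of the recursion multiplies by \<open>(t - n) / (n + 1)\<close>, which has modulus at most 1. The
  factor \<open>\<bar>t\<bar>\<close> that survives gives norm continuity of the powers at 0.
\<close>

lemma abs_gbinomial_le:
  assumes "\<bar>t :: real\<bar> \<le> 1" "n \<ge> 1"
  shows "\<bar>t gchoose n\<bar> \<le> \<bar>t\<bar>"
  using assms(2)
proof (induction n rule: dec_induct)
  case (step n)
  have "of_nat (Suc n) * (t gchoose Suc n) = (t - of_nat n) * (t gchoose n)"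
    using gbinomial_mult_1[of t n] by (simp add: algebra_simps)
  then have "real (Suc n) * \<bar>t gchoose Suc n\<bar> = \<bar>t - of_nat n\<bar> * \<bar>t gchoose n\<bar>"
    by (metis abs_mult abs_of_nat)
  also have "\<dots> \<le> real (Suc n) * \<bar>t\<bar>"
    using assms(1) step by (intro mult_mono) auto
  finally show ?case by (simp add: mult_le_cancel_left)
qed simp

lemma tendsto_binomial_series_norm_lt_1:
  fixes X :: "'e :: {real_normed_algebra, monoid_mult, banach}"
  assumes "norm X < 1"
  shows "(binomial_series X \<longlongrightarrow> 1) (at 0)"
proof -
  define C where "C = (\<Sum>n. norm (1 :: 'e) * norm X ^ n)"
  have geo: "summable (\<lambda>n. norm (1 :: 'e) * norm X ^ n)"
    using assms by (intro summable_mult summable_geometric) simp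
  have le: "norm (binomial_series X t - 1) \<le> C * \<bar>t\<bar>" if "\<bar>t\<bar> \<le> 1" for t
  proof -
    let ?b = "\<lambda>n. (t gchoose n) *\<^sub>R (- X) ^ n"
    have sm: "summable (\<lambda>n. norm (?b n))"
      using binomial_summable_norm_lt_1[OF assms] by (simp add: binomial_summable_def)
    have "binomial_series X t - 1 = (\<Sum>n. ?b (Suc n))"
      unfolding binomial_series_def using suminf_split_head[OF summable_norm_cancel[OF sm]] by simp
    also have "norm \<dots> \<le> (\<Sum>n. norm (?b (Suc n)))"
      using sm by (intro summable_norm) (subst summable_Suc_iff)
    also have "\<dots> \<le> (\<Sum>n. (norm (1 :: 'e) * norm X ^ n) * \<bar>t\<bar>)"
    proof (rule suminf_le)
      show "norm (?b (Suc n)) \<le> norm (1 :: 'e) * norm X ^ n * \<bar>t\<bar>" for n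
      proof -
        have "norm (?b (Suc n)) \<le> \<bar>t\<bar> * (norm (1 :: 'e) * norm X ^ Suc n)"
          using norm_power_le_monoid[of "- X" "Suc n"] abs_gbinomial_le[OF that, of "Suc n"]
          by (simp only: norm_scaleR norm_minus_cancel) (rule mult_mono, auto)
        also have "norm X ^ Suc n \<le> norm X ^ n"
          using assms by (intro power_decreasing) auto
        then have "\<bar>t\<bar> * (norm (1 :: 'e) * norm X ^ Suc n) \<le> \<bar>t\<bar> * (norm (1 :: 'e) * norm X ^ n)"
          by (intro mult_left_mono) auto
        finally show ?thesis by (simp add: mult_ac)
      qed
      show "summable (\<lambda>n. norm (?b (Suc n)))" using sm by (subst summable_Suc_iff)
      show "summable (\<lambda>n. norm (1 :: 'e) * norm X ^ n * \<bar>t\<bar>)" by (intro summable_mult2 geo)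
    qed
    also have "\<dots> = C * \<bar>t\<bar>" unfolding C_def by (rule suminf_mult2[OF geo, symmetric])
    finally show ?thesis .
  qed
  have "((\<lambda>t. binomial_series X t - 1) \<longlongrightarrow> 0) (at 0)"
  proof (rule Lim_null_comparison)
    show "\<forall>\<^sub>F t in at 0. norm (binomial_series X t - 1) \<le> C * \<bar>t\<bar>"
      unfolding eventually_at by (rule exI[of _ 1]) (auto intro: le)
    show "((\<lambda>t. C * \<bar>t\<bar>) \<longlongrightarrow> 0) (at 0)"
      by (auto intro!: tendsto_eq_intros)
  qed
  then show ?thesis by (simp add: LIM_zero_iff)
qed

section \<open>The binomial series of a contraction\<close>

text \<open>
  From index 1 on, the coefficients of \<open>(1 - x)\<^sup>t\<close> with \<open>0 < t \<le> 1\<close> all have the same sign; for the exponent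
  \<open>1 + t\<close> this holds from index 2 on. Sums of absolute values then telescope.
\<close>

lemma gbinomial_sign_le_1:
  assumes "0 < t" "t \<le> (1 :: real)"
  shows "(-1) ^ n * (t - 1 gchoose n) \<in> {0..1}" "(-1) ^ n * (t gchoose Suc n) \<ge> 0"
    and "(-1) ^ n * (1 + t gchoose Suc (Suc n)) \<ge> 0"
proof -
  have *: "(-1) ^ n * (t - 1 gchoose n) \<in> {0..1}" for n
  proof (induction n)
    case (Suc n)
    have "of_nat (Suc n) * (t - 1 gchoose Suc n) = (t - 1 - of_nat n) * (t - 1 gchoose n)"
      using gbinomial_mult_1[of "t - 1" n] by (simp add: algebra_simps)
    then have "t - 1 gchoose Suc n = - ((n + 1 - t) / (n + 1)) * (t - 1 gchoose n)"
      by (simp add: field_simps)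
    then have "(-1) ^ Suc n * (t - 1 gchoose Suc n) = ((n + 1 - t) / (n + 1)) * ((-1) ^ n * (t - 1 gchoose n))"
      by simp
    moreover have "(n + 1 - t) / (n + 1) \<in> {0..1}" using assms by (auto simp: field_simps)
    ultimately show ?case
      using Suc.IH mult_nonneg_nonneg[of "(n + 1 - t) / (n + 1)" "(-1) ^ n * (t - 1 gchoose n)"]
        mult_le_one[of "(n + 1 - t) / (n + 1)" "(-1) ^ n * (t - 1 gchoose n)"]
      by (simp only: atLeastAtMost_iff)
  qed simp
  show "(-1) ^ n * (t - 1 gchoose n) \<in> {0..1}" by (rule *)
  have **: "(-1) ^ n * (t gchoose Suc n) \<ge> 0" for n
  proof -
    have "(-1) ^ n * (t gchoose Suc n) = t / (n + 1) * ((-1) ^ n * (t - 1 gchoose n))"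
      using gbinomial_factors[of "t - 1" n] by simp
    then show ?thesis using *[of n] assms by simp
  qed
  then show "(-1) ^ n * (t gchoose Suc n) \<ge> 0" .
  have "(-1) ^ n * (1 + t gchoose Suc (Suc n)) = (1 + t) / (n + 2) * ((-1) ^ n * (t gchoose Suc n))"
    using gbinomial_factors[of "t" "Suc n"] by (simp add: add.commute)
  then show "(-1) ^ n * (1 + t gchoose Suc (Suc n)) \<ge> 0" using **[of n] assms by simp
qed

text \<open>
  The alternating partial sums of \<open>t gchoose k\<close> are \<open>(-1)\<^sup>m (t - 1 gchoose m)\<close>, and all signs are known.
\<close>

lemma sum_abs_gbinomial_le:
  assumes "0 < t" "t \<le> (1 :: real)"
  shows "(\<Sum>n<m. \<bar>t gchoose Suc n\<bar>) \<le> 1" "(\<Sum>n<m. \<bar>1 + t gchoose Suc (Suc n)\<bar>) \<le> t"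
proof -
  have eq: "\<bar>t gchoose Suc n\<bar> = (-1) ^ n * (t gchoose Suc n)"
    "\<bar>1 + t gchoose Suc (Suc n)\<bar> = (-1) ^ n * (1 + t gchoose Suc (Suc n))" for n
    using gbinomial_sign_le_1(2,3)[OF assms, of n] by (auto simp: abs_if uminus_power_if power_minus_odd split: if_splits)
  have "1 - (\<Sum>n<m. \<bar>t gchoose Suc n\<bar>) = (\<Sum>k\<le>m. (t gchoose k) * (- 1) ^ k)"
    unfolding eq by (simp add: sum.atMost_shift sum_negf[symmetric] mult.commute)
  also have "\<dots> \<ge> 0"
    using gbinomial_sign_le_1(1)[OF assms, of m] by (simp add: gbinomial_sum_lower_neg)
  finally show "(\<Sum>n<m. \<bar>t gchoose Suc n\<bar>) \<le> 1" by simp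
  have "1 - (1 + t) + (\<Sum>n<m. \<bar>1 + t gchoose Suc (Suc n)\<bar>) = (\<Sum>k\<le>Suc m. (1 + t gchoose k) * (- 1) ^ k)"
    unfolding eq sum.atMost_shift lessThan_Suc_atMost by (simp add: sum.lessThan_Suc_shift mult.commute del: sum.lessThan_Suc)
  also have "\<dots> = - ((-1) ^ m * (t gchoose Suc m))"
    by (subst gbinomial_sum_lower_neg) simp
  also have "\<dots> \<le> 0" using gbinomial_sign_le_1(2)[OF assms, of m] by simp
  finally show "(\<Sum>n<m. \<bar>1 + t gchoose Suc (Suc n)\<bar>) \<le> t" by simp
qed

text \<open>
  Pascal's rule carries summability from \<open>t\<close> to \<open>t + 1\<close>, starting from \<open>0 < t \<le> 1\<close>.
\<close>

lemma summable_abs_gbinomial: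
  assumes "0 < (t :: real)"
  shows "summable (\<lambda>n. \<bar>t gchoose n\<bar>)"
proof -
  have small: "summable (\<lambda>n. \<bar>t gchoose n\<bar>)" if "0 < t" "t \<le> 1" for t :: real
  proof -
    have "summable (\<lambda>n. \<bar>t gchoose Suc n\<bar>)"
      by (rule summableI_nonneg_bounded[where x = 1]) (use sum_abs_gbinomial_le(1)[OF that] in auto)
    then show ?thesis by (subst (asm) summable_Suc_iff)
  qed
  have "summable (\<lambda>n. \<bar>t gchoose n\<bar>)" if "0 < t" "t \<le> 1 + real m" for t :: real and m
    using that
  proof (induction m arbitrary: t)
    case (Suc m)
    show ?case
    proof (cases "t \<le> 1")
      case False
      then have IH: "summable (\<lambda>n. \<bar>t - 1 gchoose n\<bar>)"
        using Suc.prems by (intro Suc.IH) auto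
      have "summable (\<lambda>n. \<bar>t - 1 gchoose n\<bar> + \<bar>t - 1 gchoose Suc n\<bar>)"
        using IH by (intro summable_add) (simp_all add: summable_Suc_iff[of "\<lambda>n. \<bar>t - 1 gchoose n\<bar>"])
      then have "summable (\<lambda>n. \<bar>t gchoose Suc n\<bar>)"
        by (rule summable_comparison_test'[where N = 0])
           (use gbinomial_Suc_Suc[of "t - 1"] in auto)
      then show ?thesis by (subst (asm) summable_Suc_iff)
    qed (use small Suc.prems in auto)
  qed (use small in auto)
  then show ?thesis
    using assms real_nat_ceiling_ge[of t] by (metis add.commute add_increasing2 order_refl le_add_same_cancel2 zero_le_one order_trans)
qed

lemma binomial_summable_contraction:
  fixes X :: "'e :: {real_normed_algebra, monoid_mult, banach}"
  assumes "norm X \<le> 1" "0 < t"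
  shows "binomial_summable X t"
  unfolding binomial_summable_def
proof (rule summable_comparison_test')
  show "summable (\<lambda>n. \<bar>t gchoose n\<bar> * norm (1 :: 'e))"
    by (intro summable_mult2 summable_abs_gbinomial assms)
  show "norm (norm ((t gchoose n) *\<^sub>R (- X) ^ n)) \<le> \<bar>t gchoose n\<bar> * norm (1 :: 'e)" if "n \<ge> 0" for n
  proof -
    have "norm ((- X) ^ n) \<le> norm (1 :: 'e) * norm X ^ n"
      using norm_power_le_monoid[of "- X" n] by simp
    also have "\<dots> \<le> norm (1 :: 'e) * 1"
      using assms(1) by (intro mult_left_mono power_le_one) auto
    finally show ?thesis by (simp add: mult_left_mono)
  qed
qed

text \<open>
  These two bounds give strong continuity at 0: the powers \<open>(1 - X)\<^sup>t\<close> are uniformly bounded, and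
  \<open>(1 - X)\<^sup>t (1 - X)\<close> tends to \<open>1 - X\<close> even in norm.
\<close>

lemma norm_binomial_series_contraction:
  fixes X :: "'e :: {real_normed_algebra, monoid_mult, banach}"
  assumes "norm (1 :: 'e) \<le> 1" "norm X \<le> 1" "0 < t" "t \<le> 1"
  shows "norm (binomial_series X t) \<le> 2"
    and "norm (binomial_series X (1 + t) - (1 - X)) \<le> 2 * t"
proof -
  have pow: "norm ((- X) ^ n) \<le> 1" for n
  proof -
    have "norm ((- X) ^ n) \<le> norm (1 :: 'e) * norm X ^ n"
      using norm_power_le_monoid[of "- X" n] by simp
    also have "\<dots> \<le> 1 * 1"
      using assms by (intro mult_mono power_le_one) auto
    finally show ?thesis by simp
  qed
  have bound: "norm (\<Sum>n. c n *\<^sub>R (- X) ^ (n + k)) \<le> B"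
    if c: "summable (\<lambda>n. \<bar>c n\<bar>)" "\<And>m. (\<Sum>n<m. \<bar>c n\<bar>) \<le> B" for c :: "nat \<Rightarrow> real" and k B
  proof -
    have le: "norm (c n *\<^sub>R (- X) ^ (n + k)) \<le> \<bar>c n\<bar>" for n
      using pow[of "n + k"] by (simp add: mult_left_le)
    have "norm (\<Sum>n. c n *\<^sub>R (- X) ^ (n + k)) \<le> (\<Sum>n. \<bar>c n\<bar>)"
      using c(1) le by (intro norm_suminf_le) auto
    also have "\<dots> \<le> B" using c by (intro suminf_le_const) auto
    finally show ?thesis .
  qed
  have sm: "summable (\<lambda>n. (s gchoose n) *\<^sub>R (- X) ^ n)" if "s > 0" for s
    using binomial_summable_contraction[OF assms(2) that]
    unfolding binomial_summable_def by (rule summable_norm_cancel)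
  have "binomial_series X t = 1 + (\<Sum>n. (t gchoose Suc n) *\<^sub>R (- X) ^ (n + 1))"
    using suminf_split_head[OF sm[OF assms(3)]] by (simp add: binomial_series_def)
  also have "norm \<dots> \<le> 1 + 1"
  proof (intro norm_triangle_mono bound sum_abs_gbinomial_le)
    show "summable (\<lambda>n. \<bar>t gchoose Suc n\<bar>)"
      using summable_abs_gbinomial[OF assms(3)] by (subst summable_Suc_iff)
  qed (use assms in auto)
  finally show "norm (binomial_series X t) \<le> 2" by simp
  have "binomial_series X (1 + t)
      = (\<Sum>n. (1 + t gchoose (n + 2)) *\<^sub>R (- X) ^ (n + 2)) + (\<Sum>n<2. (1 + t gchoose n) *\<^sub>R (- X) ^ n)"
    unfolding binomial_series_def using assms by (intro suminf_split_initial_segment sm) simp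
  then have "binomial_series X (1 + t) - (1 - X)
      = (\<Sum>n. (1 + t gchoose (n + 2)) *\<^sub>R (- X) ^ (n + 2)) - t *\<^sub>R X"
    by (simp add: numeral_2_eq_2 scaleR_add_left)
  also have "norm \<dots> \<le> t + t"
  proof (intro norm_triangle_le_diff add_mono bound)
    show "summable (\<lambda>n. \<bar>1 + t gchoose (n + 2)\<bar>)"
      using assms summable_abs_gbinomial[of "1 + t"] by (subst summable_iff_shift) auto
    show "(\<Sum>n<m. \<bar>1 + t gchoose (n + 2)\<bar>) \<le> t" for m
      using sum_abs_gbinomial_le(2)[OF assms(3,4), of m] by simp
    show "norm (t *\<^sub>R X) \<le> t" using assms by (simp add: mult_left_le)
  qed
  finally show "norm (binomial_series X (1 + t) - (1 - X)) \<le> 2 * t" by simp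
qed

section \<open>The algebra of bounded operators\<close>

text \<open>
  A copy of the type of bounded linear maps from a space to itself, which can carry composition as
  its multiplication; powers, Cauchy products and the binomial series then apply to operators.
\<close>

typedef (overloaded) 'a endo = "UNIV :: ('a :: real_normed_vector \<Rightarrow>\<^sub>L 'a) set"
  by simp

setup_lifting type_definition_endo

instantiation endo :: (real_normed_vector) real_normed_algebra
begin

lift_definition zero_endo :: "'a endo" is 0 .
lift_definition plus_endo :: "'a endo \<Rightarrow> 'a endo \<Rightarrow> 'a endo" is "(+)" .
lift_definition uminus_endo :: "'a endo \<Rightarrow> 'a endo" is uminus .
lift_definition minus_endo :: "'a endo \<Rightarrow> 'a endo \<Rightarrow> 'a endo" is "(-)" .
lift_definition times_endo :: "'a endo \<Rightarrow> 'a endo \<Rightarrow> 'a endo" is blinfun_compose .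
lift_definition scaleR_endo :: "real \<Rightarrow> 'a endo \<Rightarrow> 'a endo" is scaleR .
lift_definition norm_endo :: "'a endo \<Rightarrow> real" is norm .
lift_definition sgn_endo :: "'a endo \<Rightarrow> 'a endo" is sgn .
lift_definition dist_endo :: "'a endo \<Rightarrow> 'a endo \<Rightarrow> real" is dist .

definition uniformity_endo :: "('a endo \<times> 'a endo) filter"
  where "uniformity_endo = (INF e\<in>{0 <..}. principal {(x, y). dist x y < e})"

definition open_endo :: "'a endo set \<Rightarrow> bool"
  where "open_endo U = (\<forall>x\<in>U. eventually (\<lambda>(x', y). x' = x \<longrightarrow> y \<in> U) uniformity)"

instance
proof
  fix A B D :: "'a endo" and r s :: real and U :: "'a endo set"
  show "A + B + D = A + (B + D)" by transfer (rule add.assoc)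
  show "A + B = B + A" by transfer (rule add.commute)
  show "0 + A = A" by transfer (rule add_0_left)
  show "- A + A = 0" by transfer (rule left_minus)
  show "A - B = A + - B" by transfer (rule diff_conv_add_uminus)
  show "r *\<^sub>R (A + B) = r *\<^sub>R A + r *\<^sub>R B" by transfer (rule scaleR_add_right)
  show "(r + s) *\<^sub>R A = r *\<^sub>R A + s *\<^sub>R A" by transfer (rule scaleR_add_left)
  show "r *\<^sub>R s *\<^sub>R A = (r * s) *\<^sub>R A" by transfer (rule scaleR_scaleR)
  show "1 *\<^sub>R A = A" by transfer (rule scaleR_one)
  show "A * B * D = A * (B * D)" by transfer (auto intro: blinfun_eqI)
  show "(A + B) * D = A * D + B * D" by transfer (rule bounded_bilinear.add_left[OF bounded_bilinear_blinfun_compose])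
  show "A * (B + D) = A * B + A * D" by transfer (rule bounded_bilinear.add_right[OF bounded_bilinear_blinfun_compose])
  show "r *\<^sub>R A * B = r *\<^sub>R (A * B)" by transfer (rule bounded_bilinear.scaleR_left[OF bounded_bilinear_blinfun_compose])
  show "A * r *\<^sub>R B = r *\<^sub>R (A * B)" by transfer (rule bounded_bilinear.scaleR_right[OF bounded_bilinear_blinfun_compose])
  show "sgn A = inverse (norm A) *\<^sub>R A" by transfer (rule sgn_div_norm)
  show "dist A B = norm (A - B)" by transfer (rule dist_norm)
  show "uniformity = (INF e\<in>{0 <..}. principal {(x :: 'a endo, y). dist x y < e})"
    by (rule uniformity_endo_def)
  show "open U = (\<forall>x\<in>U. eventually (\<lambda>(x', y). x' = x \<longrightarrow> y \<in> U) uniformity)"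
    by (rule open_endo_def)
  show "norm A = 0 \<longleftrightarrow> A = 0" by transfer (rule norm_eq_zero)
  show "norm (A + B) \<le> norm A + norm B" by transfer (rule norm_triangle_ineq)
  show "norm (r *\<^sub>R A) = \<bar>r\<bar> * norm A" by transfer (rule norm_scaleR)
  show "norm (A * B) \<le> norm A * norm B" by transfer (rule norm_blinfun_compose)
qed

end

instantiation endo :: (real_normed_vector) monoid_mult
begin
lift_definition one_endo :: "'a endo" is id_blinfun .
instance
proof
  fix A :: "'a endo"
  show "1 * A = A" by transfer (simp add: blinfun_eqI)
  show "A * 1 = A" by transfer (simp add: blinfun_eqI)
qed
end

instance endo :: (banach) banach
proof
  fix X :: "nat \<Rightarrow> 'a endo"
  assume "Cauchy X"
  then have "Cauchy (\<lambda>n. Rep_endo (X n))"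
    by (simp add: Cauchy_def dist_endo.rep_eq)
  then obtain L where "(\<lambda>n. Rep_endo (X n)) \<longlonglongrightarrow> L"
    using Cauchy_convergent convergent_def by blast
  then have "X \<longlonglongrightarrow> Abs_endo L"
    unfolding tendsto_dist_iff[of X] tendsto_dist_iff[of "\<lambda>n. Rep_endo (X n)"]
    by (simp add: dist_endo.rep_eq Abs_endo_inverse)
  then show "convergent X"
    by (rule convergentI)
qed

lift_definition endo_app :: "'a :: real_normed_vector endo \<Rightarrow> 'a \<Rightarrow> 'a" is blinfun_apply .
lift_definition Endo :: "('a :: real_normed_vector \<Rightarrow> 'a) \<Rightarrow> 'a endo" is Blinfun .

lemma endo_app_Endo: "bounded_linear f \<Longrightarrow> endo_app (Endo f) = f"
  by transfer (rule bounded_linear_Blinfun_apply)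

lemma bounded_linear_endo_app: "bounded_linear (endo_app A)"
  by transfer (rule blinfun.bounded_linear_right)

lemma endo_app_simps [simp]:
  "endo_app (A * B) x = endo_app A (endo_app B x)"
  "endo_app (A + B) x = endo_app A x + endo_app B x"
  "endo_app (A - B) x = endo_app A x - endo_app B x"
  "endo_app (- A) x = - endo_app A x"
  "endo_app (r *\<^sub>R A) x = r *\<^sub>R endo_app A x"
  "endo_app 1 x = x" "endo_app 0 x = 0"
  by (transfer, simp add: blinfun.bilinear_simps)+

lemma norm_endo_app: "norm (endo_app A x) \<le> norm A * norm x"
  by transfer (rule norm_blinfun)

lemma endo_eqI: "(\<And>x. endo_app A x = endo_app B x) \<Longrightarrow> A = B"
  by transfer (rule blinfun_eqI)

lemma norm_endo_bound: "0 \<le> b \<Longrightarrow> (\<And>x. norm (endo_app A x) \<le> b * norm x) \<Longrightarrow> norm A \<le> b"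
  by transfer (rule norm_blinfun_bound)

lemma norm_one_endo_le: "norm (1 :: 'a :: real_normed_vector endo) \<le> 1"
  by (rule norm_endo_bound) auto

text \<open>
  Complex scalars as operators. A real linear operator is complex linear if and only if it commutes
  with all of them, so complex linearity becomes a statement inside the operator algebra.
\<close>

definition cscale :: "complex \<Rightarrow> 'a :: complex_banach endo"
  where "cscale c = Endo (\<lambda>x. c *\<^sub>C x)"

lemma endo_app_cscale [simp]: "endo_app (cscale c) x = c *\<^sub>C x"
proof -
  have "bounded_linear (\<lambda>x :: 'a. c *\<^sub>C x)"
    by (rule bounded_linear_intro[where K = "cmod c"])
       (simp_all add: scaleC_add_right scaleR_eq_scaleC scaleC_scaleC norm_scaleC mult.commute)
  then show ?thesis by (simp add: cscale_def endo_app_Endo)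
qed

lemma cscale_add: "cscale (a + b) = cscale a + cscale b"
  and cscale_mult: "cscale (a * b) = cscale a * cscale b"
  by (auto intro!: endo_eqI simp: scaleC_add_left scaleC_scaleC)

lemma cscale_1: "cscale 1 = 1"
proof (rule endo_eqI)
  show "endo_app (cscale 1) x = endo_app 1 x" for x :: 'a
    using scaleR_eq_scaleC[of 1 x] by simp
qed

lemma cscale_0: "cscale 0 = 0"
  using cscale_add[of 0 0, where 'a = 'a] by simp

lemma cscale_diff: "cscale (a - b) = cscale a - cscale b"
  using cscale_add[of "a - b" b, where 'a = 'a] by (simp add: eq_diff_eq)

lemma cscale_commute: "cscale a * cscale b = cscale b * cscale a"
  by (simp add: mult.commute flip: cscale_mult)

lemma norm_cscale_le: "norm (cscale c :: 'a :: complex_banach endo) \<le> cmod c"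
  by (rule norm_endo_bound) (auto simp: norm_scaleC)

definition clin :: "'a :: complex_banach endo \<Rightarrow> bool"
  where "clin A \<longleftrightarrow> (\<forall>c. A * cscale c = cscale c * A)"

lemma clin_commute: "clin A \<Longrightarrow> A * cscale c = cscale c * A"
  by (simp add: clin_def)

lemma bounded_clinear_endo_app: "clin A \<Longrightarrow> bounded_clinear (endo_app A)"
  unfolding bounded_clinear_def clin_def
  by (metis bounded_linear_endo_app endo_app_cscale endo_app_simps(1))

lemma clin_Endo: "bounded_clinear f \<Longrightarrow> clin (Endo f) \<and> endo_app (Endo f) = f"
  by (auto simp: clin_def bounded_clinear_def endo_app_Endo intro!: endo_eqI)

lemma clin_mult: "clin A \<Longrightarrow> clin B \<Longrightarrow> clin (A * B)"
  unfolding clin_def by (metis mult.assoc)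

lemma clin_cscale: "clin (cscale c)"
  by (simp add: clin_def cscale_commute)

lemma clin_diff: "clin A \<Longrightarrow> clin B \<Longrightarrow> clin (A - B)"
  by (simp add: clin_def algebra_simps)

lemma clin_1: "clin 1"
  by (simp add: clin_def)

lemma not_in_op_spectrum_iff:
  fixes T :: "'a :: complex_banach endo"
  shows "c \<notin> op_spectrum (endo_app T) \<longleftrightarrow>
    (\<exists>R. clin R \<and> R * (T - cscale c) = 1 \<and> (T - cscale c) * R = 1)"
proof -
  have *: "(\<lambda>x. endo_app T x - c *\<^sub>C x) = endo_app (T - cscale c)" by auto
  show ?thesis
  proof
    assume "c \<notin> op_spectrum (endo_app T)"
    then obtain B where B: "bounded_clinear B" "B \<circ> endo_app (T - cscale c) = id"
      "endo_app (T - cscale c) \<circ> B = id"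
      by (auto simp: op_spectrum_def *)
    then show "\<exists>R. clin R \<and> R * (T - cscale c) = 1 \<and> (T - cscale c) * R = 1"
      using clin_Endo[OF B(1)] by (intro exI[of _ "Endo B"]) (auto intro!: endo_eqI simp: fun_eq_iff)
  next
    assume "\<exists>R. clin R \<and> R * (T - cscale c) = 1 \<and> (T - cscale c) * R = 1"
    then obtain R where R: "clin R" "R * (T - cscale c) = 1" "(T - cscale c) * R = 1" by blast
    then have "endo_app R \<circ> endo_app (T - cscale c) = id" "endo_app (T - cscale c) \<circ> endo_app R = id"
      by (simp_all only: fun_eq_iff comp_apply endo_app_simps(1)[symmetric]) simp_all
    then show "c \<notin> op_spectrum (endo_app T)"
      using bounded_clinear_endo_app[OF R(1)] by (auto simp: op_spectrum_def *)
  qed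
qed

section \<open>Norm continuous powers off the spectrum\<close>

text \<open>
  Complex linearity of \<open>S\<close> is required because the powers constructed below involve complex scalars.
\<close>

definition bicommutes :: "'a :: complex_banach endo \<Rightarrow> 'a endo \<Rightarrow> bool"
  where "bicommutes T U \<longleftrightarrow> (\<forall>S. clin S \<longrightarrow> S * T = T * S \<longrightarrow> S * U = U * S)"

lemma bicommutesD: "bicommutes T U \<Longrightarrow> clin S \<Longrightarrow> S * T = T * S \<Longrightarrow> S * U = U * S"
  by (simp add: bicommutes_def)

lemma bicommutes_mult: "bicommutes T U \<Longrightarrow> bicommutes T V \<Longrightarrow> bicommutes T (U * V)"
  unfolding bicommutes_def by (metis mult.assoc)

lemma bicommutes_cscale: "bicommutes T (cscale c)"
  by (simp add: bicommutes_def clin_def)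

lemma bicommutes_self: "bicommutes T T"
  by (simp add: bicommutes_def)

lemma bicommutes_imp_clin:
  assumes "clin T" "bicommutes T U"
  shows "clin U"
  unfolding clin_def
proof
  fix c
  have "cscale c * U = U * cscale c"
    using assms by (intro bicommutesD[OF assms(2)] clin_cscale) (simp add: clin_commute)
  then show "U * cscale c = cscale c * U" by simp
qed

lemma bicommutes_commute:
  assumes "clin T" "bicommutes T U" "bicommutes T V"
  shows "U * V = V * U"
proof (rule bicommutesD[OF assms(3)])
  show "clin U" using assms bicommutes_imp_clin by blast
  show "U * T = T * U" using bicommutesD[OF assms(2) assms(1)] by simp
qed

lemma bicommutes_inverse:
  assumes "clin T" "R * (T - cscale c) = 1" "(T - cscale c) * R = 1"
  shows "bicommutes T R"
  unfolding bicommutes_def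
proof (intro allI impI)
  fix S assume S: "clin S" "S * T = T * S"
  then have *: "S * (T - cscale c) = (T - cscale c) * S"
    by (simp add: algebra_simps clin_commute)
  have "S * R = R * (T - cscale c) * S * R" by (simp add: assms)
  also have "\<dots> = R * (S * (T - cscale c)) * R" by (simp add: mult.assoc *)
  also have "\<dots> = R * S" by (simp add: mult.assoc assms)
  finally show "S * R = R * S" .
qed

definition norm_group :: "(real \<Rightarrow> 'a :: complex_banach endo) \<Rightarrow> bool"
  where "norm_group U \<longleftrightarrow> U 0 = 1 \<and> (\<forall>s t. U (s + t) = U s * U t) \<and> (U \<longlongrightarrow> 1) (at 0)"

text \<open>
  Membership in the bicommutant makes powers of different factors commute with each other and with
  the binomial series of \<open>Q\<close>, although they are constructed independently.
\<close>

definition has_powers_in_bicommutant :: "'a :: complex_banach endo \<Rightarrow> 'a endo \<Rightarrow> bool"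
  where "has_powers_in_bicommutant T V \<longleftrightarrow>
    (\<exists>U. norm_group U \<and> (\<forall>t. bicommutes T (U t)) \<and> U 1 = V)"

lemma has_powers_mult:
  assumes "clin T" "has_powers_in_bicommutant T V" "has_powers_in_bicommutant T W"
  shows "has_powers_in_bicommutant T (V * W)"
proof -
  obtain P Q where P: "norm_group P" "\<And>t. bicommutes T (P t)" "P 1 = V"
    and Q: "norm_group Q" "\<And>t. bicommutes T (Q t)" "Q 1 = W"
    using assms unfolding has_powers_in_bicommutant_def by blast
  have "P (s + t) * Q (s + t) = P s * Q s * (P t * Q t)" for s t
    using bicommutes_commute[OF assms(1) P(2)[of t] Q(2)[of s]] P(1) Q(1)
    unfolding norm_group_def by (metis mult.assoc)
  moreover have "((\<lambda>t. P t * Q t) \<longlongrightarrow> 1 * 1) (at 0)"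
    using P Q by (intro tendsto_mult) (auto simp: norm_group_def)
  ultimately have "norm_group (\<lambda>t. P t * Q t)"
    using P Q by (simp add: norm_group_def)
  then show ?thesis
    unfolding has_powers_in_bicommutant_def using P Q
    by (intro exI[of _ "\<lambda>t. P t * Q t"]) (auto intro: bicommutes_mult)
qed

lemma has_powers_inverse:
  assumes "has_powers_in_bicommutant T V"
  shows "\<exists>W. has_powers_in_bicommutant T W \<and> W * V = 1 \<and> V * W = 1"
proof -
  obtain P where P: "norm_group P" "\<And>t. bicommutes T (P t)" "P 1 = V"
    using assms unfolding has_powers_in_bicommutant_def by blast
  have "(P \<longlongrightarrow> 1) (filtermap uminus (at 0))"
    using P(1) by (simp add: filtermap_at_minus norm_group_def)
  then have "((\<lambda>t. P (- t)) \<longlongrightarrow> 1) (at 0)"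
    by (simp only: filterlim_filtermap)
  moreover have "P (- (s + t)) = P (- s) * P (- t)" for s t
    using P(1) unfolding norm_group_def minus_add_distrib by blast
  ultimately have "norm_group (\<lambda>t. P (- t))"
    using P(1) by (simp add: norm_group_def)
  moreover have "P (- 1 + 1) = P (- 1) * V" "P (1 + - 1) = V * P (- 1)" "P 0 = 1"
    using P(1) unfolding norm_group_def P(3)[symmetric] by blast+
  then have "P (- 1) * V = 1" "V * P (- 1) = 1" by simp_all
  ultimately show ?thesis
    unfolding has_powers_in_bicommutant_def using P(2)
    by (intro exI[of _ "P (- 1)"]) (auto intro!: exI[of _ "\<lambda>t. P (- t)"])
qed

lemma has_powers_one_minus:
  assumes "bicommutes T X" "norm X < 1"
  shows "has_powers_in_bicommutant T (1 - X)"
  unfolding has_powers_in_bicommutant_def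
proof (intro exI conjI allI)
  show "norm_group (binomial_series X)"
    using assms(2) by (simp add: norm_group_def binomial_series_0 tendsto_binomial_series_norm_lt_1
        binomial_series_add binomial_summable_norm_lt_1)
  show "bicommutes T (binomial_series X t)" for t
    unfolding bicommutes_def using assms
    by (auto intro!: binomial_series_commute binomial_summable_norm_lt_1 dest: bicommutesD)
qed (rule binomial_series_1)

lemma has_powers_cscale:
  assumes "c \<noteq> 0"
  shows "has_powers_in_bicommutant T (cscale c)"
  unfolding has_powers_in_bicommutant_def
proof (intro exI conjI allI)
  let ?U = "\<lambda>t. cscale (exp (of_real t * Ln c))"
  have "((\<lambda>t. cscale (exp (of_real t * Ln c) - 1)) \<longlongrightarrow> 0) (at (0 :: real))"
  proof (rule Lim_null_comparison)
    show "\<forall>\<^sub>F t :: real in at 0. norm (cscale (exp (of_real t * Ln c) - 1)) \<le> cmod (exp (of_real t * Ln c) - 1)"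
      by (intro always_eventually allI norm_cscale_le)
    show "((\<lambda>t :: real. cmod (exp (of_real t * Ln c) - 1)) \<longlongrightarrow> 0) (at 0)"
      by (auto intro!: tendsto_eq_intros)
  qed
  then have "(?U \<longlongrightarrow> 1) (at 0)"
    by (simp add: cscale_diff cscale_1 LIM_zero_iff)
  then show "norm_group ?U"
    by (simp add: norm_group_def cscale_1 distrib_right exp_add cscale_mult)
  show "cscale (exp (of_real 1 * Ln c)) = cscale c" using assms by simp
qed (rule bicommutes_cscale)

text \<open>
  Inside the component, \<open>T - y = (T - x) (1 - (y - x) R)\<close> with the resolvent \<open>R\<close> at \<open>x\<close>, so that nearby
  points differ by an operator with powers. This is an equivalence relation with open classes, and a
  connected set has just one class. A point far from 0, where \<open>T - b = - b (1 - T / b)\<close> has powers,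
  starts the argument; it exists because the component is unbounded.
\<close>

lemma has_powers_shift:
  fixes T :: "'a :: complex_banach endo"
  assumes T: "clin T"
    and C: "C \<in> components (- op_spectrum (endo_app T))" "\<not> bounded C" "a \<in> C"
  shows "has_powers_in_bicommutant T (T - cscale a)"
proof -
  obtain b where b: "b \<in> C" "cmod b > norm T"
    using C(2) unfolding bounded_iff by (meson not_le)
  then have "b \<noteq> 0" by auto
  have "has_powers_in_bicommutant T (1 - cscale (1 / b) * T)"
  proof (rule has_powers_one_minus)
    have "norm (cscale (1 / b) * T) \<le> cmod (1 / b) * norm T"
      by (intro order.trans[OF norm_mult_ineq] mult_right_mono norm_cscale_le) auto
    also have "\<dots> < 1" using b le_less_trans[OF norm_ge_zero b(2)] by (simp add: norm_divide field_simps)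
    finally show "norm (cscale (1 / b) * T) < 1" .
  qed (intro bicommutes_mult bicommutes_cscale bicommutes_self)
  from has_powers_mult[OF T has_powers_cscale[of "- b"] this]
  have "has_powers_in_bicommutant T (cscale (- b) * (1 - cscale (1 / b) * T))"
    using \<open>b \<noteq> 0\<close> by simp
  also have "cscale (- b) * (1 - cscale (1 / b) * T) = T - cscale b"
  proof -
    have "cscale (- b) * (cscale (1 / b) * T) = - T"
      using \<open>b \<noteq> 0\<close>
      by (simp add: mult.assoc[symmetric] cscale_mult[symmetric] cscale_diff[of 0 1, simplified] cscale_1 cscale_0)
    then show ?thesis
      by (simp add: right_diff_distrib cscale_diff[of 0 b, simplified] cscale_0)
  qed
  finally have start: "has_powers_in_bicommutant T (T - cscale b)" .
  let ?R = "\<lambda>x y. \<exists>V. has_powers_in_bicommutant T V \<and> T - cscale y = (T - cscale x) * V"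
  have "?R b a"
  proof (rule connected_equivalence_relation[of C b a ?R])
    show "connected C" using C(1) by (rule in_components_connected)
    show "?R y x" if R: "?R x y" for x y
    proof -
      obtain V where V: "has_powers_in_bicommutant T V" "T - cscale y = (T - cscale x) * V"
        using R by blast
      then obtain W where "has_powers_in_bicommutant T W" "V * W = 1"
        using has_powers_inverse by blast
      then show ?thesis using V(2) by (intro exI[of _ W]) (simp add: mult.assoc)
    qed
    show "?R x z" if "?R x y" "?R y z" for x y z
      using that has_powers_mult[OF T] by (metis mult.assoc)
    show "\<exists>S. openin (top_of_set C) S \<and> x \<in> S \<and> (\<forall>y\<in>S. ?R x y)" if x: "x \<in> C" for x
    proof -
      have "x \<notin> op_spectrum (endo_app T)" using C(1) x in_components_subset by fastforce
      then obtain R where R: "R * (T - cscale x) = 1" "(T - cscale x) * R = 1"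
        unfolding not_in_op_spectrum_iff by blast
      show ?thesis
      proof (intro exI conjI ballI)
        show "openin (top_of_set C) (C \<inter> ball x (1 / (norm R + 1)))"
          by (intro openin_open_Int open_ball)
        show "x \<in> C \<inter> ball x (1 / (norm R + 1))"
          using x by (simp add: add_nonneg_pos)
      next
        fix y assume "y \<in> C \<inter> ball x (1 / (norm R + 1))"
        then have y: "cmod (y - x) * (norm R + 1) < 1"
          using norm_ge_zero[of R] by (simp add: dist_norm norm_minus_commute field_simps del: norm_ge_zero)
        show "has_powers_in_bicommutant T (1 - cscale (y - x) * R)"
        proof (rule has_powers_one_minus)
          show "bicommutes T (cscale (y - x) * R)"
            by (intro bicommutes_mult bicommutes_cscale bicommutes_inverse[OF T R])
          have "norm (cscale (y - x) * R) \<le> cmod (y - x) * norm R"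
            by (intro order.trans[OF norm_mult_ineq] mult_right_mono norm_cscale_le) auto
          also have "\<dots> < 1" using y norm_ge_zero[of "y - x"] by (simp add: algebra_simps del: norm_ge_zero)
          finally show "norm (cscale (y - x) * R) < 1" .
        qed
        have "(T - cscale x) * (1 - cscale (y - x) * R)
            = T - cscale x - ((T - cscale x) * cscale (y - x)) * R"
          by (simp only: right_diff_distrib mult.assoc mult_1_right)
        also have "(T - cscale x) * cscale (y - x) = cscale (y - x) * (T - cscale x)"
          by (rule clin_commute[OF clin_diff[OF T clin_cscale[of x]]])
        also have "T - cscale x - cscale (y - x) * (T - cscale x) * R = T - cscale x - cscale (y - x)"
          by (simp only: mult.assoc R mult_1_right)
        also have "\<dots> = T - cscale y"
          by (simp add: cscale_diff)
        finally show "T - cscale y = (T - cscale x) * (1 - cscale (y - x) * R)" ..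
      qed
    qed
  qed (use b C in auto)
  then obtain V where "has_powers_in_bicommutant T V" "T - cscale a = (T - cscale b) * V" by blast
  then show ?thesis using has_powers_mult[OF T start] by simp
qed

section \<open>Strong continuity for contractions without fixed vectors\<close>

text \<open>
  The mean ergodic argument: the vector \<open>z\<close> of least norm in the closure of \<open>x + range (1 - K)\<close> is
  orthogonal to the range, so \<open>z \<bullet> z = z \<bullet> K z\<close>. As \<open>\<parallel>K z\<parallel> \<le> \<parallel>z\<parallel>\<close>, this forces \<open>K z = z\<close>.
\<close>

lemma dense_range_one_minus_contraction:
  fixes K :: "'h :: {real_inner, banach} endo"
  assumes K: "norm K \<le> 1" and fix0: "\<And>x. endo_app K x = x \<Longrightarrow> x = 0"
  shows "x \<in> closure (range (endo_app (1 - K)))"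
proof -
  let ?A = "endo_app (1 - K)"
  interpret A: bounded_linear ?A by (rule bounded_linear_endo_app)
  define M where "M = {x - ?A w | w. True}"
  define d where "d = Inf (norm ` M)"
  have ne: "norm ` M \<noteq> {}" and bdd: "bdd_below (norm ` M)"
    by (auto simp: M_def intro: bdd_belowI[of _ 0])
  have d_le: "d \<le> norm y" if "y \<in> M" for y
    unfolding d_def using that bdd by (intro cInf_lower) auto
  have "d \<ge> 0" unfolding d_def using ne by (intro cInf_greatest) auto
  have "\<exists>y\<in>M. norm y < d + 1 / (real n + 1)" for n
    using cInf_lessD[OF ne, of "d + 1 / (real n + 1)"] by (auto simp: d_def add_nonneg_pos)
  then obtain y where y: "\<And>n. y n \<in> M" "\<And>n. norm (y n) < d + 1 / (real n + 1)" by metis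
  \<comment> \<open>The parallelogram law: the midpoint of two elements of \<open>M\<close> has norm at least \<open>d\<close>, so two
    elements of almost minimal norm are close to each other.\<close>
  have diff_le: "(norm (u - v))\<^sup>2 \<le> 2 * (norm u)\<^sup>2 + 2 * (norm v)\<^sup>2 - 4 * d\<^sup>2" if uv: "u \<in> M" "v \<in> M" for u v
  proof -
    obtain p q where p: "u = x - ?A p" "v = x - ?A q" using uv by (auto simp: M_def)
    have "(1/2) *\<^sub>R (u + v) = x - ?A ((1/2) *\<^sub>R (p + q))"
      by (simp only: p A.scaleR A.add) (simp add: algebra_simps flip: scaleR_add_left)
    then have "d \<le> norm ((1/2) *\<^sub>R (u + v))" by (intro d_le) (auto simp: M_def)
    then have "4 * d\<^sup>2 \<le> (norm (u + v))\<^sup>2"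
      using \<open>d \<ge> 0\<close> power_mono[of "2 * d" "norm (u + v)" 2] by (simp add: power_mult_distrib)
    moreover have "(norm (u - v))\<^sup>2 + (norm (u + v))\<^sup>2 = 2 * (norm u)\<^sup>2 + 2 * (norm v)\<^sup>2"
      by (simp add: power2_norm_eq_inner inner_diff_left inner_diff_right inner_add_left inner_add_right)
    ultimately show ?thesis by linarith
  qed
  have lim_d: "(\<lambda>n. norm (y n)) \<longlonglongrightarrow> d"
  proof (rule tendsto_sandwich[of "\<lambda>_. d" _ _ "\<lambda>n. d + 1 / (real n + 1)"])
    show "(\<lambda>n. d + 1 / (real n + 1)) \<longlonglongrightarrow> d"
      using tendsto_add[OF tendsto_const lim_1_over_n[THEN LIMSEQ_Suc], of d] by (simp add: add.commute)
  qed (use d_le y(1) less_imp_le[OF y(2)] in auto)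
  have "Cauchy y"
  proof (rule metric_CauchyI)
    fix e :: real assume "e > 0"
    have "(\<lambda>n. (norm (y n))\<^sup>2) \<longlonglongrightarrow> d\<^sup>2" by (intro tendsto_intros lim_d)
    moreover have "d\<^sup>2 < d\<^sup>2 + e\<^sup>2 / 4" using \<open>e > 0\<close> by simp
    ultimately obtain N where N: "\<And>n. n \<ge> N \<Longrightarrow> (norm (y n))\<^sup>2 < d\<^sup>2 + e\<^sup>2 / 4"
      by (metis (no_types, lifting) order_tendstoD(2) eventually_sequentially)
    have "dist (y m) (y n) < e" if "m \<ge> N" "n \<ge> N" for m n
    proof -
      have "(norm (y m - y n))\<^sup>2 < e\<^sup>2" using diff_le[OF y(1) y(1), of m n] N[OF that(1)] N[OF that(2)] by simp
      then show ?thesis using \<open>e > 0\<close> by (simp add: dist_norm power2_less_imp_less)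
    qed
    then show "\<exists>N. \<forall>m\<ge>N. \<forall>n\<ge>N. dist (y m) (y n) < e" by blast
  qed
  then obtain z where z: "y \<longlonglongrightarrow> z" using Cauchy_convergent convergent_def by blast
  have nz: "norm z = d" using LIMSEQ_unique[OF tendsto_norm[OF z] lim_d] .
  have d_le_z: "d \<le> norm (z - ?A w)" for w
  proof (rule LIMSEQ_le_const)
    show "(\<lambda>n. norm (y n - ?A w)) \<longlonglongrightarrow> norm (z - ?A w)" by (intro tendsto_intros z)
    have "y n - ?A w \<in> M" for n
    proof -
      obtain p where "y n = x - ?A p" using y(1)[of n] by (auto simp: M_def)
      then have "y n - ?A w = x - ?A (p + w)" by (simp only: A.add) (simp add: algebra_simps)
      then show ?thesis unfolding M_def by blast
    qed
    then show "\<exists>N. \<forall>n\<ge>N. d \<le> norm (y n - ?A w)" using d_le by blast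
  qed
  have orth: "z \<bullet> ?A w = 0" for w
  proof (rule ccontr)
    assume ne: "z \<bullet> ?A w \<noteq> 0"
    define s where "s = z \<bullet> ?A w / (norm (?A w))\<^sup>2"
    have Aw: "?A w \<noteq> 0" using ne by auto
    have "d\<^sup>2 \<le> (norm (z - ?A (s *\<^sub>R w)))\<^sup>2"
      using d_le_z[of "s *\<^sub>R w"] \<open>d \<ge> 0\<close> by (intro power_mono) auto
    also have "\<dots> = (norm z)\<^sup>2 - 2 * s * (z \<bullet> ?A w) + s\<^sup>2 * (norm (?A w))\<^sup>2"
      unfolding A.scaleR power2_norm_eq_inner
      by (simp add: inner_diff_left inner_diff_right inner_commute power2_eq_square algebra_simps del: endo_app_simps)
    also have "\<dots> = (norm z)\<^sup>2 - (z \<bullet> ?A w)\<^sup>2 / (norm (?A w))\<^sup>2"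
      using Aw by (simp add: s_def power2_eq_square field_simps del: endo_app_simps)
    finally have "(z \<bullet> ?A w)\<^sup>2 / (norm (?A w))\<^sup>2 \<le> 0" using nz by simp
    then show False using ne Aw by (simp add: divide_le_0_iff del: endo_app_simps)
  qed
  have "z \<bullet> z = z \<bullet> endo_app K z" using orth[of z] by (simp add: inner_diff_right)
  moreover have "norm (endo_app K z) \<le> norm z"
    using norm_endo_app[of K z] mult_right_mono[OF K norm_ge_zero[of z]] by simp
  ultimately have "(norm (endo_app K z - z))\<^sup>2 \<le> 0"
    using power_mono[of "norm (endo_app K z)" "norm z" 2]
    by (simp add: power2_norm_eq_inner inner_diff_left inner_diff_right inner_commute)
  then have "z = 0" using fix0 by simp
  show ?thesis
    unfolding closure_sequential
  proof (intro exI conjI allI)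
    have "(\<lambda>n. x - y n) \<longlonglongrightarrow> x - z" by (intro tendsto_intros z)
    then show "(\<lambda>n. x - y n) \<longlonglongrightarrow> x" by (simp add: \<open>z = 0\<close>)
    show "x - y n \<in> range ?A" for n using y(1)[of n] by (auto simp: M_def)
  qed
qed

lemma tendsto_on_closure:
  fixes T :: "real \<Rightarrow> 'b :: real_normed_vector \<Rightarrow> 'b"
  assumes lin: "\<And>t. 0 < t \<Longrightarrow> t < \<delta> \<Longrightarrow> linear (T t)" and \<delta>: "\<delta> > 0"
    and bound: "\<And>t x. 0 < t \<Longrightarrow> t < \<delta> \<Longrightarrow> norm (T t x) \<le> M * norm x"
    and lim: "\<And>x. x \<in> S \<Longrightarrow> ((\<lambda>t. norm (T t x - x)) \<longlongrightarrow> 0) (at_right 0)"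
    and x: "x \<in> closure S"
  shows "((\<lambda>t. norm (T t x - x)) \<longlongrightarrow> 0) (at_right 0)"
proof (rule tendstoI)
  fix e :: real assume "e > 0"
  define B where "B = \<bar>M\<bar> + 1"
  have B: "B \<ge> 1" by (simp add: B_def)
  obtain y where y: "y \<in> S" "dist y x < e / (4 * B)"
    using x \<open>e > 0\<close> B unfolding closure_approachable by (metis divide_pos_pos mult_pos_pos zero_less_numeral less_le_trans zero_less_one)
  have "\<forall>\<^sub>F t in at_right 0. norm (T t y - y) < e / 2"
    using order_tendstoD(2)[OF lim[OF y(1)], of "e / 2"] \<open>e > 0\<close> by simp
  moreover have "\<forall>\<^sub>F t in at_right 0. 0 < t \<and> t < \<delta>"
    using \<delta> by (auto simp: eventually_at_right intro!: exI[of _ \<delta>])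
  ultimately show "\<forall>\<^sub>F t in at_right 0. dist (norm (T t x - x)) 0 < e"
  proof eventually_elim
    case (elim t)
    interpret linear "T t" using lin elim by blast
    have xy: "norm (x - y) < e / (4 * B)" using y(2) by (simp add: dist_norm norm_minus_commute)
    have "norm (T t (x - y)) \<le> M * norm (x - y)" using bound elim by blast
    also have "\<dots> \<le> B * norm (x - y)" by (intro mult_right_mono) (auto simp: B_def)
    also have "\<dots> \<le> e / 4" using xy B by (simp add: field_simps)
    finally have 1: "norm (T t (x - y)) \<le> e / 4" .
    have "e / (4 * B) \<le> e / 4" using B \<open>e > 0\<close> by (simp add: field_simps)
    then have 2: "norm (y - x) < e / 4" using xy by (simp add: norm_minus_commute)
    have "T t x - x = T t (x - y) + (T t y - y) + (y - x)" by (simp add: diff)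
    then have "norm (T t x - x) \<le> norm (T t (x - y)) + norm (T t y - y) + norm (y - x)"
      by (metis norm_triangle_ineq norm_triangle_mono order_refl)
    then show ?case using 1 2 elim by simp
  qed
qed

text \<open>
  On the range of \<open>1 - K\<close> the convergence is \<open>(1 - K)\<^sup>t (1 - K) \<longlonglongrightarrow> 1 - K\<close>; density of the range
  and the uniform bound do the rest.
\<close>

lemma tendsto_binomial_series_contraction:
  fixes K :: "'h :: {real_inner, banach} endo"
  assumes K: "norm K \<le> 1" and fix0: "\<And>x. endo_app K x = x \<Longrightarrow> x = 0"
  shows "((\<lambda>t. norm (endo_app (binomial_series K t) x - x)) \<longlongrightarrow> 0) (at_right 0)"
proof (rule tendsto_on_closure[where \<delta> = 1 and M = 2])
  show "linear (endo_app (binomial_series K t))" for t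
    using bounded_linear_endo_app bounded_linear.linear by blast
  show "norm (endo_app (binomial_series K t) x) \<le> 2 * norm x" if "0 < t" "t < 1" for t x
    using norm_binomial_series_contraction(1)[OF norm_one_endo_le K, of t] that
    by (intro order.trans[OF norm_endo_app] mult_right_mono) auto
  show "x \<in> closure (range (endo_app (1 - K)))"
    using K fix0 by (rule dense_range_one_minus_contraction)
  fix y assume "y \<in> range (endo_app (1 - K))"
  then obtain w where w: "y = endo_app (1 - K) w" by blast
  have *: "norm (endo_app (binomial_series K t) y - y) \<le> 2 * t * norm w" if "0 < t" "t < 1" for t
  proof -
    have "binomial_series K t * (1 - K) = binomial_series K (1 + t)"
      using binomial_series_add[of K t 1] binomial_summable_contraction[OF K] that
      by (simp add: binomial_series_1 add.commute)
    then have "endo_app (binomial_series K t) y = endo_app (binomial_series K (1 + t)) w"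
      unfolding w by (metis endo_app_simps(1))
    then have "endo_app (binomial_series K t) y - y = endo_app (binomial_series K (1 + t) - (1 - K)) w"
      by (simp add: w)
    also have "norm \<dots> \<le> (2 * t) * norm w"
      using norm_binomial_series_contraction(2)[OF norm_one_endo_le K, of t] that
      by (intro order.trans[OF norm_endo_app] mult_right_mono) auto
    finally show ?thesis .
  qed
  show "((\<lambda>t. norm (endo_app (binomial_series K t) y - y)) \<longlongrightarrow> 0) (at_right 0)"
  proof (rule Lim_null_comparison)
    show "\<forall>\<^sub>F t in at_right 0. norm (norm (endo_app (binomial_series K t) y - y)) \<le> 2 * t * norm w"
      unfolding eventually_at_right_field using * by (intro exI[of _ 1]) auto
    show "((\<lambda>t. 2 * t * norm w) \<longlongrightarrow> 0) (at_right 0)"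
      by (auto intro!: tendsto_eq_intros)
  qed
qed simp

text \<open>
  The semigroup is \<open>U t * (A' * (1 - K)\<^sup>t * A)\<close>, where \<open>U\<close> are the powers of \<open>T - a\<close>. The two factors
  commute: \<open>A' * K * A\<close> is \<open>1 - (T - a)\<^sup>-\<^sup>1 T\<close> and so commutes with \<open>T\<close>, and \<open>U t\<close> is in the bicommutant.
\<close>

theorem c0_embeddable_similar_contraction:
  fixes T :: "'h :: {real_inner, complex_banach} endo"
  assumes T: "clin T" and C: "C \<in> components (- op_spectrum (endo_app T))" "\<not> bounded C" "a \<in> C"
    and A: "clin A" "clin A'" "A' * A = 1" "A * A' = 1"
    and K: "norm K \<le> 1" "\<And>x. endo_app K x = x \<Longrightarrow> x = 0"
    and sim: "T = (T - cscale a) * (A' * (1 - K) * A)"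
  shows "c0_embeddable (endo_app T)"
proof -
  have "a \<notin> op_spectrum (endo_app T)" using C in_components_subset by fastforce
  then obtain R where R: "clin R" "R * (T - cscale a) = 1" "(T - cscale a) * R = 1"
    unfolding not_in_op_spectrum_iff by blast
  obtain U where U: "norm_group U" "\<And>t. bicommutes T (U t)" "U 1 = T - cscale a"
    using has_powers_shift[OF T C] unfolding has_powers_in_bicommutant_def by blast
  have AKA: "A' * K * A = 1 - R * T"
  proof -
    have "R * T = A' * (1 - K) * A"
      by (subst sim) (simp add: mult.assoc[symmetric] R)
    then show ?thesis by (simp add: algebra_simps A)
  qed
  have K_eq: "K = A * (1 - R * T) * A'"
    by (simp add: AKA[symmetric] mult.assoc A) (simp add: mult.assoc[symmetric] A)
  have clin_K: "clin K" unfolding K_eq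
    by (intro clin_mult clin_diff clin_1 A R T)
  have RT: "R * T = T * R"
    using bicommutesD[OF bicommutes_inverse[OF T R(2,3)] T] by simp
  define B where "B t = A' * binomial_series K t * A" for t
  have summ: "binomial_summable K t" if "t > 0" for t
    using K(1) that by (rule binomial_summable_contraction)
  have clin_B: "clin (B t)" if "t > 0" for t
  proof -
    have "clin (binomial_series K t)"
      unfolding clin_def using binomial_series_commute[OF summ[OF that]] clin_K
      by (metis clin_commute)
    then show ?thesis unfolding B_def by (intro clin_mult A)
  qed
  have B_T: "B t * T = T * B t" if "t > 0" for t
  proof -
    have "(A * T * A') * K = A * (T * ((A' * A) * ((1 - R * T) * A')))"
      unfolding K_eq by (simp only: mult.assoc)
    also have "\<dots> = A * ((T * (1 - R * T)) * A')" by (simp add: A mult.assoc)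
    also have "T * (1 - R * T) = (1 - R * T) * T"
      by (simp add: right_diff_distrib left_diff_distrib mult.assoc RT)
    also have "A * ((1 - R * T) * T * A') = A * ((1 - R * T) * ((A' * A) * (T * A')))"
      by (simp add: A mult.assoc)
    also have "\<dots> = K * (A * T * A')"
      unfolding K_eq by (simp only: mult.assoc)
    finally have "(A * T * A') * K = K * (A * T * A')" .
    from binomial_series_commute[OF summ[OF that] this]
    have "A' * ((A * T * A') * binomial_series K t) * A = A' * (binomial_series K t * (A * T * A')) * A"
      by (simp only:)
    then have "(A' * A) * (T * (A' * (binomial_series K t * A))) = A' * (binomial_series K t * (A * (T * (A' * A))))"
      by (simp only: mult.assoc)
    then show ?thesis by (simp add: B_def A mult.assoc)
  qed
  have B_U: "B t * U s = U s * B t" if "t > 0" for t s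
    using bicommutesD[OF U(2) clin_B[OF that] B_T[OF that]] .
  have B_add: "B (s + t) = B s * B t" if "s > 0" "t > 0" for s t
  proof -
    have "B s * B t = A' * binomial_series K s * (A * A') * binomial_series K t * A"
      by (simp only: B_def mult.assoc)
    then show ?thesis
      using binomial_series_add[OF summ[OF that(1)] summ[OF that(2)]] by (simp add: A B_def mult.assoc)
  qed
  have B_lim: "((\<lambda>t. endo_app (B t) x) \<longlongrightarrow> x) (at_right 0)" for x
  proof -
    have "((\<lambda>t. endo_app (binomial_series K t) (endo_app A x)) \<longlongrightarrow> endo_app A x) (at_right 0)"
      using tendsto_binomial_series_contraction[OF K] by (subst Lim_null) (simp add: tendsto_norm_zero_iff)
    from bounded_linear.tendsto[OF bounded_linear_endo_app[of A'] this]
    have "((\<lambda>t. endo_app (B t) x) \<longlongrightarrow> endo_app (A' * A) x) (at_right 0)" by (simp add: B_def)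
    then show ?thesis by (simp only: A endo_app_simps)
  qed
  let ?S = "\<lambda>t. U t * B t"
  have "c0_semigroup (\<lambda>t. endo_app (?S t))"
    unfolding c0_semigroup_def
  proof (intro conjI allI impI)
    show "bounded_clinear (endo_app (?S t))" if "t > 0" for t
      using clin_B[OF that] bicommutes_imp_clin[OF T U(2)]
      by (intro bounded_clinear_endo_app clin_mult)
    show "endo_app (?S t) \<circ> endo_app (?S s) = endo_app (?S (t + s))" if "t > 0" "s > 0" for t s
    proof -
      have "?S t * ?S s = U t * (B t * U s) * B s" by (simp add: mult.assoc)
      also have "\<dots> = U t * U s * (B t * B s)" using B_U[OF that(1), of s] by (simp add: mult.assoc)
      also have "\<dots> = ?S (t + s)"
        using U(1) B_add[OF that] by (simp add: norm_group_def)
      finally show ?thesis by (metis comp_apply endo_app_simps(1) ext)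
    qed
    show "((\<lambda>t. norm (endo_app (?S t) x - x)) \<longlongrightarrow> 0) (at_right 0)" for x
    proof -
      have "(U \<longlongrightarrow> 1) (at_right 0)"
        using U(1) unfolding norm_group_def by (auto intro: filterlim_mono at_le)
      then have U0: "((\<lambda>t. U t - 1) \<longlongrightarrow> 0) (at_right 0)" by (simp add: LIM_zero)
      have 0: "((\<lambda>t. endo_app (U t - 1) (endo_app (B t) x)) \<longlongrightarrow> 0) (at_right 0)"
      proof (rule Lim_null_comparison)
        show "\<forall>\<^sub>F t in at_right 0. norm (endo_app (U t - 1) (endo_app (B t) x)) \<le> norm (U t - 1) * norm (endo_app (B t) x)"
          by (intro always_eventually allI norm_endo_app)
        show "((\<lambda>t. norm (U t - 1) * norm (endo_app (B t) x)) \<longlongrightarrow> 0) (at_right 0)"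
          using tendsto_mult[OF tendsto_norm[OF U0] tendsto_norm[OF B_lim[of x]]] by simp
      qed
      from tendsto_add[OF 0 B_lim[of x]]
      have "((\<lambda>t. endo_app (?S t) x) \<longlongrightarrow> x) (at_right 0)" by simp
      then show ?thesis by (subst (asm) Lim_null) (simp add: tendsto_norm_zero_iff)
    qed
  qed
  moreover have "?S 1 = T"
    unfolding U(3) B_def binomial_series_1 by (rule sim[symmetric])
  ultimately show ?thesis
    unfolding c0_embeddable_def by (intro exI[of _ "\<lambda>t. endo_app (?S t)"]) auto
qed

section \<open>Trigonometric polynomials and completeness of the Fourier system\<close>

text \<open>
  Open arcs have positive length, so almost everywhere equality of continuous functions is equality.
\<close>

lemma AE_circle_open_empty:
  assumes AE: "AE z in circle. z \<notin> U" and U: "open U"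
  shows "U \<inter> sphere 0 1 = {}"
proof (rule ccontr)
  assume "U \<inter> sphere 0 1 \<noteq> {}"
  then obtain z where z: "z \<in> U" "cmod z = 1" by auto
  define s where "s = Arg2pi z"
  have s: "0 \<le> s" "s < 2 * pi" "cis s = z"
    using Arg2pi[of z] z(2) by (auto simp: s_def cis_conv_exp is_Arg_def)
  have U_sets: "{x \<in> space (restrict_space borel (sphere 0 1)). x \<notin> U} \<in> sets (restrict_space borel (sphere 0 1))"
    using U by (auto simp: sets_restrict_space space_restrict_space intro!: image_eqI[of _ _ "- U"])
  have "AE t in uniform_measure lborel {0..<2 * pi}. cis t \<notin> U"
    using AE unfolding circle_def by (subst (asm) AE_distr_iff[OF measurable_cis_circle U_sets])
  then have AE_t: "AE t in lborel. t \<in> {0..<2 * pi} \<longrightarrow> cis t \<notin> U"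
    by (subst (asm) AE_uniform_measure) auto
  have "open (cis -` U)"
    by (intro open_vimage U) (intro continuous_intros)
  moreover have "s \<in> cis -` U" using s z by simp
  ultimately obtain e where e: "e > 0" "ball s e \<subseteq> cis -` U"
    by (meson open_contains_ball)
  define b where "b = min (s + e) (2 * pi)"
  have "AE t in lborel. t \<notin> {s<..<b}"
    using AE_t
  proof eventually_elim
    case (elim t)
    show ?case
    proof
      assume t: "t \<in> {s<..<b}"
      then have "t \<in> ball s e" "t \<in> {0..<2 * pi}" using s by (auto simp: b_def dist_real_def)
      then show False using e elim by auto
    qed
  qed
  then have "{s<..<b} \<in> null_sets lborel"
    by (subst (asm) AE_iff_null_sets[symmetric]) auto
  then have "emeasure lborel {s<..<b} = 0" by auto
  moreover have "s < b" using e s by (auto simp: b_def)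
  ultimately show False by simp
qed

lemma continuous_AE_eq_circle:
  fixes f g :: "complex \<Rightarrow> complex"
  assumes "continuous_on (sphere 0 1) f" "continuous_on (sphere 0 1) g" "AE z in circle. f z = g z"
    and z: "z \<in> sphere 0 1"
  shows "f z = g z"
proof -
  have "openin (top_of_set (sphere 0 1)) (sphere 0 1 \<inter> (\<lambda>z. f z - g z) -` (- {0}))"
    using assms by (intro continuous_openin_preimage_gen continuous_intros) auto
  then obtain U where U: "open U" "sphere 0 1 \<inter> (\<lambda>z. f z - g z) -` (- {0}) = sphere 0 1 \<inter> U"
    unfolding openin_open by blast
  have "AE z in circle. z \<in> space circle" by (rule AE_space)
  with assms(3) have "AE z in circle. z \<notin> U"
    by eventually_elim (use U(2) in \<open>auto simp: space_circle\<close>)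
  from AE_circle_open_empty[OF this U(1)] show ?thesis using U(2) z by auto
qed

text \<open>
  Only the values on the circle matter, which is what the last rule expresses; \<open>z powi (-1)\<close> and
  \<open>cnj z\<close> then represent the same trigonometric polynomial.
\<close>

inductive trig_poly :: "(complex \<Rightarrow> complex) \<Rightarrow> bool" where
  monom: "trig_poly (\<lambda>z. c * z powi k)"
| add: "trig_poly f \<Longrightarrow> trig_poly g \<Longrightarrow> trig_poly (\<lambda>z. f z + g z)"
| cong: "trig_poly f \<Longrightarrow> (\<And>z. z \<in> sphere 0 1 \<Longrightarrow> f z = g z) \<Longrightarrow> trig_poly g"

lemma trig_poly_const: "trig_poly (\<lambda>_. c)"
  using trig_poly.monom[of c 0] by simp

lemma trig_poly_mult_monom: "trig_poly f \<Longrightarrow> trig_poly (\<lambda>z. f z * (c * z powi k))"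
proof (induction rule: trig_poly.induct)
  case (monom b j)
  show ?case
  proof (rule trig_poly.cong[OF trig_poly.monom])
    show "(b * c) * z powi (j + k) = b * z powi j * (c * z powi k)" if "z \<in> sphere 0 1" for z
      using that by (subst power_int_add) auto
  qed
next
  case (add f g)
  from trig_poly.add[OF add.IH] show ?case by (simp add: distrib_right)
next
  case (cong f g)
  from trig_poly.cong[OF cong.IH] show ?case using cong.hyps by simp
qed

lemma trig_poly_mult:
  assumes g: "trig_poly g" and f: "trig_poly f"
  shows "trig_poly (\<lambda>z. f z * g z)"
  using g
proof (induction rule: trig_poly.induct)
  case (monom c k)
  show ?case by (rule trig_poly_mult_monom[OF f])
next
  case (add g h)
  from trig_poly.add[OF add.IH] show ?case by (simp add: distrib_left)
next
  case (cong g h)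
  from trig_poly.cong[OF cong.IH] show ?case using cong.hyps by simp
qed

lemma trig_poly_cmult: "trig_poly f \<Longrightarrow> trig_poly (\<lambda>z. c * f z)"
  using trig_poly_mult[of f "\<lambda>_. c"] trig_poly_const by blast

lemma continuous_on_powi_sphere: "continuous_on (sphere 0 1) (\<lambda>z :: complex. z powi k)"
  by (intro continuous_intros) auto

lemma continuous_on_trig_poly: "trig_poly p \<Longrightarrow> continuous_on (sphere 0 1) p"
proof (induction rule: trig_poly.induct)
  case (cong f g)
  then show ?case using continuous_on_cong by blast
qed (intro continuous_intros continuous_on_powi_sphere; simp)+

lemma inverse_eq_cnj_circle: "z \<in> sphere 0 1 \<Longrightarrow> inverse z = cnj z"
  using complex_norm_square[of z] by (intro inverse_unique) simp

lemma trig_poly_real_polynomial_function: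
  assumes "real_polynomial_function p"
  shows "trig_poly (\<lambda>z. complex_of_real (p z))"
  using assms
proof (induction rule: real_polynomial_function.induct)
  case (linear f)
  have Re: "trig_poly (\<lambda>z. complex_of_real (Re z))"
  proof (rule trig_poly.cong[OF trig_poly.add[OF trig_poly.monom[of "1/2" 1] trig_poly.monom[of "1/2" "-1"]]])
    show "1 / 2 * z powi 1 + 1 / 2 * z powi - 1 = complex_of_real (Re z)" if "z \<in> sphere 0 1" for z
      using that by (simp add: power_int_minus inverse_eq_cnj_circle complex_eq_iff)
  qed
  have Im: "trig_poly (\<lambda>z. complex_of_real (Im z))"
  proof (rule trig_poly.cong[OF trig_poly.add[OF trig_poly.monom[of "-\<i>/2" 1] trig_poly.monom[of "\<i>/2" "-1"]]])
    show "- \<i> / 2 * z powi 1 + \<i> / 2 * z powi - 1 = complex_of_real (Im z)" if "z \<in> sphere 0 1" for z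
      using that by (simp add: power_int_minus inverse_eq_cnj_circle complex_eq_iff)
  qed
  have lin: "f z = Re z * f 1 + Im z * f \<i>" for z
  proof -
    interpret bounded_linear f by (rule linear)
    have "z = Re z *\<^sub>R 1 + Im z *\<^sub>R \<i>" by (simp add: complex_eq_iff)
    then show ?thesis by (metis add scaleR real_scaleR_def)
  qed
  have "(\<lambda>z. complex_of_real (f z)) = (\<lambda>z. of_real (f 1) * of_real (Re z) + of_real (f \<i>) * of_real (Im z))"
  proof
    show "complex_of_real (f z) = of_real (f 1) * of_real (Re z) + of_real (f \<i>) * of_real (Im z)" for z
      by (subst lin[of z]) simp
  qed
  then show ?case
    using trig_poly.add[OF trig_poly_cmult[OF Re] trig_poly_cmult[OF Im]] by simp
next
  case (const c)
  show ?case by (rule trig_poly_const)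
next
  case (add f g)
  then show ?case using trig_poly.add by fastforce
next
  case (mult f g)
  then show ?case using trig_poly_mult[of "\<lambda>z. of_real (g z)" "\<lambda>z. of_real (f z)"] by simp
qed

text \<open>
  The Stone-Weierstrass theorem for polynomials in the real and imaginary part of \<open>z\<close>, which are
  \<open>(z + z\<^sup>-\<^sup>1) / 2\<close> and \<open>(z - z\<^sup>-\<^sup>1) / (2\<i>)\<close> on the circle.
\<close>

lemma trig_poly_dense:
  assumes f: "continuous_on (sphere 0 1) f" and "e > 0"
  obtains p where "trig_poly p" "\<And>z. z \<in> sphere 0 1 \<Longrightarrow> cmod (f z - p z) < e"
proof -
  have 1: "continuous_on (sphere 0 1) (\<lambda>z. Re (f z))" "continuous_on (sphere 0 1) (\<lambda>z. Im (f z))"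
    by (intro continuous_intros f)+
  obtain u where u: "real_polynomial_function u" "\<And>z. z \<in> sphere 0 1 \<Longrightarrow> \<bar>Re (f z) - u z\<bar> < e / 2"
    using Stone_Weierstrass_real_polynomial_function[OF compact_sphere 1(1), of "e/2"] \<open>e > 0\<close> by auto
  obtain v where v: "real_polynomial_function v" "\<And>z. z \<in> sphere 0 1 \<Longrightarrow> \<bar>Im (f z) - v z\<bar> < e / 2"
    using Stone_Weierstrass_real_polynomial_function[OF compact_sphere 1(2), of "e/2"] \<open>e > 0\<close> by auto
  show thesis
  proof
    show "trig_poly (\<lambda>z. of_real (u z) + \<i> * of_real (v z))"
      by (intro trig_poly.add trig_poly_cmult trig_poly_real_polynomial_function u v)
    fix z :: complex assume z: "z \<in> sphere 0 1"
    have "cmod (f z - (of_real (u z) + \<i> * of_real (v z))) \<le> \<bar>Re (f z) - u z\<bar> + \<bar>Im (f z) - v z\<bar>"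
      using cmod_le[of "f z - (of_real (u z) + \<i> * of_real (v z))"] by simp
    then show "cmod (f z - (of_real (u z) + \<i> * of_real (v z))) < e"
      using u(2)[OF z] v(2)[OF z] by simp
  qed
qed

lemma continuous_on_circle_bounded:
  fixes f :: "complex \<Rightarrow> complex"
  assumes "continuous_on (sphere 0 1) f"
  obtains B where "\<And>z. z \<in> sphere 0 1 \<Longrightarrow> cmod (f z) \<le> B"
proof -
  have "compact (f ` sphere 0 1)" using assms by (intro compact_continuous_image) auto
  then show thesis using that by (meson bounded_iff compact_imp_bounded imageI)
qed

lemma integrable_mult_continuous_circle:
  assumes "integrable circle f" "continuous_on (sphere 0 1) g"
  shows "integrable circle (\<lambda>z. f z * g z :: complex)"
proof -
  obtain C where C: "\<And>z. z \<in> sphere 0 1 \<Longrightarrow> cmod (g z) \<le> C"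
    using continuous_on_circle_bounded[OF assms(2)] by blast
  have [measurable]: "g \<in> borel_measurable circle" "f \<in> borel_measurable circle"
    using assms borel_measurable_circle_continuous by auto
  show ?thesis
  proof (rule Bochner_Integration.integrable_bound)
    show "integrable circle (\<lambda>z. C *\<^sub>R f z)" using assms by simp
    show "AE z in circle. norm (f z * g z) \<le> norm (C *\<^sub>R f z)"
    proof (rule AE_I2)
      fix z assume z: "z \<in> space circle"
      have "cmod (f z) * cmod (g z) \<le> cmod (f z) * \<bar>C\<bar>"
        using C[of z] z by (intro mult_left_mono) (auto simp: space_circle)
      then show "norm (f z * g z) \<le> norm (C *\<^sub>R f z)" by (simp add: norm_mult mult.commute)
    qed
  qed measurable
qed

lemma integral_eq_0_if_fourier_coeff_0:
  assumes f: "integrable circle f" and c0: "\<And>n. fourier_coeff f n = 0"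
    and g: "continuous_on (sphere 0 1) g"
  shows "(\<integral>z. f z * g z \<partial>circle) = 0"
proof -
  have p0: "(\<integral>z. f z * p z \<partial>circle) = 0" if "trig_poly p" for p
    using that
  proof (induction rule: trig_poly.induct)
    case (monom c k)
    have "(\<integral>z. f z * (c * z powi k) \<partial>circle) = (\<integral>z. c * (f z * z powi k) \<partial>circle)"
      by (simp add: mult.left_commute)
    also have "\<dots> = c * fourier_coeff f (- k)" by (simp add: fourier_coeff_def)
    finally show ?case by (simp add: c0)
  next
    case (add p q)
    then show ?case
      using f by (simp add: distrib_left integrable_mult_continuous_circle continuous_on_trig_poly)
  next
    case (cong p q)
    have "(\<integral>z. f z * q z \<partial>circle) = (\<integral>z. f z * p z \<partial>circle)"
      using cong.hyps by (intro Bochner_Integration.integral_cong) (auto simp: space_circle)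
    then show ?case using cong.IH by simp
  qed
  have "norm (\<integral>z. f z * g z \<partial>circle) \<le> e * (\<integral>z. norm (f z) \<partial>circle)" if e: "e > 0" for e
  proof -
    obtain p where p: "trig_poly p" "\<And>z. z \<in> sphere 0 1 \<Longrightarrow> cmod (g z - p z) < e"
      using trig_poly_dense[OF g e] by blast
    have cp: "continuous_on (sphere 0 1) p" by (rule continuous_on_trig_poly[OF p(1)])
    have i: "integrable circle (\<lambda>z. f z * (g z - p z))"
      by (intro integrable_mult_continuous_circle f continuous_intros g cp)
    have "(\<integral>z. f z * g z \<partial>circle) = (\<integral>z. f z * (g z - p z) \<partial>circle) + (\<integral>z. f z * p z \<partial>circle)"
      by (subst Bochner_Integration.integral_add[symmetric])
         (use i integrable_mult_continuous_circle[OF f cp] in \<open>auto simp: algebra_simps\<close>)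
    also have "\<dots> = (\<integral>z. f z * (g z - p z) \<partial>circle)" using p0[OF p(1)] by simp
    also have "norm \<dots> \<le> (\<integral>z. norm (f z * (g z - p z)) \<partial>circle)" by (rule integral_norm_bound)
    also have "\<dots> \<le> (\<integral>z. e * norm (f z) \<partial>circle)"
    proof (rule integral_mono)
      show "integrable circle (\<lambda>z. norm (f z * (g z - p z)))" using i by (rule integrable_norm)
      show "integrable circle (\<lambda>z. e * norm (f z))" using f by simp
      show "norm (f z * (g z - p z)) \<le> e * norm (f z)" if "z \<in> space circle" for z
        using mult_left_mono[OF less_imp_le[OF p(2)[of z]], of "cmod (f z)"] that
        by (simp add: norm_mult space_circle mult.commute)
    qed
    finally show ?thesis by simp
  qed
  then have "norm (\<integral>z. f z * g z \<partial>circle) \<le> 0"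
  proof -
    let ?I = "\<integral>z. norm (f z) \<partial>circle"
    assume *: "\<And>e. e > 0 \<Longrightarrow> norm (\<integral>z. f z * g z \<partial>circle) \<le> e * ?I"
    have "?I \<ge> 0" by simp
    show ?thesis
    proof (rule field_le_epsilon)
      fix d :: real assume "d > 0"
      have le: "d / (i + 1) * i \<le> d" if "i \<ge> 0" for i
        using that \<open>d > 0\<close> by (simp add: field_simps)
      have "norm (\<integral>z. f z * g z \<partial>circle) \<le> d / (?I + 1) * ?I"
        using \<open>?I \<ge> 0\<close> \<open>d > 0\<close> by (intro * divide_pos_pos add_nonneg_pos) auto
      also note le[OF \<open>?I \<ge> 0\<close>]
      finally show "norm (\<integral>z. f z * g z \<partial>circle) \<le> 0 + d" by simp
    qed
  qed
  then show ?thesis by simp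
qed

text \<open>
  The positive and the negative part of \<open>u\<close> are densities of two finite measures that agree on the
  closed sets, hence on all Borel sets.
\<close>

lemma AE_eq_0_if_integral_closed_0:
  fixes u :: "complex \<Rightarrow> real"
  assumes u: "integrable circle u" and c: "\<And>A. closed A \<Longrightarrow> (\<integral>z. u z * indicator A z \<partial>circle) = 0"
  shows "AE z in circle. u z = 0"
proof -
  have [measurable]: "u \<in> borel_measurable circle" using u by auto
  define D where "D v = density circle (\<lambda>z. ennreal (v z))" for v :: "complex \<Rightarrow> real"
  define D' where "D' v = distr (D v) borel (\<lambda>z. z)" for v :: "complex \<Rightarrow> real"
  have id: "(\<lambda>z. z) \<in> D v \<rightarrow>\<^sub>M borel" for v
  proof -
    have "(\<lambda>z. z) \<in> borel_measurable circle" by (intro borel_measurable_circle_continuous continuous_intros)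
    then show ?thesis by (simp add: D_def)
  qed
  have em: "emeasure (D' v) A = (\<integral>\<^sup>+z. ennreal (v z * indicator A z) \<partial>circle)"
    if [measurable]: "A \<in> sets borel" "v \<in> borel_measurable circle" for v A
  proof -
    have "A \<inter> sphere 0 1 \<in> sets circle"
      using that by (auto simp: sets_circle sets_restrict_space)
    then have "emeasure (D' v) A = (\<integral>\<^sup>+z. ennreal (v z) * indicator (A \<inter> sphere 0 1) z \<partial>circle)"
      unfolding D'_def by (subst emeasure_distr[OF id]) (auto simp: D_def space_circle emeasure_density)
    also have "\<dots> = (\<integral>\<^sup>+z. ennreal (v z * indicator A z) \<partial>circle)"
      by (rule nn_integral_cong) (auto simp: indicator_def space_circle)
    finally show ?thesis .
  qed
  have fin: "(\<integral>\<^sup>+z. ennreal (v z * indicator A z) \<partial>circle) < \<infinity>"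
    if "integrable circle v" "A \<in> sets borel" for v :: "complex \<Rightarrow> real" and A
  proof -
    have "(\<integral>\<^sup>+z. ennreal (v z * indicator A z) \<partial>circle) \<le> (\<integral>\<^sup>+z. ennreal (norm (v z)) \<partial>circle)"
      by (intro nn_integral_mono) (auto simp: indicator_def intro: ennreal_leI)
    also have "\<dots> < \<infinity>" using that(1) by (simp add: integrable_iff_bounded)
    finally show ?thesis .
  qed
  have closed_eq: "emeasure (D' u) A = emeasure (D' (\<lambda>z. - u z)) A" if "closed A" for A
  proof -
    have [measurable]: "A \<in> sets borel" using that by auto
    have "A \<inter> sphere 0 1 \<in> sets circle" by (auto simp: sets_circle sets_restrict_space)
    have ind: "(\<lambda>z. indicator A z :: real) \<in> borel_measurable circle"
      using \<open>A \<inter> sphere 0 1 \<in> sets circle\<close>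
      by (subst measurable_cong[of _ _ "indicator (A \<inter> sphere 0 1)"]) (auto simp: space_circle indicator_def)
    have i: "integrable circle (\<lambda>z. u z * indicator A z)"
      by (rule Bochner_Integration.integrable_bound[OF u])
         (use ind in \<open>auto simp: indicator_def intro!: borel_measurable_times\<close>)
    have "enn2real (\<integral>\<^sup>+z. ennreal (u z * indicator A z) \<partial>circle)
        = enn2real (\<integral>\<^sup>+z. ennreal (- (u z * indicator A z)) \<partial>circle)"
      using c[OF that] unfolding real_lebesgue_integral_def[OF i] by simp
    moreover have "(\<integral>\<^sup>+z. ennreal (- (u z * indicator A z)) \<partial>circle) < top"
      using fin[of "\<lambda>z. - u z" A] u by simp
    moreover have "(\<integral>\<^sup>+z. ennreal (u z * indicator A z) \<partial>circle) < top"
      using fin[OF u, of A] by simp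
    ultimately have "(\<integral>\<^sup>+z. ennreal (u z * indicator A z) \<partial>circle)
        = (\<integral>\<^sup>+z. ennreal (- (u z * indicator A z)) \<partial>circle)"
      using ennreal_enn2real by metis
    then show ?thesis by (simp add: em)
  qed
  have "D' u = D' (\<lambda>z. - u z)"
  proof (rule measure_eqI_generator_eq[of "Collect closed" UNIV _ _ "\<lambda>_. UNIV"])
    show "Int_stable (Collect closed)" by (auto simp: Int_stable_def)
    show "sets (D' u) = sigma_sets UNIV (Collect closed)" "sets (D' (\<lambda>z. - u z)) = sigma_sets UNIV (Collect closed)"
      by (simp_all add: D'_def borel_eq_closed)
    show "emeasure (D' u) UNIV \<noteq> \<infinity>" using fin[OF u, of UNIV] by (simp add: em)
  qed (use closed_eq in auto)
  then have eq: "emeasure (D' u) A = emeasure (D' (\<lambda>z. - u z)) A" for A by simp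
  have "D u = D (\<lambda>z. - u z)"
  proof (rule measure_eqI)
    fix A assume "A \<in> sets (D u)"
    then have A: "A \<in> sets circle" by (simp add: D_def)
    then have [measurable]: "A \<in> sets borel" and "A \<subseteq> sphere 0 1"
      by (auto simp: sets_circle sets_restrict_space)
    have "emeasure (D v) A = emeasure (D' v) A" if "v \<in> borel_measurable circle" for v
    proof -
      have "A = (\<lambda>z. z) -` A \<inter> space (D v)" using \<open>A \<subseteq> sphere 0 1\<close> by (auto simp: D_def space_circle)
      then show ?thesis unfolding D'_def by (subst emeasure_distr[OF id]) auto
    qed
    then show "emeasure (D u) A = emeasure (D (\<lambda>z. - u z)) A" using eq[of A] by simp
  qed (simp add: D_def)
  then have "AE z in circle. ennreal (u z) = ennreal (- u z)"
    unfolding D_def by (intro circle.density_unique) auto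
  then show ?thesis
  proof eventually_elim
    case (elim z)
    then show ?case by (cases "u z \<ge> 0") (auto simp: ennreal_neg ennreal_eq_0_iff not_le)
  qed
qed

text \<open>
  The integral against every continuous function vanishes, and indicators of closed sets are bounded
  pointwise limits of continuous functions.
\<close>

lemma AE_eq_0_if_fourier_coeff_0:
  assumes f: "integrable circle f" and c0: "\<And>n. fourier_coeff f n = 0"
  shows "AE z in circle. f z = 0"
proof -
  have [measurable]: "f \<in> borel_measurable circle" using f by auto
  have A0: "(\<integral>z. f z * indicator A z \<partial>circle) = 0" if A: "closed A" for A
  proof (cases "A = {}")
    case False
    \<comment> \<open>equal to 1 on \<open>A\<close> and to 0 at distance at least \<open>1 / n\<close> from \<open>A\<close>\<close>
    define \<phi> where "\<phi> n z = complex_of_real (max 0 (1 - real n * infdist z A))" for n z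
    have c\<phi>: "continuous_on S (\<phi> n)" for S n
      unfolding \<phi>_def by (intro continuous_intros)
    have lim: "(\<lambda>n. \<phi> n z) \<longlonglongrightarrow> indicator A z" for z
    proof (cases "z \<in> A")
      case True
      then show ?thesis by (simp add: \<phi>_def)
    next
      case zA: False
      then have pos: "infdist z A > 0"
        using A False by (metis in_closed_iff_infdist_zero infdist_nonneg less_eq_real_def)
      then obtain N where N: "real N * infdist z A > 1"
        by (metis ex_less_of_nat_mult)
      have "\<phi> n z = 0" if "n \<ge> N" for n
      proof -
        have "real N * infdist z A \<le> real n * infdist z A"
          using that pos by (intro mult_right_mono) auto
        then show ?thesis using N by (simp add: \<phi>_def)
      qed
      then show ?thesis using zA by (intro tendsto_eventually eventually_sequentiallyI[of N]) simp
    qed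
    have "(\<lambda>n. \<integral>z. f z * \<phi> n z \<partial>circle) \<longlonglongrightarrow> (\<integral>z. f z * indicator A z \<partial>circle)"
    proof (rule integral_dominated_convergence[where w = "\<lambda>z. cmod (f z)"])
      show *: "(\<lambda>z. f z * \<phi> n z) \<in> borel_measurable circle" for n
        using borel_measurable_circle_continuous[OF c\<phi>] by measurable
      show "(\<lambda>z. f z * indicator A z) \<in> borel_measurable circle"
        by (rule borel_measurable_LIMSEQ_metric[where f = "\<lambda>n z. f z * \<phi> n z", OF *])
           (intro tendsto_intros lim)
      show "AE z in circle. norm (f z * \<phi> n z) \<le> cmod (f z)" for n
        by (auto simp: \<phi>_def norm_mult mult_left_le infdist_nonneg)
      show "AE z in circle. (\<lambda>n. f z * \<phi> n z) \<longlonglongrightarrow> f z * indicator A z"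
        by (intro AE_I2 tendsto_intros lim)
    qed (use f in auto)
    moreover have "(\<integral>z. f z * \<phi> n z \<partial>circle) = 0" for n
      by (rule integral_eq_0_if_fourier_coeff_0[OF f c0 c\<phi>])
    ultimately show ?thesis by (simp add: LIMSEQ_const_iff)
  qed simp
  have i: "integrable circle (\<lambda>z. f z * indicator A z)" if "closed A" for A
  proof -
    have "A \<inter> sphere 0 1 \<in> sets circle" using that by (auto simp: sets_circle sets_restrict_space)
    then have "integrable circle (\<lambda>z. indicator (A \<inter> sphere 0 1) z *\<^sub>R f z)"
      using f by (rule integrable_mult_indicator)
    then show ?thesis
      by (rule iffD1[OF Bochner_Integration.integrable_cong, rotated 2])
         (auto simp: indicator_def space_circle)
  qed
  have "AE z in circle. Re (f z) = 0" "AE z in circle. Im (f z) = 0"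
  proof (rule_tac [!] AE_eq_0_if_integral_closed_0)
    fix A :: "complex set" assume A: "closed A"
    show "(\<integral>z. Re (f z) * indicator A z \<partial>circle) = 0"
    proof -
      have "(\<lambda>z. Re (f z) * indicator A z) = (\<lambda>z. Re (f z * indicator A z))"
        by (auto simp: indicator_def fun_eq_iff)
      then show ?thesis using integral_Re[OF i[OF A]] A0[OF A] by simp
    qed
    show "(\<integral>z. Im (f z) * indicator A z \<partial>circle) = 0"
    proof -
      have "(\<lambda>z. Im (f z) * indicator A z) = (\<lambda>z. Im (f z * indicator A z))"
        by (auto simp: indicator_def fun_eq_iff)
      then show ?thesis using integral_Im[OF i[OF A]] A0[OF A] by simp
    qed
  qed (use f in auto)
  then show ?thesis by eventually_elim (simp add: complex_eq_iff)
qed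

lemma coeff_L2_abs: "square_integrable h \<Longrightarrow> coeff_L2 (abs_circle_L2 h) n = fourier_coeff h n"
  by (simp add: coeff_L2.abs_eq eq_onp_def)

lemma abs_circle_L2_eq_iff:
  assumes "square_integrable f" "square_integrable g"
  shows "abs_circle_L2 f = abs_circle_L2 g \<longleftrightarrow> (AE z in circle. f z = g z)"
  using Quotient3_rel[OF Quotient3_circle_L2, of f g] assms by simp

lemma circle_L2_eqI:
  assumes "\<And>n. coeff_L2 f n = coeff_L2 g n"
  shows "f = g"
proof -
  obtain h where h: "square_integrable h" "f - g = abs_circle_L2 h" by (rule abs_circle_L2_cases)
  have c0: "fourier_coeff h n = 0" for n
    using assms[of n] by (simp add: coeff_L2_diff flip: coeff_L2_abs[OF h(1)] h(2))
  have "AE z in circle. h z = 0"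
    by (rule AE_eq_0_if_fourier_coeff_0[OF square_integrable_L1(1)[OF h(1)] c0])
  then have "abs_circle_L2 h = 0"
    unfolding zero_circle_L2_def by (subst abs_circle_L2_eq_iff) (use h square_integrable_0 in auto)
  then show ?thesis using h by simp
qed

lemma sum_powi_L2_norm:
  assumes "finite I" "inj_on k I"
  shows "(norm (\<Sum>n\<in>I. c n *\<^sub>C powi_L2 (k n)))\<^sup>2 = (\<Sum>n\<in>I. (cmod (c n))\<^sup>2)"
proof -
  have "pairwise (\<lambda>i j. orthogonal (c i *\<^sub>C powi_L2 (k i)) (c j *\<^sub>C powi_L2 (k j))) I"
    using assms(2)
    by (auto simp: pairwise_def orthogonal_def inner_scaleC_powi_L2 coeff_L2_scaleC coeff_L2_powi inj_on_def)
  moreover have "(norm (c n *\<^sub>C powi_L2 (k n)))\<^sup>2 = (cmod (c n))\<^sup>2" for n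
    by (simp only: power2_norm_eq_inner inner_scaleC_powi_L2) (simp add: coeff_L2_scaleC coeff_L2_powi)
  ultimately show ?thesis
    using norm_sum_Pythagorean[OF assms(1), of "\<lambda>n. c n *\<^sub>C powi_L2 (k n)"] by simp
qed

lemma bessel_inequality_L2:
  assumes "finite I" "inj_on k I"
  shows "(\<Sum>n\<in>I. (cmod (coeff_L2 f (k n)))\<^sup>2) \<le> (norm f)\<^sup>2"
proof -
  let ?p = "\<Sum>n\<in>I. coeff_L2 f (k n) *\<^sub>C powi_L2 (k n)"
  have "f \<bullet> ?p = (\<Sum>n\<in>I. (cmod (coeff_L2 f (k n)))\<^sup>2)"
    by (simp add: inner_sum_right inner_scaleC_powi_L2 power2_norm_eq_inner)
  also have "\<dots> = (norm ?p)\<^sup>2"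
    by (simp add: sum_powi_L2_norm[OF assms])
  finally have eq: "f \<bullet> ?p = (norm ?p)\<^sup>2" .
  have "(norm ?p)\<^sup>2 \<le> norm f * norm ?p"
    using norm_cauchy_schwarz[of f ?p] by (simp add: eq)
  then have "norm ?p \<le> norm f"
    by (cases "norm ?p = 0") (auto simp: power2_eq_square mult_le_cancel_right)
  then show ?thesis
    unfolding sum_powi_L2_norm[OF assms, symmetric] by (intro power_mono) auto
qed

lemma summable_coeff_L2:
  assumes "inj k"
  shows "summable (\<lambda>n :: nat. (cmod (coeff_L2 f (k n)))\<^sup>2)"
  by (rule summableI_nonneg_bounded[where x = "(norm f)\<^sup>2"])
     (auto intro!: bessel_inequality_L2 inj_on_subset[OF assms])

lemma summable_powi_L2:
  assumes k: "inj k" and sq: "summable (\<lambda>n :: nat. (cmod (c n))\<^sup>2)"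
  shows "summable (\<lambda>n. c n *\<^sub>C powi_L2 (k n))"
  unfolding summable_Cauchy
proof (intro allI impI)
  fix e :: real assume "e > 0"
  then obtain N where N: "\<And>m n. m \<ge> N \<Longrightarrow> norm (\<Sum>i=m..<n. (cmod (c i))\<^sup>2) < e\<^sup>2"
    using sq unfolding summable_Cauchy by (meson zero_less_power)
  have "norm (\<Sum>i=m..<n. c i *\<^sub>C powi_L2 (k i)) < e" if "m \<ge> N" for m n
  proof -
    have "(norm (\<Sum>i=m..<n. c i *\<^sub>C powi_L2 (k i)))\<^sup>2 < e\<^sup>2"
      using N[OF that, of n] sum_powi_L2_norm[OF finite_atLeastLessThan inj_on_subset[OF k subset_UNIV]] by simp
    then show ?thesis
      using \<open>e > 0\<close> by (rule power2_less_imp_less[OF _ less_imp_le])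
  qed
  then show "\<exists>N. \<forall>m\<ge>N. \<forall>n. norm (\<Sum>i=m..<n. c i *\<^sub>C powi_L2 (k i)) < e"
    by blast
qed

lemma coeff_L2_sum: "coeff_L2 (\<Sum>i\<in>I. f i) n = (\<Sum>i\<in>I. coeff_L2 (f i) n)"
  by (induction I rule: infinite_finite_induct) (simp_all add: coeff_L2_add)

lemma coeff_L2_sums:
  assumes "f sums s"
  shows "(\<lambda>i. coeff_L2 (f i) n) sums coeff_L2 s n"
  using tendsto_coeff_L2[OF assms[unfolded sums_def], of n] by (simp add: sums_def coeff_L2_sum)

lemma coeff_L2_powi_sums:
  assumes "inj k" "(\<lambda>n. c n *\<^sub>C powi_L2 (k n)) sums f"
  shows "coeff_L2 f m = (if m \<in> range k then c (inv k m) else 0)"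
proof -
  have eq: "coeff_L2 (c n *\<^sub>C powi_L2 (k n)) m = (if m \<in> range k \<and> n = inv k m then c n else 0)" for n
    using assms(1) by (auto simp: coeff_L2_scaleC coeff_L2_powi f_inv_into_f)
  have "(\<lambda>n. coeff_L2 (c n *\<^sub>C powi_L2 (k n)) m) sums coeff_L2 f m"
    by (rule coeff_L2_sums[OF assms(2)])
  moreover have "(\<lambda>n. coeff_L2 (c n *\<^sub>C powi_L2 (k n)) m) sums (if m \<in> range k then c (inv k m) else 0)"
    unfolding eq by (cases "m \<in> range k") (simp_all add: sums_single)
  ultimately show ?thesis by (rule sums_unique2)
qed

text \<open>
  The bijection \<open>int_decode\<close> arranges the two-sided series as an ordinary one.
\<close>

lemma fourier_expansion_L2:
  "(\<lambda>n. coeff_L2 f (int_decode n) *\<^sub>C powi_L2 (int_decode n)) sums f"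
proof -
  have s: "(\<lambda>n. coeff_L2 f (int_decode n) *\<^sub>C powi_L2 (int_decode n)) sums
      (\<Sum>n. coeff_L2 f (int_decode n) *\<^sub>C powi_L2 (int_decode n))" (is "_ sums ?s")
    by (intro summable_sums summable_powi_L2 summable_coeff_L2 inj_int_decode)
  have "?s = f"
  proof (rule circle_L2_eqI)
    show "coeff_L2 ?s n = coeff_L2 f n" for n
      using coeff_L2_powi_sums[OF inj_int_decode s, of n] by (simp add: f_inv_into_f surj_int_decode)
  qed
  then show ?thesis using s by simp
qed

section \<open>Multiplication operators and bounded analytic symbols\<close>

lemma ess_bounded_const: "ess_bounded (\<lambda>_. c)"
  by (auto simp: ess_bounded_def)

lemma ess_bounded_powi: "ess_bounded (\<lambda>z. z powi k)"
  by (intro ess_bounded_continuous continuous_on_powi_sphere)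

lemma ess_boundedI: "f \<in> borel_measurable circle \<Longrightarrow> AE z in circle. cmod (f z) \<le> C \<Longrightarrow> ess_bounded f"
  by (auto simp: ess_bounded_def)

lemma ess_bounded_add:
  assumes "ess_bounded f" "ess_bounded g"
  shows "ess_bounded (\<lambda>z. f z + g z)"
proof -
  obtain C D where [measurable]: "f \<in> borel_measurable circle" "g \<in> borel_measurable circle"
    and C: "AE z in circle. cmod (f z) \<le> C" and D: "AE z in circle. cmod (g z) \<le> D"
    using assms by (auto simp: ess_bounded_def)
  have "AE z in circle. cmod (f z + g z) \<le> C + D"
    using C D by eventually_elim (rule norm_triangle_mono)
  then show ?thesis by (intro ess_boundedI) measurable
qed

lemma ess_bounded_mult:
  assumes "ess_bounded f" "ess_bounded g"
  shows "ess_bounded (\<lambda>z. f z * g z)"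
proof -
  obtain C D where [measurable]: "f \<in> borel_measurable circle" "g \<in> borel_measurable circle"
    and C: "AE z in circle. cmod (f z) \<le> C" and D: "AE z in circle. cmod (g z) \<le> D"
    using assms by (auto simp: ess_bounded_def)
  have "AE z in circle. cmod (f z * g z) \<le> C * D"
    using C D
  proof eventually_elim
    case (elim z)
    then show ?case unfolding norm_mult by (intro mult_mono) (auto intro: order_trans[OF norm_ge_zero])
  qed
  then show ?thesis by (intro ess_boundedI) measurable
qed

lemma ess_bounded_cnj:
  assumes "ess_bounded f"
  shows "ess_bounded (\<lambda>z. cnj (f z))"
proof -
  have "(\<lambda>z. cnj (f z)) \<in> borel_measurable circle"
    using assms borel_measurable_continuous_on[of cnj f circle] by (simp add: ess_bounded_def)
  then show ?thesis using assms by (simp add: ess_bounded_def)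
qed

lemma ess_bounded_power: "ess_bounded f \<Longrightarrow> ess_bounded (\<lambda>z. f z ^ n)"
  by (induction n) (auto intro: ess_bounded_const ess_bounded_mult)

lemma square_integrable_ess_bounded: "ess_bounded f \<Longrightarrow> square_integrable f"
  using square_integrable_mult_ess_bounded[OF _ square_integrable_const[of 1]] by simp

lemma mult_L2_abs:
  "ess_bounded F \<Longrightarrow> square_integrable u \<Longrightarrow> mult_L2 F (abs_circle_L2 u) = abs_circle_L2 (\<lambda>z. F z * u z)"
  by (simp add: mult_L2.abs_eq)

lemma mult_L2_add:
  assumes "ess_bounded F"
  shows "mult_L2 F (f + g) = mult_L2 F f + mult_L2 F g"
proof -
  obtain u v where "square_integrable u" "f = abs_circle_L2 u" "square_integrable v" "g = abs_circle_L2 v"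
    by (metis abs_circle_L2_cases)
  then show ?thesis
    using assms by (simp add: mult_L2_abs plus_circle_L2.abs_eq square_integrable_mult_ess_bounded
        square_integrable_add ring_distribs)
qed

lemma mult_L2_scaleC:
  assumes "ess_bounded F"
  shows "mult_L2 F (c *\<^sub>C f) = c *\<^sub>C mult_L2 F f"
proof -
  obtain u where "square_integrable u" "f = abs_circle_L2 u"
    by (rule abs_circle_L2_cases)
  then show ?thesis
    using assms by (simp add: mult_L2_abs scaleC_circle_L2.abs_eq square_integrable_mult_ess_bounded
        square_integrable_cmult mult.left_commute)
qed

lemma mult_L2_diff: "ess_bounded F \<Longrightarrow> mult_L2 F (f - g) = mult_L2 F f - mult_L2 F g"
  using mult_L2_add[of F "f - g" g] by (simp add: eq_diff_eq)

lemma norm_mult_L2_le: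
  assumes F: "ess_bounded F" "AE z in circle. cmod (F z) \<le> C" and "C \<ge> 0"
  shows "norm (mult_L2 F f) \<le> C * norm f"
proof -
  obtain h where h: "square_integrable h" "f = abs_circle_L2 h"
    by (rule abs_circle_L2_cases)
  have sq: "square_integrable (\<lambda>z. F z * h z)" by (rule square_integrable_mult_ess_bounded[OF F(1) h(1)])
  have "(\<integral>z. (cmod (F z * h z))\<^sup>2 \<partial>circle) \<le> (\<integral>z. C\<^sup>2 * (cmod (h z))\<^sup>2 \<partial>circle)"
  proof (rule integral_mono_AE)
    show "AE z in circle. (cmod (F z * h z))\<^sup>2 \<le> C\<^sup>2 * (cmod (h z))\<^sup>2"
      using F(2) by eventually_elim (auto simp: norm_mult power_mult_distrib intro!: mult_right_mono power_mono)
  qed (use h sq in \<open>auto simp: square_integrable_def\<close>)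
  then have "sqrt (\<integral>z. (cmod (F z * h z))\<^sup>2 \<partial>circle) \<le> sqrt (C\<^sup>2 * (\<integral>z. (cmod (h z))\<^sup>2 \<partial>circle))"
    by simp
  then show ?thesis
    using h sq \<open>C \<ge> 0\<close> by (simp add: mult_L2_abs[OF F(1)] norm_circle_L2_abs real_sqrt_mult)
qed

lemma bounded_linear_mult_L2:
  assumes "ess_bounded F"
  shows "bounded_linear (mult_L2 F)"
proof -
  obtain C where C: "AE z in circle. cmod (F z) \<le> C" using assms by (auto simp: ess_bounded_def)
  have "AE z in circle. cmod (F z) \<le> \<bar>C\<bar>" using C by eventually_elim auto
  then show ?thesis
    using assms norm_mult_L2_le[OF assms]
    by (intro bounded_linear_intro[where K = "\<bar>C\<bar>"])
       (simp_all add: mult_L2_add mult_L2_scaleC scaleR_eq_scaleC mult.commute)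
qed

lemma mult_L2_mult_L2:
  assumes "ess_bounded F" "ess_bounded G"
  shows "mult_L2 F (mult_L2 G f) = mult_L2 (\<lambda>z. F z * G z) f"
proof -
  obtain u where "square_integrable u" "f = abs_circle_L2 u" by (rule abs_circle_L2_cases)
  then show ?thesis
    using assms by (simp add: mult_L2_abs square_integrable_mult_ess_bounded ess_bounded_mult mult.assoc)
qed

lemma mult_L2_cong_AE:
  assumes "ess_bounded F" "ess_bounded G" "AE z in circle. F z = G z"
  shows "mult_L2 F = mult_L2 G"
proof
  fix f
  obtain u where u: "square_integrable u" "f = abs_circle_L2 u" by (rule abs_circle_L2_cases)
  have "AE z in circle. F z * u z = G z * u z" using assms(3) by eventually_elim simp
  then show "mult_L2 F f = mult_L2 G f"
    using assms u by (simp add: mult_L2_abs abs_circle_L2_eq_iff square_integrable_mult_ess_bounded)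
qed

lemma coeff_mult_powi_L2:
  assumes "ess_bounded F"
  shows "coeff_L2 (mult_L2 F (powi_L2 k)) n = fourier_coeff F (n - k)"
proof -
  have "coeff_L2 (mult_L2 F (powi_L2 k)) n = fourier_coeff (\<lambda>z. F z * z powi k) n"
    using assms by (simp add: powi_L2.abs_eq powi_L2_def mult_L2_abs square_integrable_powi coeff_L2_abs
        square_integrable_mult_ess_bounded)
  also have "\<dots> = fourier_coeff F (n - k)"
    unfolding fourier_coeff_def
  proof (rule Bochner_Integration.integral_cong)
    fix z assume "z \<in> space circle"
    then have "z \<noteq> 0" by (auto simp: space_circle)
    then have "z powi k * z powi (- n) = z powi (- (n - k))" by (simp flip: power_int_add)
    then show "F z * z powi k * z powi (- n) = F z * z powi (- (n - k))" by (simp add: mult.assoc)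
  qed simp
  finally show ?thesis .
qed

text \<open>
  The Fourier coefficients of a product are the convolution. That products of analytic functions are
  analytic, and both product rules for Toeplitz operators, are read off from this formula.
\<close>

lemma coeff_mult_L2_sums:
  assumes "ess_bounded F"
  shows "(\<lambda>j. coeff_L2 f (int_decode j) * fourier_coeff F (n - int_decode j)) sums coeff_L2 (mult_L2 F f) n"
  using coeff_L2_sums[OF bounded_linear.sums[OF bounded_linear_mult_L2[OF assms] fourier_expansion_L2[of f]], of n]
  by (simp add: mult_L2_scaleC[OF assms] coeff_L2_scaleC coeff_mult_powi_L2[OF assms])

lemma coeff_mult_L2_eq_0:
  assumes "ess_bounded F" "\<And>k. coeff_L2 f k = 0 \<or> fourier_coeff F (n - k) = 0"
  shows "coeff_L2 (mult_L2 F f) n = 0"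
proof -
  have "(\<lambda>j. coeff_L2 f (int_decode j) * fourier_coeff F (n - int_decode j)) = (\<lambda>_. 0)"
    using assms(2) by auto
  then show ?thesis using coeff_mult_L2_sums[OF assms(1), of f n] by (simp add: sums_iff)
qed

definition H_infinity :: "(complex \<Rightarrow> complex) \<Rightarrow> bool"
  where "H_infinity f \<longleftrightarrow> ess_bounded f \<and> (\<forall>n<0. fourier_coeff f n = 0)"

lemma H_infinityD: "H_infinity f \<Longrightarrow> ess_bounded f" "H_infinity f \<Longrightarrow> n < 0 \<Longrightarrow> fourier_coeff f n = 0"
  by (auto simp: H_infinity_def)

lemma integrable_ess_bounded: "ess_bounded f \<Longrightarrow> integrable circle f"
  by (intro square_integrable_L1 square_integrable_ess_bounded)

lemma fourier_coeff_powi: "fourier_coeff (\<lambda>z. z powi m) n = (if m = n then 1 else 0)"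
  using coeff_L2_powi[of m n] by (simp add: powi_L2.abs_eq powi_L2_def coeff_L2_abs square_integrable_powi)

lemma fourier_coeff_const: "fourier_coeff (\<lambda>_. c) n = (if n = 0 then c else 0)"
proof -
  have "fourier_coeff (\<lambda>_. c) n = c * fourier_coeff (\<lambda>z. z powi 0) n"
    by (simp add: fourier_coeff_def)
  then show ?thesis by (simp only: fourier_coeff_powi) auto
qed

lemma fourier_coeff_add:
  assumes "ess_bounded f" "ess_bounded g"
  shows "fourier_coeff (\<lambda>z. f z + g z) n = fourier_coeff f n + fourier_coeff g n"
proof -
  have "integrable circle (\<lambda>z. h z * z powi (- n))" if "ess_bounded h" for h
    by (intro integrable_ess_bounded ess_bounded_mult ess_bounded_powi that)
  then show ?thesis using assms by (simp add: fourier_coeff_def distrib_right)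
qed

lemma fourier_coeff_cmult: "fourier_coeff (\<lambda>z. c * f z) n = c * fourier_coeff f n"
  by (simp add: fourier_coeff_def mult.assoc)

lemma ess_bounded_sum_powi: "ess_bounded (\<lambda>z. \<Sum>i\<in>I. c i * z powi k i)"
  by (induction I rule: infinite_finite_induct)
     (simp_all add: ess_bounded_const ess_bounded_add ess_bounded_mult ess_bounded_powi)

lemma fourier_coeff_sum_powi:
  "fourier_coeff (\<lambda>z. \<Sum>i\<in>I. c i * z powi k i) n = (\<Sum>i\<in>I. if k i = n then c i else 0)"
  by (induction I rule: infinite_finite_induct)
     (simp_all add: fourier_coeff_const fourier_coeff_add ess_bounded_sum_powi ess_bounded_mult
       ess_bounded_const ess_bounded_powi fourier_coeff_cmult fourier_coeff_powi)

lemma fourier_coeff_cnj: "fourier_coeff (\<lambda>z. cnj (f z)) n = cnj (fourier_coeff f (- n))"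
proof -
  have "fourier_coeff (\<lambda>z. cnj (f z)) n = (\<integral>z. cnj (f z * z powi n) \<partial>circle)"
    unfolding fourier_coeff_def
  proof (rule Bochner_Integration.integral_cong)
    fix z assume "z \<in> space circle"
    then have "inverse z = cnj z" by (simp add: space_circle inverse_eq_cnj_circle)
    then have "z powi (- n) = cnj (z powi n)"
      by (simp add: power_int_minus power_int_inverse flip: power_int_inverse)
    then show "cnj (f z) * z powi (- n) = cnj (f z * z powi n)" by simp
  qed simp
  also have "\<dots> = cnj (\<integral>z. f z * z powi n \<partial>circle)" by (rule integral_bounded_linear'[OF bounded_linear_cnj bounded_linear_cnj]) simp
  finally show ?thesis by (simp add: fourier_coeff_def)
qed

lemma fourier_coeff_mult_abs:
  assumes "ess_bounded f" "ess_bounded g"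
  shows "fourier_coeff (\<lambda>z. f z * g z) n = coeff_L2 (mult_L2 f (abs_circle_L2 g)) n"
  using assms by (simp add: mult_L2_abs square_integrable_ess_bounded coeff_L2_abs ess_bounded_mult)

lemma H_infinity_const: "H_infinity (\<lambda>_. c)"
  by (simp add: H_infinity_def ess_bounded_const fourier_coeff_const)

lemma H_infinity_powi: "0 \<le> k \<Longrightarrow> H_infinity (\<lambda>z. z powi k)"
  by (simp add: H_infinity_def ess_bounded_powi fourier_coeff_powi)

lemma H_infinity_add: "H_infinity f \<Longrightarrow> H_infinity g \<Longrightarrow> H_infinity (\<lambda>z. f z + g z)"
  by (simp add: H_infinity_def ess_bounded_add fourier_coeff_add)

lemma H_infinity_mult:
  assumes "H_infinity f" "H_infinity g"
  shows "H_infinity (\<lambda>z. f z * g z)"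
  unfolding H_infinity_def
proof (intro conjI allI impI)
  show "ess_bounded (\<lambda>z. f z * g z)" using assms by (simp add: H_infinityD ess_bounded_mult)
  fix n :: int assume n: "n < 0"
  show "fourier_coeff (\<lambda>z. f z * g z) n = 0"
    unfolding fourier_coeff_mult_abs[OF H_infinityD(1)[OF assms(1)] H_infinityD(1)[OF assms(2)]]
  proof (rule coeff_mult_L2_eq_0)
    show "coeff_L2 (abs_circle_L2 g) k = 0 \<or> fourier_coeff f (n - k) = 0" for k
      using assms n by (cases "k < 0") (auto simp: H_infinity_def coeff_L2_abs square_integrable_ess_bounded)
  qed (use assms in \<open>simp add: H_infinityD\<close>)
qed

lemma H_infinity_power: "H_infinity f \<Longrightarrow> H_infinity (\<lambda>z. f z ^ n)"
  by (induction n) (auto intro: H_infinity_const H_infinity_mult)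

lemma H_infinity_cmult: "H_infinity f \<Longrightarrow> H_infinity (\<lambda>z. c * f z)"
  by (intro H_infinity_mult H_infinity_const)

lemma H_infinity_sum: "(\<And>i. i \<in> I \<Longrightarrow> H_infinity (f i)) \<Longrightarrow> H_infinity (\<lambda>z. \<Sum>i\<in>I. f i z)"
  by (induction I rule: infinite_finite_induct) (auto intro: H_infinity_const H_infinity_add)

lemma fourier_coeff_LIMSEQ:
  assumes f: "\<And>i. ess_bounded (f i)" and C: "\<And>i. AE z in circle. cmod (f i z) \<le> C"
    and g: "g \<in> borel_measurable circle"
    and lim: "\<And>z. z \<in> sphere 0 1 \<Longrightarrow> (\<lambda>i. f i z) \<longlonglongrightarrow> g z"
  shows "(\<lambda>i. fourier_coeff (f i) n) \<longlonglongrightarrow> fourier_coeff g n"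
  unfolding fourier_coeff_def
proof (rule integral_dominated_convergence[where w = "\<lambda>_. C"])
  show "AE z in circle. (\<lambda>i. f i z * z powi (- n)) \<longlonglongrightarrow> g z * z powi (- n)"
    by (intro AE_I2 tendsto_intros lim) (simp add: space_circle)
  show "AE z in circle. norm (f i z * z powi (- n)) \<le> C" for i
    using C[of i] AE_space[of circle] by eventually_elim (simp add: norm_mult norm_circle_powi)
  have [measurable]: "f i \<in> borel_measurable circle" for i using f by (simp add: ess_bounded_def)
  show "(\<lambda>z. f i z * z powi (- n)) \<in> borel_measurable circle" for i by measurable
qed (use g in auto)

text \<open>
  Bounded pointwise convergence replaces the weak-star topology.
\<close>

lemma H_infinity_LIMSEQ:
  assumes f: "\<And>i. H_infinity (f i)" and C: "\<And>i. AE z in circle. cmod (f i z) \<le> C"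
    and lim: "\<And>z. z \<in> sphere 0 1 \<Longrightarrow> (\<lambda>i. f i z) \<longlonglongrightarrow> g z"
  shows "H_infinity g"
proof -
  have m: "f i \<in> borel_measurable circle" for i using f by (auto simp: H_infinity_def ess_bounded_def)
  have lim': "\<And>z. z \<in> space circle \<Longrightarrow> (\<lambda>i. f i z) \<longlonglongrightarrow> g z" using lim by (simp add: space_circle)
  have g: "g \<in> borel_measurable circle"
    by (rule borel_measurable_LIMSEQ_metric[OF m lim'])
  have "AE z in circle. \<forall>i. cmod (f i z) \<le> C" using C by (simp add: AE_all_countable)
  moreover have "AE z in circle. z \<in> space circle" by (rule AE_space)
  ultimately have bd: "AE z in circle. cmod (g z) \<le> C"
  proof eventually_elim
    case (elim z)
    show ?case using elim by (intro Lim_bounded[OF tendsto_norm[OF lim']]) auto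
  qed
  have "fourier_coeff g n = 0" if "n < 0" for n
    using fourier_coeff_LIMSEQ[OF H_infinityD(1)[OF f] C g lim, of n] H_infinityD(2)[OF f that]
    by (simp add: LIMSEQ_const_iff)
  then show ?thesis using ess_boundedI[OF g bd] by (simp add: H_infinity_def)
qed

lemma H_infinity_exp:
  assumes f: "H_infinity f"
  shows "H_infinity (\<lambda>z. exp (f z))"
proof -
  obtain C where C: "AE z in circle. cmod (f z) \<le> C"
    using f by (auto simp: H_infinity_def ess_bounded_def)
  let ?s = "\<lambda>n z. \<Sum>k<n. inverse (fact k) * f z ^ k"
  show ?thesis
  proof (rule H_infinity_LIMSEQ)
    show "H_infinity (?s n)" for n
      by (intro H_infinity_sum H_infinity_cmult H_infinity_power f)
    show "AE z in circle. cmod (?s n z) \<le> exp C" for n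
      using C
    proof eventually_elim
      case (elim z)
      have "cmod (?s n z) \<le> (\<Sum>k<n. inverse (fact k) * cmod (f z) ^ k)"
        by (rule order.trans[OF norm_sum]) (simp add: norm_mult norm_power norm_inverse)
      also have "\<dots> \<le> exp (cmod (f z))"
        unfolding exp_def using summable_exp[of "cmod (f z)"]
        by (intro order.trans[OF sum_le_suminf[of "\<lambda>n. inverse (fact n) * cmod (f z) ^ n"]])
           (auto simp: divide_inverse_commute)
      also have "\<dots> \<le> exp C" using elim by simp
      finally show ?case .
    qed
    show "(\<lambda>n. ?s n z) \<longlonglongrightarrow> exp (f z)" for z
      using exp_converges[of "f z"] by (simp add: sums_def scaleR_conv_of_real of_real_inverse)
  qed
qed

section \<open>Toeplitz operators\<close>

lemma hardy2_eqI:
  assumes "\<And>n. n \<ge> 0 \<Longrightarrow> coeff_L2 (Rep_hardy2 f) n = coeff_L2 (Rep_hardy2 g) n"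
  shows "f = g"
proof -
  have "Rep_hardy2 f = Rep_hardy2 g"
    using assms by (intro circle_L2_eqI) (metis Rep_hardy2_coeff linorder_not_less)
  then show ?thesis by (simp add: Rep_hardy2_inject)
qed

lemma coeff_toeplitz:
  "coeff_L2 (Rep_hardy2 (toeplitz F f)) n = (if n \<ge> 0 then coeff_L2 (mult_L2 F (Rep_hardy2 f)) n else 0)"
  by (simp add: toeplitz_def coeff_riesz_proj)

lemma toeplitz_cong_AE:
  "ess_bounded F \<Longrightarrow> ess_bounded G \<Longrightarrow> AE z in circle. F z = G z \<Longrightarrow> toeplitz F = toeplitz G"
  using mult_L2_cong_AE[of F G] by (simp add: toeplitz_def fun_eq_iff)

lemma Rep_toeplitz_analytic:
  assumes "H_infinity \<phi>"
  shows "Rep_hardy2 (toeplitz \<phi> f) = mult_L2 \<phi> (Rep_hardy2 f)"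
proof (rule circle_L2_eqI)
  show "coeff_L2 (Rep_hardy2 (toeplitz \<phi> f)) n = coeff_L2 (mult_L2 \<phi> (Rep_hardy2 f)) n" for n
  proof (cases "n \<ge> 0")
    case False
    have "coeff_L2 (mult_L2 \<phi> (Rep_hardy2 f)) n = 0"
    proof (rule coeff_mult_L2_eq_0)
      show "coeff_L2 (Rep_hardy2 f) k = 0 \<or> fourier_coeff \<phi> (n - k) = 0" for k
        using assms False by (cases "k < 0") (auto simp: H_infinity_def Rep_hardy2_coeff)
    qed (use assms in \<open>simp add: H_infinityD\<close>)
    then show ?thesis using False by (simp add: coeff_toeplitz)
  qed (simp add: coeff_toeplitz)
qed

text \<open>
  An analytic factor on the right maps the Hardy space into itself, so there is no projection in between.
\<close>

lemma toeplitz_mult_analytic: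
  assumes "H_infinity \<phi>" "ess_bounded \<psi>"
  shows "toeplitz (\<lambda>z. \<psi> z * \<phi> z) f = toeplitz \<psi> (toeplitz \<phi> f)"
  using assms by (simp add: toeplitz_def[of \<psi>] toeplitz_def[of "\<lambda>z. \<psi> z * \<phi> z"] Rep_toeplitz_analytic
      mult_L2_mult_L2 H_infinityD)

text \<open>
  An antianalytic factor on the left maps the orthogonal complement of the Hardy space into itself, so
  what the inner projection drops has no effect on the result.
\<close>

lemma toeplitz_mult_coanalytic:
  assumes \<phi>: "H_infinity (\<lambda>z. cnj (\<phi> z))" and \<psi>: "ess_bounded \<psi>"
  shows "toeplitz (\<lambda>z. \<phi> z * \<psi> z) f = toeplitz \<phi> (toeplitz \<psi> f)"
proof (rule hardy2_eqI)
  fix n :: int assume n: "n \<ge> 0"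
  have b: "ess_bounded \<phi>" using ess_bounded_cnj[OF H_infinityD(1)[OF \<phi>]] by simp
  let ?h = "mult_L2 \<psi> (Rep_hardy2 f) - Rep_hardy2 (toeplitz \<psi> f)"
  have "coeff_L2 (mult_L2 \<phi> ?h) n = 0"
  proof (rule coeff_mult_L2_eq_0[OF b])
    fix k
    show "coeff_L2 ?h k = 0 \<or> fourier_coeff \<phi> (n - k) = 0"
    proof (cases "k \<ge> 0")
      case False
      have "fourier_coeff (\<lambda>z. cnj (\<phi> z)) (k - n) = 0"
        using \<phi> n False by (intro H_infinityD) auto
      then show ?thesis by (simp add: fourier_coeff_cnj)
    qed (simp add: coeff_L2_diff coeff_toeplitz)
  qed
  then show "coeff_L2 (Rep_hardy2 (toeplitz (\<lambda>z. \<phi> z * \<psi> z) f)) n = coeff_L2 (Rep_hardy2 (toeplitz \<phi> (toeplitz \<psi> f))) n"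
    using n by (simp add: coeff_toeplitz mult_L2_mult_L2[OF b \<psi>, symmetric] mult_L2_diff[OF b] coeff_L2_diff)
qed

lemma norm_riesz_proj_le: "norm (riesz_proj g) \<le> norm g"
proof (rule LIMSEQ_le_const2)
  show "(\<lambda>N. norm (\<Sum>i<N. coeff_L2 g (int i) *\<^sub>C powi_hardy2 i)) \<longlonglongrightarrow> norm (riesz_proj g)"
    unfolding riesz_proj_def by (intro tendsto_norm summable_LIMSEQ summable_riesz_proj)
  have "norm (\<Sum>i<N. coeff_L2 g (int i) *\<^sub>C powi_hardy2 i) \<le> norm g" for N
    by (rule power2_le_imp_le) (auto simp: sum_powi_hardy2_norm bessel_inequality)
  then show "\<exists>N. \<forall>n\<ge>N. norm (\<Sum>i<n. coeff_L2 g (int i) *\<^sub>C powi_hardy2 i) \<le> norm g"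
    by simp
qed

lemma norm_toeplitz_le_mult_L2: "norm (toeplitz F f) \<le> norm (mult_L2 F (Rep_hardy2 f))"
  by (simp add: toeplitz_def norm_riesz_proj_le)

lemma norm_toeplitz_le:
  assumes "ess_bounded F" "AE z in circle. cmod (F z) \<le> C" "C \<ge> 0"
  shows "norm (toeplitz F f) \<le> C * norm f"
  using norm_toeplitz_le_mult_L2[of F f] norm_mult_L2_le[OF assms, of "Rep_hardy2 f"]
  by (simp add: norm_hardy2.rep_eq)

lemma toeplitz_add:
  assumes "ess_bounded F" "ess_bounded G"
  shows "toeplitz (\<lambda>z. F z + G z) f = toeplitz F f + toeplitz G f"
proof (rule hardy2_eqI)
  obtain u where u: "square_integrable u" "Rep_hardy2 f = abs_circle_L2 u" by (rule abs_circle_L2_cases)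
  have "mult_L2 (\<lambda>z. F z + G z) (Rep_hardy2 f) = mult_L2 F (Rep_hardy2 f) + mult_L2 G (Rep_hardy2 f)"
    using assms u by (simp add: mult_L2_abs ess_bounded_add plus_circle_L2.abs_eq
        square_integrable_mult_ess_bounded distrib_right)
  then show "n \<ge> 0 \<Longrightarrow> coeff_L2 (Rep_hardy2 (toeplitz (\<lambda>z. F z + G z) f)) n = coeff_L2 (Rep_hardy2 (toeplitz F f + toeplitz G f)) n" for n
    by (simp add: coeff_toeplitz plus_hardy2.rep_eq coeff_L2_add)
qed

lemma toeplitz_const: "toeplitz (\<lambda>_. c) f = c *\<^sub>C f"
proof (rule hardy2_eqI)
  obtain u where u: "square_integrable u" "Rep_hardy2 f = abs_circle_L2 u" by (rule abs_circle_L2_cases)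
  have "mult_L2 (\<lambda>_. c) (Rep_hardy2 f) = c *\<^sub>C Rep_hardy2 f"
    using u by (simp add: mult_L2_abs ess_bounded_const scaleC_circle_L2.abs_eq)
  then show "n \<ge> 0 \<Longrightarrow> coeff_L2 (Rep_hardy2 (toeplitz (\<lambda>_. c) f)) n = coeff_L2 (Rep_hardy2 (c *\<^sub>C f)) n" for n
    by (simp add: coeff_toeplitz scaleC_hardy2.rep_eq)
qed

definition toeplitz_endo :: "(complex \<Rightarrow> complex) \<Rightarrow> hardy2 endo"
  where "toeplitz_endo F = Endo (toeplitz F)"

lemma endo_app_toeplitz [simp]: "endo_app (toeplitz_endo F) = toeplitz F"
  and clin_toeplitz: "clin (toeplitz_endo F)"
  using clin_Endo[OF bounded_clinear_toeplitz[of F]] by (simp_all add: toeplitz_endo_def)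

section \<open>The range of a continuous symbol lies in the spectrum\<close>

lemma coeff_mult_shift_L2:
  "coeff_L2 (mult_L2 (\<lambda>z. z powi m) f) n = coeff_L2 f (n - m)"
proof -
  obtain u where u: "square_integrable u" "f = abs_circle_L2 u" by (rule abs_circle_L2_cases)
  have "coeff_L2 (mult_L2 (\<lambda>z. z powi m) f) n = fourier_coeff (\<lambda>z. z powi m * u z) n"
    using u by (simp add: mult_L2_abs ess_bounded_powi coeff_L2_abs square_integrable_mult_ess_bounded)
  also have "\<dots> = fourier_coeff u (n - m)"
    unfolding fourier_coeff_def
  proof (rule Bochner_Integration.integral_cong)
    fix z assume "z \<in> space circle"
    then have "z \<noteq> 0" by (auto simp: space_circle)
    then have "z powi m * z powi (- n) = z powi (- (n - m))" by (simp flip: power_int_add)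
    then show "z powi m * u z * z powi (- n) = u z * z powi (- (n - m))"
      by (metis mult.commute mult.left_commute)
  qed simp
  finally show ?thesis using u by (simp add: coeff_L2_abs)
qed

lemma norm_mult_shift_L2: "norm (mult_L2 (\<lambda>z. z powi m) f) = norm f"
proof -
  have le: "norm (mult_L2 (\<lambda>z. z powi k) h) \<le> norm h" for k h
    using norm_mult_L2_le[OF ess_bounded_powi[of k], of 1 h] by (simp add: norm_circle_powi)
  have "mult_L2 (\<lambda>z. z powi (- m)) (mult_L2 (\<lambda>z. z powi m) f) = f"
    by (rule circle_L2_eqI) (simp add: coeff_mult_shift_L2)
  then show ?thesis
    using le[of m f] le[of "- m" "mult_L2 (\<lambda>z. z powi m) f"] by simp
qed

lemma ess_bounded_indicator:
  assumes "open U"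
  shows "ess_bounded (indicator U)"
proof (rule ess_boundedI[where C = 1])
  have "U \<inter> sphere 0 1 \<in> sets circle" using assms by (auto simp: sets_circle sets_restrict_space)
  then show "(indicator U :: complex \<Rightarrow> complex) \<in> borel_measurable circle"
    by (subst measurable_cong[of _ _ "indicator (U \<inter> sphere 0 1)"]) (auto simp: space_circle indicator_def)
qed (auto simp: indicator_def)

lemma toeplitz_minus_const:
  assumes "ess_bounded F"
  shows "toeplitz_endo (\<lambda>z. F z - c) = toeplitz_endo F - cscale c"
proof (rule endo_eqI)
  fix f
  have "toeplitz (\<lambda>z. F z + - c) f = toeplitz F f + (- c) *\<^sub>C f"
    by (simp only: toeplitz_add[OF assms ess_bounded_const] toeplitz_const)
  moreover have "(- c) *\<^sub>C f = - (c *\<^sub>C f)"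
    using scaleC_add_left[of "- c" c f] scaleC_add_left[of 0 0 f] by (simp add: eq_neg_iff_add_eq_0)
  ultimately show "endo_app (toeplitz_endo (\<lambda>z. F z - c)) f = endo_app (toeplitz_endo F - cscale c) f"
    by simp
qed

text \<open>
  A lower bound for a Toeplitz operator passes to the multiplication operator on the whole space:
  a trigonometric polynomial times a high power of \<open>z\<close> lies in the Hardy space, and
  multiplication by powers of \<open>z\<close> is isometric and commutes with multiplication by \<open>G\<close>.
\<close>

lemma mult_L2_bounded_below:
  assumes G: "ess_bounded G" and "K \<ge> 0" and below: "\<And>f. norm f \<le> K * norm (toeplitz G f)"
  shows "norm f \<le> K * norm (mult_L2 G f)"
proof -
  define t where "t N = (\<Sum>n<N. coeff_L2 f (int_decode n) *\<^sub>C powi_L2 (int_decode n))" for N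
  have t: "t \<longlonglongrightarrow> f"
    using fourier_expansion_L2[of f] by (simp add: t_def[abs_def] sums_def)
  have le: "norm (t N) \<le> K * norm (mult_L2 G (t N))" for N
  proof -
    define m where "m = (\<Sum>n<N. \<bar>int_decode n\<bar>)"
    let ?s = "mult_L2 (\<lambda>z. z powi m) (t N)"
    have "coeff_L2 ?s k = 0" if "k < 0" for k
    proof -
      have "coeff_L2 (coeff_L2 f (int_decode n) *\<^sub>C powi_L2 (int_decode n)) (k - m) = 0" if "n < N" for n
      proof -
        have "\<bar>int_decode n\<bar> \<le> m" unfolding m_def using that by (intro member_le_sum) auto
        then show ?thesis using \<open>k < 0\<close> by (auto simp: coeff_L2_scaleC coeff_L2_powi)
      qed
      then show ?thesis by (simp add: coeff_mult_shift_L2 t_def coeff_L2_sum)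
    qed
    then have Rep: "Rep_hardy2 (Abs_hardy2 ?s) = ?s" by (simp add: Abs_hardy2_inverse)
    have "norm (t N) = norm (Abs_hardy2 ?s)" by (simp add: norm_hardy2.rep_eq Rep norm_mult_shift_L2)
    also have "\<dots> \<le> K * norm (toeplitz G (Abs_hardy2 ?s))" by (rule below)
    also have "\<dots> \<le> K * norm (mult_L2 G ?s)"
      using norm_toeplitz_le_mult_L2[of G "Abs_hardy2 ?s"] \<open>K \<ge> 0\<close> by (simp add: Rep mult_left_mono)
    also have "mult_L2 G ?s = mult_L2 (\<lambda>z. z powi m) (mult_L2 G (t N))"
      using G by (simp add: mult_L2_mult_L2 ess_bounded_powi mult.commute)
    finally show ?thesis by (simp add: norm_mult_shift_L2)
  qed
  show ?thesis
  proof (rule LIMSEQ_le)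
    show "(\<lambda>N. norm (t N)) \<longlonglongrightarrow> norm f" by (intro tendsto_norm t)
    show "(\<lambda>N. K * norm (mult_L2 G (t N))) \<longlonglongrightarrow> K * norm (mult_L2 G f)"
      by (intro tendsto_mult tendsto_const tendsto_norm bounded_linear.tendsto[OF bounded_linear_mult_L2[OF G]] t)
  qed (use le in blast)
qed

text \<open>
  If \<open>T - F z0\<close> were invertible, then multiplication by \<open>F - F z0\<close> would be bounded below. The
  indicator of a short arc around \<open>z0\<close>, where the symbol is small, contradicts this.
\<close>

lemma range_subset_op_spectrum_toeplitz:
  assumes F: "continuous_on (sphere 0 1) F" and z0: "z0 \<in> sphere 0 1"
  shows "F z0 \<in> op_spectrum (toeplitz F)"
proof (rule ccontr)
  define c where "c = F z0"
  assume "F z0 \<notin> op_spectrum (toeplitz F)"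
  then obtain R where R: "R * (toeplitz_endo F - cscale c) = 1"
    using not_in_op_spectrum_iff[of c "toeplitz_endo F"] by (auto simp: c_def)
  have bF: "ess_bounded F" by (rule ess_bounded_continuous[OF F])
  define G where "G z = F z - c" for z
  have cG: "continuous_on (sphere 0 1) G" unfolding G_def by (intro continuous_intros F)
  have bG: "ess_bounded G" by (rule ess_bounded_continuous[OF cG])
  have R': "R * toeplitz_endo G = 1" using R by (simp add: G_def[abs_def] toeplitz_minus_const[OF bF])
  define K where "K = norm R"
  have below: "norm f \<le> K * norm (toeplitz G f)" for f
  proof -
    have "f = endo_app R (toeplitz G f)" using arg_cong[OF R', of "\<lambda>A. endo_app A f"] by simp
    then show ?thesis using norm_endo_app[of R "toeplitz G f"] by (simp add: K_def)
  qed
  \<comment> \<open>any positive bound with \<open>K * e < 1\<close>\<close>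
  define e where "e = 1 / (2 * (K + 1))"
  have "K \<ge> 0" by (simp add: K_def)
  then have e: "e > 0" "K * e < 1" by (auto simp: e_def field_simps)
  have "openin (top_of_set (sphere 0 1)) (sphere 0 1 \<inter> G -` ball 0 e)"
    by (intro continuous_openin_preimage_gen cG open_ball)
  then obtain U where U: "open U" "sphere 0 1 \<inter> G -` ball 0 e = sphere 0 1 \<inter> U"
    unfolding openin_open by blast
  define i where "i = (indicator U :: complex \<Rightarrow> complex)"
  have bi: "ess_bounded i" unfolding i_def by (rule ess_bounded_indicator[OF U(1)])
  define f where "f = abs_circle_L2 i"
  have "mult_L2 G f = mult_L2 (\<lambda>z. G z * i z) f"
    using bG bi by (simp add: f_def mult_L2_abs square_integrable_ess_bounded ess_bounded_mult i_def mult.assoc flip: indicator_inter_arith)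
  also have "norm \<dots> \<le> e * norm f"
  proof (rule norm_mult_L2_le)
    show "AE z in circle. cmod (G z * i z) \<le> e"
    proof (rule AE_I2)
      fix z assume z: "z \<in> space circle"
      show "cmod (G z * i z) \<le> e"
      proof (cases "z \<in> U")
        case True
        then have "z \<in> sphere 0 1 \<inter> G -` ball 0 e" using U(2) z by (simp add: space_circle)
        then show ?thesis using True by (simp add: i_def)
      qed (use e in \<open>simp add: i_def\<close>)
    qed
  qed (use e bG bi in \<open>auto intro: ess_bounded_mult\<close>)
  finally have "norm (mult_L2 G f) \<le> e * norm f" .
  then have "norm f \<le> K * (e * norm f)"
    using mult_L2_bounded_below[OF bG \<open>K \<ge> 0\<close> below, of f] \<open>K \<ge> 0\<close> by (meson mult_left_mono order_trans)
  then have "(1 - K * e) * norm f \<le> 0" by (simp add: algebra_simps)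
  then have "f = 0" using e by (simp add: mult_le_0_iff)
  then have "AE z in circle. i z = 0"
    unfolding f_def zero_circle_L2_def using bi
    by (subst (asm) abs_circle_L2_eq_iff) (auto simp: square_integrable_ess_bounded square_integrable_0)
  then have "AE z in circle. z \<notin> U" by eventually_elim (auto simp: i_def)
  from AE_circle_open_empty[OF this U(1)] have "sphere 0 1 \<inter> G -` ball 0 e = {}" using U(2) by blast
  moreover have "z0 \<in> sphere 0 1 \<inter> G -` ball 0 e" using z0 e by (simp add: G_def c_def)
  ultimately show False by blast
qed

section \<open>A Hardy space function that vanishes on an arc is zero\<close>

text \<open>
  Reflecting the terms of negative index, \<open>Re (c z\<^sup>-\<^sup>k) = Re (cnj c z\<^sup>k)\<close>, leaves the real part unchanged.
\<close>

lemma trig_poly_Re_eq_Re_analytic: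
  assumes "trig_poly t"
  shows "\<exists>p. H_infinity p \<and> fourier_coeff p 0 = 0 \<and> continuous_on (sphere 0 1) p \<and>
    (\<forall>z\<in>sphere 0 1. Re (t z) = Re (fourier_coeff t 0) + Re (p z))"
  using assms
proof (induction rule: trig_poly.induct)
  case (monom c k)
  consider "k > 0" | "k = 0" | "k < 0" by linarith
  then show ?case
  proof cases
    case 1
    then show ?thesis
      by (intro exI[of _ "\<lambda>z. c * z powi k"])
         (auto simp: fourier_coeff_cmult fourier_coeff_powi intro!: H_infinity_cmult H_infinity_powi continuous_intros)
  next
    case 2
    then show ?thesis
      by (intro exI[of _ "\<lambda>_. 0"]) (auto simp: fourier_coeff_const H_infinity_const)
  next
    case 3
    show ?thesis
    proof (intro exI[of _ "\<lambda>z. cnj c * z powi (- k)"] conjI ballI)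
      fix z :: complex assume z: "z \<in> sphere 0 1"
      have "z powi (- k) = cnj (z powi k)"
        using inverse_eq_cnj_circle[OF z] by (simp add: power_int_minus power_int_inverse flip: power_int_inverse)
      then have "cnj c * z powi (- k) = cnj (c * z powi k)" by (simp only: complex_cnj_mult)
      then have "Re (cnj c * z powi (- k)) = Re (c * z powi k)" by (simp only: cnj.sel)
      then show "Re (c * z powi k) = Re (fourier_coeff (\<lambda>z. c * z powi k) 0) + Re (cnj c * z powi (- k))"
        using 3 by (simp only: fourier_coeff_cmult fourier_coeff_powi) simp
    qed (use 3 in \<open>auto simp: fourier_coeff_cmult fourier_coeff_powi intro!: H_infinity_cmult H_infinity_powi continuous_on_mult_left continuous_on_powi_sphere\<close>)
  qed
next
  case (add f g)
  obtain p q where p: "H_infinity p" "fourier_coeff p 0 = 0" "continuous_on (sphere 0 1) p"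
      "\<And>z. z \<in> sphere 0 1 \<Longrightarrow> Re (f z) = Re (fourier_coeff f 0) + Re (p z)"
    and q: "H_infinity q" "fourier_coeff q 0 = 0" "continuous_on (sphere 0 1) q"
      "\<And>z. z \<in> sphere 0 1 \<Longrightarrow> Re (g z) = Re (fourier_coeff g 0) + Re (q z)"
    using add.IH by blast
  have "ess_bounded f" "ess_bounded g"
    using add.hyps by (auto intro: ess_bounded_continuous continuous_on_trig_poly)
  then show ?case
    using p q by (intro exI[of _ "\<lambda>z. p z + q z"])
      (auto simp: fourier_coeff_add H_infinityD intro!: H_infinity_add continuous_intros)
next
  case (cong f g)
  have "fourier_coeff g 0 = fourier_coeff f 0"
    unfolding fourier_coeff_def by (intro Bochner_Integration.integral_cong) (auto simp: cong.hyps space_circle)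
  then show ?case using cong by metis
qed

text \<open>
  Take a real function with mean 0 that is negative off the arc, approximate it by a trigonometric
  polynomial, and let \<open>p\<close> be the analytic function with mean 0 and about that real part. Then
  \<open>q = 1 + e p\<close> has mean 1, and \<open>\<bar>q\<bar>\<^sup>2 = 1 + 2 e Re p + e\<^sup>2 \<bar>p\<bar>\<^sup>2 < 1\<close> off the arc for small \<open>e > 0\<close>.
\<close>

lemma analytic_small_off_arc:
  assumes U: "open U" "U \<inter> sphere 0 1 \<noteq> {}"
  obtains q \<rho> where "H_infinity q" "fourier_coeff q 0 = 1" "0 \<le> \<rho>" "\<rho> < 1"
    "\<And>z. z \<in> sphere 0 1 - U \<Longrightarrow> cmod (q z) \<le> \<rho>"
proof -
  obtain z0 where z0: "z0 \<in> U" "z0 \<in> sphere 0 1" using U(2) by blast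
  obtain \<delta> where \<delta>: "\<delta> > 0" "ball z0 \<delta> \<subseteq> U" using U(1) z0 by (meson open_contains_ball)
  \<comment> \<open>a bump of mean \<open>\<beta>\<close> inside the arc; \<open>\<phi>\<close> below is \<open>-1\<close> off the arc and has mean 0\<close>
  define b where "b z = max 0 (1 - dist z z0 / \<delta>)" for z
  have cb: "continuous_on S b" for S unfolding b_def using \<delta> by (intro continuous_intros) auto
  have b0: "b z = 0" if "z \<notin> U" for z
  proof -
    have "\<delta> \<le> dist z z0" using that \<delta> by (auto simp: dist_commute not_less dest!: subsetD)
    then show ?thesis using \<delta> by (simp add: b_def)
  qed
  have ib: "integrable circle b"
  proof (rule circle.integrable_const_bound[where B = 1])
    show "b \<in> borel_measurable circle"
      using cb by (simp add: borel_measurable_continuous_on_restrict cong: measurable_cong_sets[OF sets_circle refl])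
    show "AE z in circle. norm (b z) \<le> 1" using \<delta> by (auto simp: b_def)
  qed
  define \<beta> where "\<beta> = (\<integral>z. b z \<partial>circle)"
  have "\<beta> > 0"
  proof (rule ccontr)
    assume "\<not> \<beta> > 0"
    moreover have "\<beta> \<ge> 0" unfolding \<beta>_def by (intro Bochner_Integration.integral_nonneg) (simp add: b_def)
    ultimately have "\<beta> = 0" by simp
    then have "AE z in circle. b z = 0"
      unfolding \<beta>_def using integral_nonneg_eq_0_iff_AE[OF ib] by (simp add: b_def)
    then have "AE z in circle. z \<notin> ball z0 \<delta>"
      by eventually_elim (use \<delta> in \<open>auto simp: b_def dist_commute field_simps max_def split: if_splits\<close>)
    from AE_circle_open_empty[OF this open_ball] have "ball z0 \<delta> \<inter> sphere 0 1 = {}" .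
    moreover have "z0 \<in> ball z0 \<delta>" using \<delta> by simp
    ultimately show False using z0(2) by blast
  qed
  define \<phi> where "\<phi> z = complex_of_real (b z / \<beta> - 1)" for z
  have c\<phi>: "continuous_on (sphere 0 1) \<phi>"
    unfolding \<phi>_def using \<open>\<beta> > 0\<close> by (intro continuous_intros cb) auto
  have int1: "(\<integral>z. (c :: complex) \<partial>circle) = c" for c
    using fourier_coeff_const[of c 0] by (simp add: fourier_coeff_def)
  have mean\<phi>: "(\<integral>z. \<phi> z \<partial>circle) = 0"
  proof -
    have "(\<integral>z. \<phi> z \<partial>circle) = complex_of_real (\<integral>z. b z / \<beta> \<partial>circle) - (\<integral>z. 1 \<partial>circle)"
      unfolding \<phi>_def using ib
      by (simp only: of_real_diff of_real_1 integral_complex_of_real[symmetric])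
         (rule Bochner_Integration.integral_diff; simp)
    then show ?thesis using \<open>\<beta> > 0\<close> by (simp only: int1) (simp add: \<beta>_def[symmetric])
  qed
  obtain t where t: "trig_poly t" "\<And>z. z \<in> sphere 0 1 \<Longrightarrow> cmod (\<phi> z - t z) < 1 / 4"
    using trig_poly_dense[OF c\<phi>, of "1/4"] by auto
  have mean_t: "cmod (fourier_coeff t 0) \<le> 1 / 4"
  proof -
    have it: "integrable circle t" "integrable circle \<phi>"
      by (intro integrable_ess_bounded ess_bounded_continuous continuous_on_trig_poly t c\<phi>)+
    have "fourier_coeff t 0 = (\<integral>z. t z - \<phi> z \<partial>circle)"
      using it mean\<phi> by (simp add: fourier_coeff_def)
    also have "cmod \<dots> \<le> (\<integral>z. cmod (t z - \<phi> z) \<partial>circle)" by (rule integral_norm_bound)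
    also have "\<dots> \<le> (\<integral>z. 1 / 4 \<partial>circle)"
      using it t(2) by (intro integral_mono) (auto simp: space_circle norm_minus_commute less_imp_le)
    also have "\<dots> = 1 / 4" by (simp add: measure_def emeasure_circle)
    finally show ?thesis .
  qed
  obtain p where p: "H_infinity p" "fourier_coeff p 0 = 0" "continuous_on (sphere 0 1) p"
      "\<And>z. z \<in> sphere 0 1 \<Longrightarrow> Re (t z) = Re (fourier_coeff t 0) + Re (p z)"
    using trig_poly_Re_eq_Re_analytic[OF t(1)] by blast
  obtain B where B: "\<And>z. z \<in> sphere 0 1 \<Longrightarrow> cmod (p z) \<le> B"
    using continuous_on_circle_bounded[OF p(3)] by blast
  define e where "e = 1 / (2 * (B\<^sup>2 + 1))"
  have e: "0 < e" "e \<le> 1" "e * B\<^sup>2 \<le> 1 / 2"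
    by (auto simp: e_def field_simps add_pos_nonneg intro: add_increasing)
  define q where "q z = 1 + e * p z" for z
  have bd: "cmod (q z) \<le> sqrt (1 - e / 2)" if z: "z \<in> sphere 0 1 - U" for z
  proof -
    have "\<phi> z = - 1" using b0 z by (simp add: \<phi>_def)
    then have "Re (t z) \<le> - 3 / 4"
      using t(2)[of z] z abs_Re_le_cmod[of "\<phi> z - t z"] by simp
    then have Re_p: "Re (p z) \<le> - 1 / 2"
      using p(4)[of z] z mean_t abs_Re_le_cmod[of "fourier_coeff t 0"] by simp
    have "(cmod (q z))\<^sup>2 = 1 + 2 * e * Re (p z) + e\<^sup>2 * (cmod (p z))\<^sup>2"
      unfolding cmod_power2 by (simp add: q_def power2_eq_square algebra_simps)
    also have "\<dots> \<le> 1 + 2 * e * (- 1 / 2) + e\<^sup>2 * B\<^sup>2"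
      using Re_p e B[of z] z by (intro add_mono mult_left_mono power_mono) auto
    also have "e\<^sup>2 * B\<^sup>2 = e * (e * B\<^sup>2)" by (simp add: power2_eq_square)
    also have "1 + 2 * e * (- 1 / 2) + e * (e * B\<^sup>2) \<le> 1 - e / 2"
      using mult_left_mono[OF e(3), of e] e by linarith
    finally show ?thesis by (rule real_le_rsqrt)
  qed
  show thesis
  proof (rule that[of q "sqrt (1 - e / 2)"])
    show "H_infinity q" unfolding q_def by (intro H_infinity_add H_infinity_const H_infinity_cmult p)
    show "fourier_coeff q 0 = 1"
      unfolding q_def using p
      by (simp add: fourier_coeff_add ess_bounded_const ess_bounded_mult H_infinityD fourier_coeff_const fourier_coeff_cmult)
  qed (use e bd in auto)
qed

text \<open>
  Up to index \<open>m\<close> the convolution has at most one nonzero term.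
\<close>

lemma coeff_mult_L2_lowest:
  assumes \<phi>: "H_infinity \<phi>" and low: "\<And>k. k < m \<Longrightarrow> coeff_L2 f k = 0" and "n \<le> m"
  shows "coeff_L2 (mult_L2 \<phi> f) n = fourier_coeff \<phi> 0 * coeff_L2 f n"
proof -
  have "coeff_L2 f (int_decode j) * fourier_coeff \<phi> (n - int_decode j)
      = (if j = int_encode n then coeff_L2 f n * fourier_coeff \<phi> 0 else 0)" for j
  proof (cases "j = int_encode n")
    case False
    then have "int_decode j \<noteq> n" by (metis int_decode_inverse)
    then have "int_decode j < m \<or> n - int_decode j < 0" using \<open>n \<le> m\<close> by linarith
    then show ?thesis using low H_infinityD(2)[OF \<phi>] False by auto
  qed simp
  then have "(\<lambda>j. if j = int_encode n then coeff_L2 f n * fourier_coeff \<phi> 0 else 0) sums coeff_L2 (mult_L2 \<phi> f) n"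
    using coeff_mult_L2_sums[OF H_infinityD(1)[OF \<phi>], of f n] by simp
  moreover have "(\<lambda>j. if j = int_encode n then coeff_L2 f n * fourier_coeff \<phi> 0 else 0) sums (coeff_L2 f n * fourier_coeff \<phi> 0)"
    by (rule sums_single)
  ultimately show ?thesis using sums_unique2 by (simp add: mult.commute) blast
qed

lemma cmod_coeff_L2_le: "cmod (coeff_L2 f n) \<le> norm f"
  using bessel_inequality_L2[of "{0}" "\<lambda>_ :: nat. n" f] by (simp add: power2_le_iff_abs_le)

text \<open>
  Let \<open>q\<close> have mean 1 and \<open>\<bar>q\<bar> \<le> \<rho> < 1\<close> off the arc. Multiplication by \<open>q\<^sup>n\<close> preserves the lowest Fourier
  coefficient of \<open>f\<close> and shrinks the norm by \<open>\<rho>\<^sup>n\<close>, because \<open>f\<close> lives off the arc. So the lowest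
  coefficient is 0, and induction over the index gives all of them.
\<close>

lemma hardy2_eq_0_if_vanishes_on_open:
  assumes U: "open U" "U \<inter> sphere 0 1 \<noteq> {}" and f0: "mult_L2 (indicator U) (Rep_hardy2 f) = 0"
  shows "f = 0"
proof -
  obtain q \<rho> where q: "H_infinity q" "fourier_coeff q 0 = 1" and \<rho>: "0 \<le> \<rho>" "\<rho> < 1"
    and small: "\<And>z. z \<in> sphere 0 1 - U \<Longrightarrow> cmod (q z) \<le> \<rho>"
    using analytic_small_off_arc[OF U] by blast
  define g where "g = Rep_hardy2 f"
  have bq: "ess_bounded q" using q by (simp add: H_infinityD)
  have bi: "ess_bounded (indicator U)" by (rule ess_bounded_indicator[OF U(1)])
  obtain u where u: "square_integrable u" "g = abs_circle_L2 u" by (rule abs_circle_L2_cases)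
  have u0: "AE z in circle. indicator U z * u z = 0"
    using f0 u bi unfolding g_def[symmetric] zero_circle_L2_def
    by (simp add: mult_L2_abs abs_circle_L2_eq_iff square_integrable_mult_ess_bounded square_integrable_0)
  have norm_le: "norm (mult_L2 (\<lambda>z. q z ^ n) g) \<le> \<rho> ^ n * norm g" for n
  proof -
    define w where "w z = q z ^ n * (1 - indicator U z)" for z
    have bw: "ess_bounded w"
      unfolding w_def using ess_bounded_add[OF ess_bounded_const[of 1] ess_bounded_mult[OF ess_bounded_const[of "-1"] bi]]
      by (intro ess_bounded_mult ess_bounded_power bq) simp
    have "mult_L2 (\<lambda>z. q z ^ n) g = mult_L2 w g"
    proof -
      have "AE z in circle. q z ^ n * u z = w z * u z"
        using u0 by eventually_elim (auto simp: w_def indicator_def split: if_splits)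
      then show ?thesis
        using u bw bq by (simp add: mult_L2_abs ess_bounded_power abs_circle_L2_eq_iff square_integrable_mult_ess_bounded)
    qed
    also have "norm \<dots> \<le> \<rho> ^ n * norm g"
    proof (rule norm_mult_L2_le[OF bw])
      show "AE z in circle. cmod (w z) \<le> \<rho> ^ n"
        using small \<rho> by (intro AE_I2) (auto simp: w_def space_circle indicator_def norm_mult norm_power power_mono)
    qed (use \<rho> in simp)
    finally show ?thesis .
  qed
  have coeff0: "coeff_L2 g m = 0" for m
  proof (cases "m < 0")
    case True
    then show ?thesis by (simp add: g_def Rep_hardy2_coeff)
  next
    case False
    then obtain j where m: "m = int j" by (metis nonneg_int_cases not_less)
    have "coeff_L2 g (int j) = 0"
    proof (induction j rule: less_induct)
      case (less j)
      have low: "coeff_L2 g k = 0" if "k < int j" for k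
        using that less.IH by (cases "k < 0") (auto simp: g_def Rep_hardy2_coeff elim!: nonneg_int_cases simp: not_less)
      have const: "coeff_L2 (mult_L2 (\<lambda>z. q z ^ n) g) k = coeff_L2 g k" if "k \<le> int j" for n k
        using that
      proof (induction n arbitrary: k)
        case 0
        have "mult_L2 (\<lambda>z. 1) g = g" using u by (simp add: mult_L2_abs ess_bounded_const)
        then show ?case by simp
      next
        case (Suc n)
        have "mult_L2 (\<lambda>z. q z ^ Suc n) g = mult_L2 q (mult_L2 (\<lambda>z. q z ^ n) g)"
          using bq by (simp add: mult_L2_mult_L2 ess_bounded_power)
        also have "coeff_L2 \<dots> k = fourier_coeff q 0 * coeff_L2 (mult_L2 (\<lambda>z. q z ^ n) g) k"
          using Suc low by (intro coeff_mult_L2_lowest[OF q(1), of "int j"]) auto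
        finally show ?case using Suc q by simp
      qed
      have "cmod (coeff_L2 g (int j)) \<le> \<rho> ^ n * norm g" for n
        using cmod_coeff_L2_le[of "mult_L2 (\<lambda>z. q z ^ n) g" "int j"] norm_le[of n] const[of "int j" n] by simp
      moreover have "(\<lambda>n. \<rho> ^ n * norm g) \<longlonglongrightarrow> 0 * norm g"
        using \<rho> by (intro tendsto_mult LIMSEQ_power_zero tendsto_const) auto
      ultimately have "cmod (coeff_L2 g (int j)) \<le> 0"
        by (intro LIMSEQ_le_const[of "\<lambda>n. \<rho> ^ n * norm g"]) auto
      then show ?case by simp
    qed
    then show ?thesis by (simp add: m)
  qed
  show ?thesis
    by (rule hardy2_eqI) (use coeff0 in \<open>simp add: g_def zero_hardy2.rep_eq\<close>)
qed

section \<open>Logarithms of shifted symbols\<close>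

text \<open>
  The same connectedness argument as for operators: \<open>(F - y) / (F - x)\<close> is close to 1 when \<open>y\<close> is close to
  \<open>x\<close>, so it has the principal logarithm, and \<open>F - b = - b (1 - F / b)\<close> for large \<open>b\<close>.
\<close>

lemma continuous_log_unbounded_component:
  fixes F :: "complex \<Rightarrow> complex"
  assumes F: "continuous_on (sphere 0 1) F" and C: "connected C" "\<not> bounded C" "a \<in> C"
    and disj: "\<And>z. z \<in> sphere 0 1 \<Longrightarrow> F z \<notin> C"
  obtains g where "continuous_on (sphere 0 1) g" "\<And>z. z \<in> sphere 0 1 \<Longrightarrow> F z - a = exp (g z)"
proof -
  define S where "S = sphere (0 :: complex) 1"
  define log1 where "log1 Q \<longleftrightarrow> (\<exists>g. continuous_on S g \<and> (\<forall>z\<in>S. Q z = exp (g z)))" for Q :: "complex \<Rightarrow> complex"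
  have near1: "log1 Q" if "continuous_on S Q" "\<And>z. z \<in> S \<Longrightarrow> cmod (Q z - 1) < 1" for Q
  proof -
    have Q: "Q z \<notin> \<real>\<^sub>\<le>\<^sub>0" "Q z \<noteq> 0" if "z \<in> S" for z
    proof -
      have "\<bar>Re (Q z - 1)\<bar> < 1" using abs_Re_le_cmod[of "Q z - 1"] \<open>\<And>z. z \<in> S \<Longrightarrow> cmod (Q z - 1) < 1\<close>[OF that] by linarith
      then have "Re (Q z) > 0" by simp
      then show "Q z \<notin> \<real>\<^sub>\<le>\<^sub>0" "Q z \<noteq> 0" by (auto simp: complex_nonpos_Reals_iff)
    qed
    then show ?thesis
      unfolding log1_def using that(1)
      by (intro exI[of _ "\<lambda>z. Ln (Q z)"]) (auto intro!: continuous_intros)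
  qed
  have mult: "log1 (\<lambda>z. P z * Q z)" if P: "log1 P" and Q: "log1 Q" for P Q
  proof -
    obtain g where "continuous_on S g" "\<forall>z\<in>S. P z = exp (g z)"
      using P unfolding log1_def by blast
    moreover obtain h where "continuous_on S h" "\<forall>z\<in>S. Q z = exp (h z)"
      using Q unfolding log1_def by blast
    ultimately show ?thesis unfolding log1_def
      by (intro exI[of _ "\<lambda>z. g z + h z"]) (auto simp: exp_add intro!: continuous_intros)
  qed
  have inverse: "log1 (\<lambda>z. inverse (P z))" if P: "log1 P" for P
  proof -
    obtain g where "continuous_on S g" "\<forall>z\<in>S. P z = exp (g z)"
      using P unfolding log1_def by blast
    then show ?thesis unfolding log1_def
      by (intro exI[of _ "\<lambda>z. - g z"]) (auto simp: exp_minus intro!: continuous_intros)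
  qed
  have cong: "log1 Q" if "log1 P" "\<And>z. z \<in> S \<Longrightarrow> P z = Q z" for P Q
    using that unfolding log1_def by metis
  have FS: "continuous_on S F" using F by (simp add: S_def)
  have comp: "compact (F ` S)" using FS by (intro compact_continuous_image) (auto simp: S_def)
  then obtain M where M: "\<And>z. z \<in> S \<Longrightarrow> cmod (F z) \<le> M"
    by (meson bounded_iff compact_imp_bounded imageI)
  obtain b where b: "b \<in> C" "cmod b > M" using C(2) unfolding bounded_iff by (meson not_le)
  have ne: "F z \<noteq> x" if "x \<in> C" "z \<in> S" for x z using disj[of z] that by (auto simp: S_def)
  have "1 \<in> S" by (simp add: S_def)
  then have "0 \<le> M" using M[of 1] norm_ge_zero order_trans by blast
  then have "b \<noteq> 0" using b by auto
  have start: "log1 (\<lambda>z. F z - b)"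
  proof (rule cong[OF mult])
    show "log1 (\<lambda>_. - b)" unfolding log1_def using \<open>b \<noteq> 0\<close> by (intro exI[of _ "\<lambda>_. Ln (- b)"]) auto
    show "log1 (\<lambda>z. 1 - F z / b)"
    proof (rule near1)
      show "continuous_on S (\<lambda>z. 1 - F z / b)" using \<open>b \<noteq> 0\<close> by (intro continuous_intros FS) auto
      show "cmod (1 - F z / b - 1) < 1" if "z \<in> S" for z
        using M[OF that] b \<open>b \<noteq> 0\<close> by (simp add: norm_divide)
    qed
    show "- b * (1 - F z / b) = F z - b" for z using \<open>b \<noteq> 0\<close> by (simp add: field_simps)
  qed
  let ?R = "\<lambda>x y. log1 (\<lambda>z. (F z - y) / (F z - x))"
  have "?R b a"
  proof (rule connected_equivalence_relation[of C b a ?R])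
    show "?R y x" if "?R x y" for x y
      using inverse[OF that] by simp
    show "?R x z" if "?R x y" "?R y z" "x \<in> C" "y \<in> C" "z \<in> C" for x y z
    proof (rule cong[OF mult[OF that(1,2)]])
      have frac: "p \<noteq> 0 \<Longrightarrow> p / q * (r / p) = r / q" for p q r :: complex by simp
      show "(F w - y) / (F w - x) * ((F w - z) / (F w - y)) = (F w - z) / (F w - x)" if "w \<in> S" for w
        using ne[OF \<open>y \<in> C\<close> that] by (intro frac) simp
    qed
    show "\<exists>T. openin (top_of_set C) T \<and> x \<in> T \<and> (\<forall>y\<in>T. ?R x y)" if x: "x \<in> C" for x
    proof -
      have "open (- (F ` S))" using comp by (simp add: compact_imp_closed open_Compl)
      moreover have "x \<in> - (F ` S)" using ne x by auto
      ultimately obtain e where e: "e > 0" "ball x e \<subseteq> - (F ` S)" by (meson open_contains_ball)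
      show ?thesis
      proof (intro exI conjI ballI)
        show "openin (top_of_set C) (C \<inter> ball x e)" by (intro openin_open_Int open_ball)
        show "x \<in> C \<inter> ball x e" using x e by simp
        fix y assume y: "y \<in> C \<inter> ball x e"
        show "?R x y"
        proof (rule near1)
          show "continuous_on S (\<lambda>z. (F z - y) / (F z - x))" using ne[OF x] by (intro continuous_intros FS) auto
          fix z assume z: "z \<in> S"
          have "e \<le> dist x (F z)" using e(2) z by (auto simp: not_less dest!: subsetD)
          moreover have "dist x y < e" using y by simp
          moreover have "(F z - y) / (F z - x) - 1 = (x - y) / (F z - x)" using ne[OF x z] by (simp add: field_simps)
          ultimately show "cmod ((F z - y) / (F z - x) - 1) < 1"
            using ne[OF x z] by (simp add: norm_divide dist_norm norm_minus_commute)
        qed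
      qed
    qed
  qed (use b C in auto)
  then have "log1 (\<lambda>z. F z - a)"
    by (rule cong[OF mult[OF start]]) (use ne b in auto)
  then show thesis using that by (auto simp: log1_def S_def)
qed

section \<open>Symbols whose logarithms split\<close>

text \<open>
  The equality case of \<open>\<parallel>P h\<parallel> \<le> \<parallel>h\<parallel>\<close>: since \<open>h - P h\<close> is orthogonal to \<open>P h\<close>, it has norm 0.
\<close>

lemma riesz_proj_norm_eq_imp_eq:
  assumes "riesz_proj h = f" "norm h \<le> norm f"
  shows "h = Rep_hardy2 f"
proof -
  have "(h - Rep_hardy2 f) \<bullet> (c *\<^sub>C powi_L2 k) = 0" if "c = coeff_L2 (Rep_hardy2 f) k" for c k
    using that coeff_riesz_proj[of h k] assms(1)
    by (cases "k \<ge> 0") (auto simp: inner_scaleC_powi_L2 coeff_L2_diff Rep_hardy2_coeff)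
  then have "(\<lambda>n. (h - Rep_hardy2 f) \<bullet> (coeff_L2 (Rep_hardy2 f) (int_decode n) *\<^sub>C powi_L2 (int_decode n))) = (\<lambda>_. 0)"
    by blast
  then have "(h - Rep_hardy2 f) \<bullet> Rep_hardy2 f = 0"
    using bounded_linear.sums[OF bounded_linear_inner_right fourier_expansion_L2[of "Rep_hardy2 f"], of "h - Rep_hardy2 f"]
    by (simp add: sums_iff)
  moreover have "(norm h)\<^sup>2 \<le> (norm (Rep_hardy2 f))\<^sup>2" using assms(2) by (intro power_mono) (auto simp: norm_hardy2.rep_eq)
  ultimately have "(norm (h - Rep_hardy2 f))\<^sup>2 \<le> 0"
    by (simp add: power2_norm_eq_inner inner_diff_left inner_diff_right inner_commute)
  then show ?thesis by simp
qed

lemma toeplitz_contraction_fixed_vector: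
  assumes \<psi>: "continuous_on (sphere 0 1) \<psi>" "\<And>z. z \<in> sphere 0 1 \<Longrightarrow> cmod (\<psi> z) \<le> 1"
    and ne1: "z0 \<in> sphere 0 1" "\<psi> z0 \<noteq> 1" and fixed: "toeplitz \<psi> f = f"
  shows "f = 0"
proof -
  have b: "ess_bounded \<psi>" by (rule ess_bounded_continuous[OF \<psi>(1)])
  have "norm (mult_L2 \<psi> (Rep_hardy2 f)) \<le> 1 * norm (Rep_hardy2 f)"
    using \<psi>(2) by (intro norm_mult_L2_le[OF b] AE_I2) (auto simp: space_circle)
  then have eq: "mult_L2 \<psi> (Rep_hardy2 f) = Rep_hardy2 f"
    using fixed by (intro riesz_proj_norm_eq_imp_eq) (simp_all add: toeplitz_def norm_hardy2.rep_eq)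
  obtain u where u: "square_integrable u" "Rep_hardy2 f = abs_circle_L2 u" by (rule abs_circle_L2_cases)
  have ae: "AE z in circle. \<psi> z * u z = u z"
    using eq u b by (simp add: mult_L2_abs abs_circle_L2_eq_iff square_integrable_mult_ess_bounded)
  have "openin (top_of_set (sphere 0 1)) (sphere 0 1 \<inter> \<psi> -` (- {1}))"
    by (intro continuous_openin_preimage_gen \<psi>) auto
  then obtain U where U: "open U" "sphere 0 1 \<inter> \<psi> -` (- {1}) = sphere 0 1 \<inter> U"
    unfolding openin_open by (elim exE conjE) (rule that)
  have "AE z in circle. indicator U z * u z = 0"
    using ae AE_space[of circle]
  proof eventually_elim
    case (elim z)
    show ?case
    proof (cases "z \<in> U")
      case True
      then have "z \<in> sphere 0 1 \<inter> \<psi> -` (- {1})" unfolding U(2) using elim by (simp add: space_circle)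
      then have "\<psi> z \<noteq> 1" by blast
      then show ?thesis using elim by simp
    qed simp
  qed
  then have "mult_L2 (indicator U) (Rep_hardy2 f) = 0"
    using u ess_bounded_indicator[OF U(1)] unfolding zero_circle_L2_def
    by (simp add: mult_L2_abs abs_circle_L2_eq_iff square_integrable_mult_ess_bounded square_integrable_0)
  moreover have "z0 \<in> sphere 0 1 \<inter> U" unfolding U(2)[symmetric] using ne1 by simp
  then have "U \<inter> sphere 0 1 \<noteq> {}" by blast
  ultimately show ?thesis using hardy2_eq_0_if_vanishes_on_open U(1) by blast
qed

text \<open>
  For continuous \<open>g\<close> this says that the Riesz projection of \<open>g\<close> is bounded.
\<close>

definition splits_analytic :: "(complex \<Rightarrow> complex) \<Rightarrow> bool"
  where "splits_analytic g \<longleftrightarrow>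
    (\<exists>u v. H_infinity u \<and> H_infinity (\<lambda>z. cnj (v z)) \<and> (AE z in circle. g z = u z + v z))"

text \<open>
  With \<open>A = T(exp u)\<close> and \<open>V = T(exp v)\<close> the operator \<open>T - a\<close> is \<open>V A\<close>, while the contraction \<open>K = T(\<psi>)\<close> is
  \<open>- a V\<^sup>-\<^sup>1 A\<^sup>-\<^sup>1\<close>. Hence \<open>A\<^sup>-\<^sup>1 K A = - a A\<^sup>-\<^sup>1 V\<^sup>-\<^sup>1 = - a (T - a)\<^sup>-\<^sup>1\<close>, and
  \<open>(T - a) A\<^sup>-\<^sup>1 (1 - K) A = T - a + a = T\<close>.
\<close>

theorem c0_embeddable_toeplitz_if_log_splits:
  assumes F: "continuous_on (sphere 0 1) F"
    and C: "C \<in> components (- op_spectrum (toeplitz F))" "\<not> bounded C"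
    and ball: "ball a r \<subseteq> C" "cmod a = r" "0 < r"
    and g: "continuous_on (sphere 0 1) g" "\<And>z. z \<in> sphere 0 1 \<Longrightarrow> F z - a = exp (g z)" "splits_analytic g"
    and ne0: "z0 \<in> sphere 0 1" "F z0 \<noteq> 0"
  shows "c0_embeddable (toeplitz F)"
proof -
  obtain u v where u: "H_infinity u" and v: "H_infinity (\<lambda>z. cnj (v z))"
    and ae: "AE z in circle. g z = u z + v z"
    using g(3) by (auto simp: splits_analytic_def)
  have exp_u: "H_infinity (\<lambda>z. exp (u z))" "H_infinity (\<lambda>z. exp (- u z))"
    using H_infinity_exp[OF u] H_infinity_exp[OF H_infinity_cmult[OF u, of "-1"]] by simp_all
  have exp_v: "H_infinity (\<lambda>z. cnj (exp (v z)))" "H_infinity (\<lambda>z. cnj (exp (- v z)))"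
    using H_infinity_exp[OF v] H_infinity_exp[OF H_infinity_cmult[OF v, of "-1"]] by (simp_all add: exp_cnj)
  have b: "ess_bounded (\<lambda>z. exp (u z))" "ess_bounded (\<lambda>z. exp (- u z))"
      "ess_bounded (\<lambda>z. exp (v z))" "ess_bounded (\<lambda>z. exp (- v z))"
    using ess_bounded_cnj[OF H_infinityD(1)[OF exp_v(1)]] ess_bounded_cnj[OF H_infinityD(1)[OF exp_v(2)]]
    by (simp_all only: H_infinityD(1)[OF exp_u(1)] H_infinityD(1)[OF exp_u(2)] complex_cnj_cnj)
  define A where "A = toeplitz_endo (\<lambda>z. exp (u z))"
  define A' where "A' = toeplitz_endo (\<lambda>z. exp (- u z))"
  define V where "V = toeplitz_endo (\<lambda>z. exp (v z))"
  define V' where "V' = toeplitz_endo (\<lambda>z. exp (- v z))"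
  have one: "toeplitz (\<lambda>_. 1) f = f" for f using scaleR_eq_scaleC[of 1 f] by (simp add: toeplitz_const)
  have A'A: "A' * A = 1" and AA': "A * A' = 1"
    using toeplitz_mult_analytic[OF exp_u(1) b(2)] toeplitz_mult_analytic[OF exp_u(2) b(1)]
    by (auto intro!: endo_eqI simp: A_def A'_def one simp flip: exp_add)
  have VV': "V * V' = 1"
    using toeplitz_mult_coanalytic[OF exp_v(1) b(4)]
    by (auto intro!: endo_eqI simp: V_def V'_def one simp flip: exp_add)
  have a_ne: "F z \<noteq> a" "cmod (F z - a) \<ge> r" if "z \<in> sphere 0 1" for z
  proof -
    have "F z \<notin> C" using range_subset_op_spectrum_toeplitz[OF F that] in_components_subset[OF C(1)] by blast
    then have "F z \<notin> ball a r" using ball by blast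
    then show "cmod (F z - a) \<ge> r" by (simp add: dist_norm norm_minus_commute)
    then show "F z \<noteq> a" using ball by auto
  qed
  have bF: "ess_bounded F" by (rule ess_bounded_continuous[OF F])
  have G: "toeplitz_endo F - cscale a = V * A"
  proof -
    have "AE z in circle. F z - a = exp (v z) * exp (u z)"
      using ae AE_space[of circle] by eventually_elim (use g(2) in \<open>simp add: space_circle exp_add mult.commute\<close>)
    then have "toeplitz (\<lambda>z. F z - a) = toeplitz (\<lambda>z. exp (v z) * exp (u z))"
      by (intro toeplitz_cong_AE ess_bounded_mult b ess_bounded_continuous continuous_intros F)
    then have "toeplitz_endo (\<lambda>z. F z - a) = V * A"
      using toeplitz_mult_analytic[OF exp_u(1) b(3)] by (auto intro!: endo_eqI simp: V_def A_def)
    then show ?thesis by (simp add: toeplitz_minus_const[OF bF])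
  qed
  define \<psi> where "\<psi> z = - a / (F z - a)" for z
  have c\<psi>: "continuous_on (sphere 0 1) \<psi>"
    unfolding \<psi>_def using a_ne by (intro continuous_intros F) auto
  have \<psi>1: "cmod (\<psi> z) \<le> 1" if "z \<in> sphere 0 1" for z
    using a_ne[OF that] ball by (simp add: \<psi>_def norm_divide divide_le_eq)
  define K where "K = toeplitz_endo \<psi>"
  have K: "K = cscale (- a) * (V' * A')"
  proof -
    have "AE z in circle. \<psi> z = exp (- v z) * (- a * exp (- u z))"
      using ae AE_space[of circle]
    proof eventually_elim
      case (elim z)
      then have "F z - a = exp (u z + v z)" using g(2) by (simp add: space_circle)
      then have "\<psi> z = - a * exp (- (v z) + - (u z))"
        unfolding \<psi>_def by (simp only: divide_inverse exp_minus[symmetric] minus_add)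
      then show ?case by (simp only: exp_add mult_ac)
    qed
    moreover have ba: "ess_bounded (\<lambda>z. - a * exp (- u z))" by (intro ess_bounded_mult ess_bounded_const b)
    ultimately have "toeplitz \<psi> = toeplitz (\<lambda>z. exp (- v z) * (- a * exp (- u z)))"
      by (intro toeplitz_cong_AE[OF ess_bounded_continuous[OF c\<psi>] ess_bounded_mult[OF b(4) ba]])
    moreover have "toeplitz (\<lambda>z. exp (- v z) * (- a * exp (- u z))) f
        = toeplitz (\<lambda>z. exp (- v z)) (toeplitz (\<lambda>z. - a * exp (- u z)) f)" for f
      by (rule toeplitz_mult_coanalytic[OF exp_v(2) ba])
    moreover have "toeplitz (\<lambda>z. - a * exp (- u z)) f = (- a) *\<^sub>C toeplitz (\<lambda>z. exp (- u z)) f" for f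
      using toeplitz_mult_analytic[OF exp_u(2) ess_bounded_const, of "- a" f] by (simp add: toeplitz_const)
    ultimately have "K = V' * (cscale (- a) * A')"
      by (auto intro!: endo_eqI simp: K_def V'_def A'_def)
    also have "\<dots> = cscale (- a) * (V' * A')"
      using clin_commute[OF clin_toeplitz[of "\<lambda>z. exp (- v z)"], of "- a"]
      by (simp add: V'_def[symmetric] mult.assoc[symmetric])
    finally show ?thesis .
  qed
  have "c0_embeddable (endo_app (toeplitz_endo F))"
  proof (rule c0_embeddable_similar_contraction[where A = A and A' = A' and K = K and a = a])
    show "clin (toeplitz_endo F)" "clin A" "clin A'" by (simp_all add: A_def A'_def clin_toeplitz)
    show "C \<in> components (- op_spectrum (endo_app (toeplitz_endo F)))" "\<not> bounded C" "a \<in> C"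
      using C ball by (auto simp: subset_iff)
    show "A' * A = 1" "A * A' = 1" by fact+
    show "norm K \<le> 1"
    proof (rule norm_endo_bound)
      show "norm (endo_app K f) \<le> 1 * norm f" for f
        unfolding K_def endo_app_toeplitz using \<psi>1
        by (intro norm_toeplitz_le ess_bounded_continuous c\<psi> AE_I2) (auto simp: space_circle)
    qed simp
    show "f = 0" if "endo_app K f = f" for f
    proof (rule toeplitz_contraction_fixed_vector[OF c\<psi> \<psi>1 ne0(1)])
      show "\<psi> z0 \<noteq> 1" using ne0 a_ne(1)[OF ne0(1)] by (simp add: \<psi>_def field_simps)
      show "toeplitz \<psi> f = f" using that by (simp add: K_def)
    qed
    have com: "cscale (- a) * (V' * A') = V' * A' * cscale (- a)" "cscale (- a) * A = A * cscale (- a)"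
      by (simp_all add: V'_def A'_def A_def clin_commute clin_mult clin_toeplitz)
    have "V * K * A = V * V' * A' * (cscale (- a) * A)"
      unfolding K com(1) by (simp only: mult.assoc)
    also have "\<dots> = V * V' * (A' * A) * cscale (- a)"
      unfolding com(2) by (simp only: mult.assoc)
    also have "\<dots> = - cscale a" using cscale_diff[of 0 a, where 'a = hardy2] by (simp add: A'A VV' cscale_0)
    finally have VKA: "V * K * A = - cscale a" .
    have "(toeplitz_endo F - cscale a) * (A' * (1 - K) * A) = V * (A * A') * (1 - K) * A"
      by (simp only: G mult.assoc)
    also have "\<dots> = V * A - V * K * A" by (simp add: AA' left_diff_distrib right_diff_distrib)
    also have "\<dots> = toeplitz_endo F" by (simp add: VKA G[symmetric])
    finally show "toeplitz_endo F = (toeplitz_endo F - cscale a) * (A' * (1 - K) * A)" by (rule sym)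
  qed
  then show ?thesis by simp
qed

section \<open>Fourier coefficients of differentiable functions\<close>

lemma integral_circle_eq_lborel:
  fixes h :: "complex \<Rightarrow> complex"
  assumes h: "continuous_on (sphere 0 1) h"
  shows "(\<integral>z. h z \<partial>circle) = (1 / (2 * pi)) *\<^sub>R (\<integral>t. indicator {0..2 * pi} t *\<^sub>R h (cis t) \<partial>lborel)"
proof -
  have hc: "continuous_on UNIV (\<lambda>t. h (cis t))"
    by (rule continuous_on_compose2[OF h]) (auto intro!: continuous_intros)
  have [measurable]: "(\<lambda>t. h (cis t)) \<in> borel_measurable borel"
    by (intro borel_measurable_continuous_onI hc)
  have "(\<integral>z. h z \<partial>circle) = (\<integral>t. h (cis t) \<partial>uniform_measure lborel {0..<2 * pi})"
    unfolding circle_def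
    by (rule integral_distr[OF measurable_cis_circle])
       (use borel_measurable_circle_continuous[OF h] in \<open>simp cong: measurable_cong_sets[OF sets_circle refl]\<close>)
  also have "\<dots> = (1 / (2 * pi)) *\<^sub>R (\<integral>t. indicator {0..<2 * pi} t *\<^sub>R h (cis t) \<partial>lborel)"
  proof -
    have eq: "uniform_measure lborel {0..<2 * pi}
        = density lborel (\<lambda>t. ennreal (indicator {0..<2 * pi} t / (2 * pi)))"
      unfolding uniform_measure_def
      by (intro density_cong) (auto simp: indicator_def divide_ennreal[symmetric] ennreal_1[symmetric] simp del: ennreal_1)
    show ?thesis
      unfolding eq
      by (subst integral_density) (auto simp flip: integral_scaleR_right intro!: Bochner_Integration.integral_cong)
  qed
  also have "(\<integral>t. indicator {0..<2 * pi} t *\<^sub>R h (cis t) \<partial>lborel)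
      = (\<integral>t. indicator {0..2 * pi} t *\<^sub>R h (cis t) \<partial>lborel)"
  proof (rule integral_cong_AE)
    show "AE t in lborel. indicator {0..<2 * pi} t *\<^sub>R h (cis t) = indicator {0..2 * pi} t *\<^sub>R h (cis t)"
      using AE_lborel_singleton[of "2 * pi"] by eventually_elim (auto simp: indicator_def)
  qed measurable
  finally show ?thesis .
qed

text \<open>
  The fundamental theorem of calculus for a function with equal values at both ends.
\<close>

lemma integral_circle_derivative:
  fixes h H :: "complex \<Rightarrow> complex"
  assumes h: "continuous_on (sphere 0 1) h"
    and H: "\<And>t. ((\<lambda>t. H (cis t)) has_vector_derivative h (cis t)) (at t)"
  shows "(\<integral>z. h z \<partial>circle) = 0"
proof -
  have "(\<integral>t. indicator {0..2 * pi} t *\<^sub>R h (cis t) \<partial>lborel) = H (cis (2 * pi)) - H (cis 0)"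
  proof (rule integral_FTC_Icc)
    show "((\<lambda>t. H (cis t)) has_vector_derivative h (cis t)) (at t within {0..2 * pi})" for t
      using H by (rule has_vector_derivative_at_within)
    show "continuous_on {0..2 * pi} (\<lambda>t. h (cis t))"
      by (rule continuous_on_compose2[OF h]) (auto intro!: continuous_intros)
  qed simp
  then show ?thesis by (simp add: integral_circle_eq_lborel[OF h])
qed

lemma has_vector_derivative_cis_powi:
  "((\<lambda>t. cis t powi n) has_vector_derivative \<i> * of_int n * cis t powi n) (at t)"
proof -
  have "((\<lambda>t. cis (of_int n * t)) has_vector_derivative \<i> * of_int n * cis (of_int n * t)) (at t)"
    by (auto intro!: derivative_eq_intros simp: has_vector_derivative_def scaleR_conv_of_real mult_ac)
  then show ?thesis by (simp add: cis_power_int)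
qed

lemma fourier_coeff_derivative:
  assumes f: "continuous_on (sphere 0 1) f" "continuous_on (sphere 0 1) f'"
    and D: "\<And>t. ((\<lambda>t. f (cis t)) has_vector_derivative f' (cis t)) (at t)"
  shows "fourier_coeff f' n = \<i> * of_int n * fourier_coeff f n"
proof -
  define h where "h z = f' z * z powi (- n) + f z * (\<i> * of_int (- n) * z powi (- n))" for z
  have "(\<integral>z. h z \<partial>circle) = 0"
  proof (rule integral_circle_derivative[where H = "\<lambda>z. f z * z powi (- n)"])
    show "continuous_on (sphere 0 1) h"
      unfolding h_def by (intro continuous_on_add continuous_on_mult f continuous_on_powi_sphere continuous_on_const)
    show "((\<lambda>t. f (cis t) * cis t powi (- n)) has_vector_derivative h (cis t)) (at t)" for t
      using has_vector_derivative_mult[OF D has_vector_derivative_cis_powi[of "- n"], of t]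
      by (simp add: h_def add.commute)
  qed
  moreover have i: "integrable circle (\<lambda>z. f' z * z powi (- n))" "integrable circle (\<lambda>z. f z * z powi (- n))"
    by (intro integrable_ess_bounded ess_bounded_mult ess_bounded_powi ess_bounded_continuous f)+
  moreover have "(\<lambda>z. h z) = (\<lambda>z. f' z * z powi (- n) - \<i> * of_int n * (f z * z powi (- n)))"
    by (auto simp: h_def algebra_simps)
  ultimately show ?thesis by (simp add: fourier_coeff_def)
qed

section \<open>Absolutely convergent trigonometric series\<close>

abbreviation abs_summable :: "('i \<Rightarrow> 'b :: real_normed_vector) \<Rightarrow> 'i set \<Rightarrow> bool"
  where "abs_summable f A \<equiv> (\<lambda>i. norm (f i)) summable_on A"

lemma infsum_eq_suminf: "f summable_on UNIV \<Longrightarrow> (\<Sum>\<^sub>\<infinity>n :: nat. f n) = (\<Sum>n. f n)"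
  by (intro sums_unique has_sum_imp_sums has_sum_infsum)

text \<open>
  A bound for the Wiener norm. The exponents \<open>k i\<close> may repeat and come in any order, so that products
  and infinite sums are obtained by reindexing, without collecting terms of the same exponent.
\<close>

definition wiener_le :: "(complex \<Rightarrow> complex) \<Rightarrow> real \<Rightarrow> bool"
  where "wiener_le f C \<longleftrightarrow> (\<exists>c k. abs_summable (c :: nat \<Rightarrow> complex) UNIV \<and>
    (\<Sum>\<^sub>\<infinity>i. cmod (c i)) \<le> C \<and> (\<forall>z\<in>sphere 0 1. f z = (\<Sum>\<^sub>\<infinity>i. c i * z powi k i)))"

text \<open>
  Index sets such as pairs of natural numbers reduce to the natural numbers.
\<close>

lemma wiener_leI:
  assumes h: "bij_betw h (UNIV :: nat set) A" and c: "abs_summable (c :: 'i \<Rightarrow> complex) A"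
    and C: "(\<Sum>\<^sub>\<infinity>i\<in>A. cmod (c i)) \<le> C"
    and f: "\<And>z. z \<in> sphere 0 1 \<Longrightarrow> f z = (\<Sum>\<^sub>\<infinity>i\<in>A. c i * z powi k i)"
  shows "wiener_le f C"
  unfolding wiener_le_def
proof (intro exI conjI ballI)
  show "abs_summable (\<lambda>n. c (h n)) (UNIV)"
    using c summable_on_reindex_bij_betw[OF h, of "\<lambda>i. cmod (c i)"] by simp
  show "(\<Sum>\<^sub>\<infinity>n. cmod (c (h n))) \<le> C"
    using C infsum_reindex_bij_betw[OF h, of "\<lambda>i. cmod (c i)"] by simp
  show "f z = (\<Sum>\<^sub>\<infinity>n. c (h n) * z powi k (h n))" if "z \<in> sphere 0 1" for z
    using f[OF that] infsum_reindex_bij_betw[OF h, of "\<lambda>i. c i * z powi k i"] by simp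
qed

lemma abs_summable_mult_powi:
  assumes "abs_summable (c :: 'i \<Rightarrow> complex) A" "z \<in> sphere 0 1"
  shows "abs_summable (\<lambda>i. c i * z powi k i) (A)"
  using assms by (simp add: norm_mult norm_power_int)

lemma wiener_le_nonneg: "wiener_le f C \<Longrightarrow> 0 \<le> C"
  unfolding wiener_le_def by (meson infsum_nonneg norm_ge_zero order_trans)

lemma wiener_le_cong:
  assumes "wiener_le f C" "\<And>z. z \<in> sphere 0 1 \<Longrightarrow> f z = g z"
  shows "wiener_le g C"
proof -
  have "(\<forall>z\<in>sphere 0 1. f z = s z) = (\<forall>z\<in>sphere 0 1. g z = s z)" for s
    using assms(2) by (intro ball_cong refl) metis
  then show ?thesis using assms(1) unfolding wiener_le_def by simp
qed

lemma cmod_le_wiener_le: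
  assumes "wiener_le f C" "z \<in> sphere 0 1"
  shows "cmod (f z) \<le> C"
proof -
  obtain c k where c: "abs_summable (c :: nat \<Rightarrow> complex) UNIV" "(\<Sum>\<^sub>\<infinity>i. cmod (c i)) \<le> C"
    "f z = (\<Sum>\<^sub>\<infinity>i. c i * z powi k i)"
    using assms unfolding wiener_le_def by blast
  have "cmod (f z) \<le> (\<Sum>\<^sub>\<infinity>i. cmod (c i * z powi k i))"
    unfolding c(3) by (rule norm_infsum_bound[OF abs_summable_mult_powi[OF c(1) assms(2)]])
  also have "\<dots> = (\<Sum>\<^sub>\<infinity>i. cmod (c i))" using assms(2) by (simp add: norm_mult norm_power_int)
  finally show ?thesis using c(2) by simp
qed

lemma wiener_le_mult:
  assumes "wiener_le f C" "wiener_le g D"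
  shows "wiener_le (\<lambda>z. f z * g z) (C * D)"
proof -
  obtain c k where c: "abs_summable (c :: nat \<Rightarrow> complex) UNIV" "(\<Sum>\<^sub>\<infinity>i. cmod (c i)) \<le> C"
    "\<And>z. z \<in> sphere 0 1 \<Longrightarrow> f z = (\<Sum>\<^sub>\<infinity>i. c i * z powi k i)"
    using assms(1) unfolding wiener_le_def by blast
  obtain d l where d: "abs_summable (d :: nat \<Rightarrow> complex) UNIV" "(\<Sum>\<^sub>\<infinity>i. cmod (d i)) \<le> D"
    "\<And>z. z \<in> sphere 0 1 \<Longrightarrow> g z = (\<Sum>\<^sub>\<infinity>i. d i * z powi l i)"
    using assms(2) unfolding wiener_le_def by blast
  have abs_summ: "abs_summable (\<lambda>p. a (fst p) * b (snd p)) (UNIV \<times> UNIV)"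
    if "abs_summable a UNIV" "abs_summable b UNIV" for a b :: "nat \<Rightarrow> complex"
    unfolding Infinite_Sum.abs_summable_on_Sigma_iff
  proof (intro conjI ballI)
    show "abs_summable (\<lambda>y. a (fst (x, y)) * b (snd (x, y))) (UNIV)" for x
      using that(2) by (simp add: norm_mult summable_on_cmult_right)
    show "abs_summable (\<lambda>x. \<Sum>\<^sub>\<infinity>y. cmod (a (fst (x, y)) * b (snd (x, y)))) (UNIV)"
      using that(1) by (simp add: norm_mult infsum_cmult_right' abs_mult infsum_nonneg summable_on_cmult_left)
  qed
  show ?thesis
  proof (rule wiener_leI[where c = "\<lambda>p. c (fst p) * d (snd p)" and A = "UNIV \<times> UNIV" and k = "\<lambda>p. k (fst p) + l (snd p)"])
    show "bij_betw prod_decode UNIV (UNIV \<times> UNIV)" using bij_prod_decode by simp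
    show s: "abs_summable (\<lambda>p. c (fst p) * d (snd p)) (UNIV \<times> UNIV)" using c(1) d(1) by (rule abs_summ)
    have "(\<Sum>\<^sub>\<infinity>p\<in>UNIV \<times> UNIV. cmod (c (fst p) * d (snd p))) = (\<Sum>\<^sub>\<infinity>x. \<Sum>\<^sub>\<infinity>y. cmod (c x * d y))"
      using infsum_Sigma_banach[OF s] by simp
    also have "\<dots> = (\<Sum>\<^sub>\<infinity>x. cmod (c x)) * (\<Sum>\<^sub>\<infinity>y. cmod (d y))"
      by (simp add: norm_mult infsum_cmult_right' infsum_cmult_left')
    also have "\<dots> \<le> C * D"
      using c(2) d(2) wiener_le_nonneg[OF assms(1)] by (intro mult_mono) (auto intro: infsum_nonneg)
    finally show "(\<Sum>\<^sub>\<infinity>p\<in>UNIV \<times> UNIV. cmod (c (fst p) * d (snd p))) \<le> C * D" .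
    fix z :: complex assume z: "z \<in> sphere 0 1"
    then have "z \<noteq> 0" by auto
    have "f z * g z = (\<Sum>\<^sub>\<infinity>x. \<Sum>\<^sub>\<infinity>y. (c x * z powi k x) * (d y * z powi l y))"
      unfolding c(3)[OF z] d(3)[OF z] by (simp add: infsum_cmult_right' infsum_cmult_left')
    also have "\<dots> = (\<Sum>\<^sub>\<infinity>p\<in>UNIV \<times> UNIV. (c (fst p) * z powi k (fst p)) * (d (snd p) * z powi l (snd p)))"
      using infsum_Sigma_banach[OF abs_summable_summable[OF abs_summ[OF abs_summable_mult_powi[OF c(1) z, of k] abs_summable_mult_powi[OF d(1) z, of l]]]]
      by simp
    also have "\<dots> = (\<Sum>\<^sub>\<infinity>p\<in>UNIV \<times> UNIV. c (fst p) * d (snd p) * z powi (k (fst p) + l (snd p)))"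
      using \<open>z \<noteq> 0\<close> by (intro infsum_cong) (simp add: power_int_add mult_ac)
    finally show "f z * g z = \<dots>" .
  qed
qed

lemma wiener_le_const: "wiener_le (\<lambda>_. a) (cmod a)"
proof -
  have fin: "(\<lambda>i :: nat. if i = 0 then x else 0) summable_on UNIV"
     "(\<Sum>\<^sub>\<infinity>i :: nat. if i = 0 then x else 0) = x" for x :: "'b :: {comm_monoid_add, t2_space}"
  proof -
    have "((\<lambda>i :: nat. if i = 0 then x else 0) has_sum (\<Sum>i\<in>{0 :: nat}. if i = 0 then x else 0)) UNIV"
      by (rule has_sum_finite_neutralI[where B = "{0}"]) auto
    then show "(\<lambda>i :: nat. if i = 0 then x else 0) summable_on UNIV"
      "(\<Sum>\<^sub>\<infinity>i :: nat. if i = 0 then x else 0) = x"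
      by (auto simp: summable_on_def infsumI)
  qed
  show ?thesis
    unfolding wiener_le_def
    by (intro exI[of _ "\<lambda>i. if i = 0 then a else 0"] exI[of _ "\<lambda>_. 0"])
       (simp add: if_distrib[of cmod] fin cong: if_cong)
qed

lemma wiener_le_power: "wiener_le f C \<Longrightarrow> wiener_le (\<lambda>z. f z ^ n) (C ^ n)"
proof (induction n)
  case 0
  then show ?case using wiener_le_const[of 1] by simp
qed (auto intro: wiener_le_mult)

lemma wiener_le_cmult: "wiener_le f C \<Longrightarrow> wiener_le (\<lambda>z. a * f z) (cmod a * C)"
  using wiener_le_mult[OF wiener_le_const[of a]] by simp

lemma wiener_le_suminf:
  assumes f: "\<And>j. wiener_le (f j) (C j)" and C: "summable C"
  shows "wiener_le (\<lambda>z. \<Sum>j. f j z) (\<Sum>j. C j)"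
proof -
  have C0: "C j \<ge> 0" for j using wiener_le_nonneg[OF f] .
  have C_on: "C summable_on UNIV" using C C0 by (simp add: summable_on_UNIV_nonneg_real_iff)
  have "\<exists>c k. abs_summable (c :: nat \<Rightarrow> complex) UNIV \<and>
    (\<Sum>\<^sub>\<infinity>i. cmod (c i)) \<le> C j \<and> (\<forall>z\<in>sphere 0 1. f j z = (\<Sum>\<^sub>\<infinity>i. c i * z powi k i))" for j
    using f[of j] unfolding wiener_le_def .
  then obtain c k where c: "\<And>j. abs_summable (c j :: nat \<Rightarrow> complex) UNIV" "\<And>j. (\<Sum>\<^sub>\<infinity>i. cmod (c j i)) \<le> C j"
    "\<And>j z. z \<in> sphere 0 1 \<Longrightarrow> f j z = (\<Sum>\<^sub>\<infinity>i. c j i * z powi k j i)"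
    by metis
  have nn: "(\<Sum>\<^sub>\<infinity>i. cmod (c j i)) \<ge> 0" for j by (simp add: infsum_nonneg)
  have s: "abs_summable (\<lambda>p. c (fst p) (snd p)) (UNIV \<times> UNIV)"
    unfolding Infinite_Sum.abs_summable_on_Sigma_iff
  proof (intro conjI ballI)
    show "abs_summable (\<lambda>y. c (fst (x, y)) (snd (x, y))) (UNIV)" for x using c(1)[of x] by simp
    have "abs_summable (\<lambda>x. \<Sum>\<^sub>\<infinity>i. cmod (c x i)) (UNIV)"
      by (rule Infinite_Sum.abs_summable_on_comparison_test[where g = C]) (use C_on C0 c(2) nn in auto)
    then show "abs_summable (\<lambda>x. \<Sum>\<^sub>\<infinity>y. cmod (c (fst (x, y)) (snd (x, y)))) (UNIV)" by simp
  qed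
  show ?thesis
  proof (rule wiener_leI[where c = "\<lambda>p. c (fst p) (snd p)" and A = "UNIV \<times> UNIV" and k = "\<lambda>p. k (fst p) (snd p)"])
    show "bij_betw prod_decode UNIV (UNIV \<times> UNIV)" using bij_prod_decode by simp
    show "abs_summable (\<lambda>p. c (fst p) (snd p)) (UNIV \<times> UNIV)" by (rule s)
    have "(\<Sum>\<^sub>\<infinity>p\<in>UNIV \<times> UNIV. cmod (c (fst p) (snd p))) = (\<Sum>\<^sub>\<infinity>j. \<Sum>\<^sub>\<infinity>i. cmod (c j i))"
      using infsum_Sigma_banach[OF s] by simp
    also have "\<dots> \<le> (\<Sum>\<^sub>\<infinity>j. C j)"
    proof (rule infsum_mono)
      show "(\<lambda>j. \<Sum>\<^sub>\<infinity>i. cmod (c j i)) summable_on UNIV"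
        by (rule summable_on_comparison_test[OF C_on]) (use c(2) nn in auto)
    qed (use C_on c(2) in auto)
    also have "\<dots> = (\<Sum>j. C j)" by (rule infsum_eq_suminf[OF C_on])
    finally show "(\<Sum>\<^sub>\<infinity>p\<in>UNIV \<times> UNIV. cmod (c (fst p) (snd p))) \<le> (\<Sum>j. C j)" .
    fix z :: complex assume z: "z \<in> sphere 0 1"
    have "abs_summable (\<lambda>j. f j z) (UNIV)"
      by (rule Infinite_Sum.abs_summable_on_comparison_test[where g = C]) (use C_on C0 cmod_le_wiener_le[OF f z] in auto)
    then have "(\<Sum>j. f j z) = (\<Sum>\<^sub>\<infinity>j. f j z)" by (metis abs_summable_summable infsum_eq_suminf)
    also have "\<dots> = (\<Sum>\<^sub>\<infinity>j. \<Sum>\<^sub>\<infinity>i. c j i * z powi k j i)" using c(3)[OF z] by simp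
    also have "\<dots> = (\<Sum>\<^sub>\<infinity>p\<in>UNIV \<times> UNIV. c (fst p) (snd p) * z powi k (fst p) (snd p))"
      using infsum_Sigma_banach[OF abs_summable_summable[OF abs_summable_mult_powi[OF s z, of "\<lambda>p. k (fst p) (snd p)"]]] by simp
    finally show "(\<Sum>j. f j z) = \<dots>" .
  qed
qed

lemma H_infinity_suminf:
  assumes f: "\<And>i. H_infinity (f i)" and c: "summable c"
    and le: "\<And>i z. z \<in> sphere 0 1 \<Longrightarrow> cmod (f i z) \<le> c i"
  shows "H_infinity (\<lambda>z. \<Sum>i. f i z)"
proof (rule H_infinity_LIMSEQ)
  have c0: "c i \<ge> 0" for i by (rule order_trans[OF norm_ge_zero le[of 1 i]]) simp
  show "H_infinity (\<lambda>z. \<Sum>i<n. f i z)" for n by (intro H_infinity_sum f)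
  show "AE z in circle. cmod (\<Sum>i<n. f i z) \<le> (\<Sum>i. c i)" for n
  proof (rule AE_I2)
    fix z assume "z \<in> space circle"
    then have "cmod (\<Sum>i<n. f i z) \<le> (\<Sum>i<n. c i)" using le by (intro sum_norm_le) (simp add: space_circle)
    also have "\<dots> \<le> (\<Sum>i. c i)" using c c0 by (intro sum_le_suminf) auto
    finally show "cmod (\<Sum>i<n. f i z) \<le> (\<Sum>i. c i)" .
  qed
  show "(\<lambda>n. \<Sum>i<n. f i z) \<longlonglongrightarrow> (\<Sum>i. f i z)" if "z \<in> sphere 0 1" for z
    by (intro summable_LIMSEQ summable_comparison_test'[OF c, of 0] le that)
qed

text \<open>
  The terms with nonnegative exponents converge uniformly to an analytic function, the others to an
  antianalytic one.
\<close>

lemma splits_analytic_wiener_le: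
  assumes "wiener_le f C"
  shows "splits_analytic f"
proof -
  obtain c k where c: "abs_summable (c :: nat \<Rightarrow> complex) UNIV"
    and f: "\<And>z. z \<in> sphere 0 1 \<Longrightarrow> f z = (\<Sum>\<^sub>\<infinity>i. c i * z powi k i)"
    using assms unfolding wiener_le_def by blast
  have s: "summable (\<lambda>i. cmod (c i))" using c by (simp add: summable_on_UNIV_nonneg_real_iff)
  define a where "a i z = (if k i \<ge> 0 then c i * z powi k i else 0)" for i z
  define b where "b i z = (if k i \<ge> 0 then 0 else c i * z powi k i)" for i z
  have le: "cmod (a i z) \<le> cmod (c i)" "cmod (b i z) \<le> cmod (c i)" if "z \<in> sphere 0 1" for i z
    using that by (auto simp: a_def b_def norm_mult norm_power_int)
  have Ha: "H_infinity (a i)" for i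
    unfolding a_def by (cases "k i \<ge> 0") (auto intro: H_infinity_const H_infinity_cmult H_infinity_powi)
  have Hb: "H_infinity (\<lambda>z. cnj (b i z))" for i
  proof (cases "k i \<ge> 0")
    case False
    have "ess_bounded (\<lambda>z. c i * z powi k i)" by (intro ess_bounded_mult ess_bounded_const ess_bounded_powi)
    moreover have "fourier_coeff (\<lambda>z. cnj (c i * z powi k i)) n = 0" if "n < 0" for n
      using False that by (simp only: fourier_coeff_cnj fourier_coeff_cmult fourier_coeff_powi) auto
    ultimately have "H_infinity (\<lambda>z. cnj (c i * z powi k i))"
      unfolding H_infinity_def using ess_bounded_cnj by blast
    then show ?thesis using False by (simp add: b_def)
  qed (simp add: b_def H_infinity_const)
  have sb: "summable (\<lambda>i. b i z)" "summable (\<lambda>i. a i z)" if "z \<in> sphere 0 1" for z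
    by (intro summable_comparison_test'[OF s, of 0] le that)+
  have "H_infinity (\<lambda>z. \<Sum>i. a i z)" by (rule H_infinity_suminf[OF Ha s]) (use le in auto)
  moreover have "H_infinity (\<lambda>z. cnj (\<Sum>i. b i z))"
  proof -
    have 1: "H_infinity (\<lambda>z. \<Sum>i. cnj (b i z))" by (rule H_infinity_suminf[OF Hb s]) (use le in auto)
    have 2: "(\<Sum>i. cnj (b i z)) = cnj (\<Sum>i. b i z)" if "z \<in> sphere 0 1" for z
      using bounded_linear.suminf[OF bounded_linear_cnj sb(1)[OF that]] by simp
    show ?thesis
    proof (rule H_infinity_LIMSEQ[of "\<lambda>_ z. \<Sum>i. cnj (b i z)" "\<Sum>i. cmod (c i)"])
      show "AE z in circle. cmod (\<Sum>i. cnj (b i z)) \<le> (\<Sum>i. cmod (c i))"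
        using le(2) by (intro AE_I2 norm_suminf_le s) (simp add: space_circle)
      show "(\<lambda>_. \<Sum>i. cnj (b i z)) \<longlonglongrightarrow> cnj (\<Sum>i. b i z)" if "z \<in> sphere 0 1" for z
        by (simp only: 2[OF that] tendsto_const)
    qed (rule 1)
  qed
  moreover have "f z = (\<Sum>i. a i z) + (\<Sum>i. b i z)" if z: "z \<in> sphere 0 1" for z
  proof -
    have "f z = (\<Sum>i. c i * z powi k i)"
      unfolding f[OF z] by (rule infsum_eq_suminf[OF abs_summable_summable[OF abs_summable_mult_powi[OF c z]]])
    also have "\<dots> = (\<Sum>i. a i z + b i z)" by (rule suminf_cong) (simp add: a_def b_def)
    also have "\<dots> = (\<Sum>i. a i z) + (\<Sum>i. b i z)" by (rule suminf_add[OF sb(2)[OF z] sb(1)[OF z], symmetric])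
    finally show ?thesis .
  qed
  then have "AE z in circle. f z = (\<Sum>i. a i z) + (\<Sum>i. b i z)"
    by (intro AE_I2) (simp only: space_circle)
  ultimately show ?thesis
    unfolding splits_analytic_def by (intro exI[of _ "\<lambda>z. \<Sum>i. a i z"] exI[of _ "\<lambda>z. \<Sum>i. b i z"] conjI)
qed

text \<open>
  The series converges uniformly to a continuous function with the Fourier coefficients of \<open>f\<close>.
\<close>

lemma continuous_eq_fourier_series:
  assumes f: "continuous_on (sphere 0 1) f"
    and s: "summable (\<lambda>j. cmod (fourier_coeff f (int_decode j)))" and z: "z \<in> sphere 0 1"
  shows "f z = (\<Sum>j. fourier_coeff f (int_decode j) * z powi int_decode j)"
proof -
  define c where "c j = fourier_coeff f (int_decode j)" for j
  define P where "P N z = (\<Sum>j<N. c j * z powi int_decode j)" for N and z :: complex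
  define S where "S z = (\<Sum>j. c j * z powi int_decode j)" for z :: complex
  have sc: "summable (\<lambda>j. cmod (c j))" using s by (simp add: c_def)
  have unif: "uniform_limit (sphere 0 1) P S sequentially"
    unfolding P_def[abs_def] S_def[abs_def] by (rule Weierstrass_m_test[OF _ sc]) (simp add: norm_mult norm_power_int)
  have cP: "continuous_on (sphere 0 1) (P N)" for N
    unfolding P_def by (intro continuous_on_sum continuous_on_mult continuous_on_const continuous_on_powi_sphere)
  have cS: "continuous_on (sphere 0 1) S"
    by (rule uniform_limit_theorem[OF _ unif]) (simp_all add: cP)
  have lim: "(\<lambda>N. P N z) \<longlonglongrightarrow> S z" if "z \<in> sphere 0 1" for z
    using tendsto_uniform_limitI[OF unif that] .
  have bP: "ess_bounded (P N)" for N by (rule ess_bounded_continuous[OF cP])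
  have coeff_P: "fourier_coeff (P N) n = (\<Sum>j<N. if int_decode j = n then c j else 0)" for N n
    unfolding P_def by (rule fourier_coeff_sum_powi)
  have coeff_S: "fourier_coeff S n = fourier_coeff f n" for n
  proof -
    have bound: "AE z in circle. cmod (P N z) \<le> (\<Sum>j. cmod (c j))" for N
    proof (rule AE_I2)
      fix z assume z: "z \<in> space circle"
      have "cmod (P N z) \<le> (\<Sum>j<N. cmod (c j))"
        unfolding P_def using z by (intro order.trans[OF norm_sum]) (simp add: norm_mult norm_circle_powi)
      also have "\<dots> \<le> (\<Sum>j. cmod (c j))" using sc by (intro sum_le_suminf) auto
      finally show "cmod (P N z) \<le> (\<Sum>j. cmod (c j))" .
    qed
    have "(\<lambda>N. fourier_coeff (P N) n) \<longlonglongrightarrow> fourier_coeff S n"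
      by (rule fourier_coeff_LIMSEQ[OF bP bound borel_measurable_circle_continuous[OF cS] lim])
    moreover have "fourier_coeff (P N) n = fourier_coeff f n" if "N \<ge> Suc (int_encode n)" for N
    proof -
      have "fourier_coeff (P N) n = (\<Sum>j<N. if j = int_encode n then c j else 0)"
        unfolding coeff_P by (intro sum.cong refl) (metis int_decode_inverse int_encode_inverse)
      then show ?thesis using that by (simp add: sum.delta c_def)
    qed
    then have "(\<lambda>N. fourier_coeff (P N) n) \<longlonglongrightarrow> fourier_coeff f n"
      by (intro tendsto_eventually eventually_sequentiallyI)
    ultimately show ?thesis by (rule LIMSEQ_unique)
  qed
  have sq: "square_integrable S" "square_integrable f"
    by (intro square_integrable_ess_bounded ess_bounded_continuous cS f)+
  have "abs_circle_L2 f = abs_circle_L2 S"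
    by (rule circle_L2_eqI) (simp add: coeff_L2_abs sq coeff_S)
  then have "AE z in circle. f z = S z" by (simp add: abs_circle_L2_eq_iff sq)
  then have "f z = S z" by (rule continuous_AE_eq_circle[OF f cS _ z])
  then show ?thesis by (simp add: S_def c_def)
qed

lemma int_decode_ge: "\<bar>int_decode (Suc j)\<bar> * 2 \<ge> int j + 1"
  by (auto simp: int_decode_def sum_decode_def elim!: evenE oddE)

text \<open>
  For \<open>n \<noteq> 0\<close> the coefficients satisfy \<open>\<bar>f\<^sub>n\<bar> = \<bar>f'\<^sub>n\<bar> / \<bar>n\<bar> \<le> \<bar>f'\<^sub>n\<bar>\<^sup>2 / (2 M) + M / (2 n\<^sup>2)\<close>, and Bessel's inequality
  sums the squares to at most \<open>M\<^sup>2\<close>. Weighting the two squares by \<open>M\<close> makes the bound linear in \<open>M\<close>, on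
  which the convergence in the logarithm below depends.
\<close>

lemma wiener_le_C1:
  obtains D where "D \<ge> 0"
    "\<And>f f' B M. \<lbrakk>continuous_on (sphere 0 1) f; continuous_on (sphere 0 1) f';
      \<And>t. ((\<lambda>t. f (cis t)) has_vector_derivative f' (cis t)) (at t);
      \<And>z. z \<in> sphere 0 1 \<Longrightarrow> cmod (f z) \<le> B; \<And>z. z \<in> sphere 0 1 \<Longrightarrow> cmod (f' z) \<le> M; 0 < M\<rbrakk>
      \<Longrightarrow> wiener_le f (B + D * M)"
proof -
  define w where "w j = (1 / real_of_int (int_decode j))\<^sup>2" for j
  have sw: "summable w"
  proof -
    have "summable (\<lambda>j. 4 * inverse (real (Suc j) ^ 2))"
      using inverse_power_summable[of 2, where 'a = real] by (intro summable_mult) (subst summable_Suc_iff, simp)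
    then have "summable (\<lambda>j. w (Suc j))"
    proof (rule summable_comparison_test'[where N = 0])
      fix j
      have "real_of_int (int j + 1) \<le> real_of_int (\<bar>int_decode (Suc j)\<bar> * 2)"
        using int_decode_ge[of j] by (simp only: of_int_le_iff)
      then have le: "real (Suc j) \<le> 2 * \<bar>real_of_int (int_decode (Suc j))\<bar>" by simp
      then have "(real (Suc j))\<^sup>2 \<le> (2 * \<bar>real_of_int (int_decode (Suc j))\<bar>)\<^sup>2" by (intro power_mono) auto
      then have "(real (Suc j))\<^sup>2 \<le> 4 * (real_of_int (int_decode (Suc j)))\<^sup>2" by (simp add: power_mult_distrib)
      moreover have "(real (Suc j))\<^sup>2 > 0" by simp
      ultimately show "norm (w (Suc j)) \<le> 4 * inverse (real (Suc j) ^ 2)"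
        by (simp add: w_def power_divide divide_simps del: of_nat_Suc)
    qed
    then show ?thesis by (simp only: summable_Suc_iff)
  qed
  define W where "W = suminf w"
  have "W \<ge> 0" unfolding W_def using sw by (intro suminf_nonneg) (auto simp: w_def)
  show thesis
  proof (rule that[of "(1 + W) / 2"])
    show "(1 + W) / 2 \<ge> 0" using \<open>W \<ge> 0\<close> by simp
    fix f f' B M
    assume f: "continuous_on (sphere 0 1) f" and f': "continuous_on (sphere 0 1) f'"
      and D: "\<And>t. ((\<lambda>t. f (cis t)) has_vector_derivative f' (cis t)) (at t)"
      and B: "\<And>z. z \<in> sphere 0 1 \<Longrightarrow> cmod (f z) \<le> B"
      and M: "\<And>z. z \<in> sphere 0 1 \<Longrightarrow> cmod (f' z) \<le> M" and "0 < M"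
    define c where "c j = fourier_coeff f (int_decode j)" for j
    define d where "d j = fourier_coeff f' (int_decode j)" for j
    have bf: "ess_bounded f" "ess_bounded f'" by (intro ess_bounded_continuous f f')+
    have norm_le: "norm (abs_circle_L2 h) \<le> X" if "continuous_on (sphere 0 1) h" "\<And>z. z \<in> sphere 0 1 \<Longrightarrow> cmod (h z) \<le> X" "X \<ge> 0" for h X
    proof -
      have bh: "ess_bounded h" by (rule ess_bounded_continuous[OF that(1)])
      have "norm (abs_circle_L2 (\<lambda>z. h z * 1)) = norm (mult_L2 h (abs_circle_L2 (\<lambda>_. 1)))"
        using bh by (simp add: mult_L2_abs square_integrable_const)
      also have "\<dots> \<le> X * norm (abs_circle_L2 (\<lambda>_. 1))"
        by (rule norm_mult_L2_le[OF bh]) (use that in \<open>auto simp: space_circle\<close>)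
      also have "norm (abs_circle_L2 (\<lambda>_. 1)) = 1"
        by (simp add: norm_circle_L2_abs square_integrable_const measure_def emeasure_circle)
      finally show ?thesis by simp
    qed
    have B0: "B \<ge> 0" using B[of 1] by (rule order_trans[OF norm_ge_zero]) simp
    have c_le: "cmod (c 0) \<le> B"
    proof -
      have "cmod (c 0) \<le> norm (abs_circle_L2 f)"
        using cmod_coeff_L2_le[of "abs_circle_L2 f" "int_decode 0"] bf by (simp add: c_def coeff_L2_abs square_integrable_ess_bounded)
      also have "\<dots> \<le> B" by (rule norm_le[OF f B B0])
      finally show ?thesis .
    qed
    have sd: "summable (\<lambda>j. (cmod (d j))\<^sup>2)" "(\<Sum>j. (cmod (d j))\<^sup>2) \<le> M\<^sup>2"
    proof -
      have le: "(\<Sum>j<N. (cmod (d j))\<^sup>2) \<le> M\<^sup>2" for N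
      proof -
        have "(\<Sum>j<N. (cmod (d j))\<^sup>2) \<le> (norm (abs_circle_L2 f'))\<^sup>2"
          using bessel_inequality_L2[of "{..<N}" int_decode "abs_circle_L2 f'"] bf inj_int_decode
          by (simp add: d_def coeff_L2_abs square_integrable_ess_bounded)
        also have "\<dots> \<le> M\<^sup>2" using \<open>0 < M\<close> by (intro power_mono norm_le[OF f' M]) auto
        finally show ?thesis .
      qed
      show s: "summable (\<lambda>j. (cmod (d j))\<^sup>2)" by (rule summableI_nonneg_bounded[where x = "M\<^sup>2"]) (use le in auto)
      show "(\<Sum>j. (cmod (d j))\<^sup>2) \<le> M\<^sup>2" by (rule suminf_le_const[OF s]) (use le in auto)
    qed
    let ?b = "\<lambda>j. (if j = 0 then B else 0) + (1 / (2 * M) * (cmod (d j))\<^sup>2 + M / 2 * w j)"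
    have bound: "cmod (c j) \<le> ?b j" for j
    proof (cases "j = 0")
      case True
      then show ?thesis using c_le \<open>0 < M\<close> by (simp add: w_def add_increasing2)
    next
      case False
      then obtain i where "j = Suc i" using not0_implies_Suc by blast
      then have ne: "int_decode j \<noteq> 0" using int_decode_ge[of i] by auto
      have "d j = \<i> * of_int (int_decode j) * c j"
        unfolding d_def c_def by (rule fourier_coeff_derivative[OF f f' D])
      then have "cmod (d j) = \<bar>real_of_int (int_decode j)\<bar> * cmod (c j)" by (simp add: norm_mult)
      then have cj: "cmod (c j) = cmod (d j) * (1 / \<bar>real_of_int (int_decode j)\<bar>)" using ne by simp
      have wj: "w j = (1 / \<bar>real_of_int (int_decode j)\<bar>)\<^sup>2" by (simp add: w_def power_divide)
      have amgm: "x * y \<le> 1 / (2 * M) * x\<^sup>2 + M / 2 * y\<^sup>2" for x y :: real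
      proof -
        have "0 \<le> (x - M * y)\<^sup>2 / (2 * M)" using \<open>0 < M\<close> by simp
        also have "\<dots> = 1 / (2 * M) * x\<^sup>2 + M / 2 * y\<^sup>2 - x * y" using \<open>0 < M\<close> by (simp add: power2_eq_square field_simps)
        finally show ?thesis by simp
      qed
      show ?thesis unfolding cj wj using False by (simp only: if_False add_0_left) (rule amgm)
    qed
    have sums_b: "?b sums (B + (1 / (2 * M) * (\<Sum>j. (cmod (d j))\<^sup>2) + M / 2 * W))"
      unfolding W_def by (intro sums_add sums_mult summable_sums sd sw sums_single)
    have sc: "summable (\<lambda>j. cmod (c j))"
      by (rule summable_comparison_test'[OF sums_summable[OF sums_b], of 0]) (use bound in simp)
    have "(\<Sum>j. cmod (c j)) \<le> B + (1 / (2 * M) * (\<Sum>j. (cmod (d j))\<^sup>2) + M / 2 * W)"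
      using suminf_le[OF bound sc sums_summable[OF sums_b]] sums_unique[OF sums_b] by simp
    also have "\<dots> \<le> B + (1 / (2 * M) * M\<^sup>2 + M / 2 * W)"
      using sd(2) \<open>0 < M\<close> by (intro add_mono mult_left_mono) auto
    also have "\<dots> = B + (1 + W) / 2 * M" using \<open>0 < M\<close> by (simp add: power2_eq_square field_simps)
    finally have le: "(\<Sum>j. cmod (c j)) \<le> B + (1 + W) / 2 * M" .
    have con: "(\<lambda>j. cmod (c j)) summable_on UNIV" using sc by (simp add: summable_on_UNIV_nonneg_real_iff)
    show "wiener_le f (B + (1 + W) / 2 * M)"
      unfolding wiener_le_def
    proof (intro exI[of _ c] exI[of _ int_decode] conjI ballI con)
      show "(\<Sum>\<^sub>\<infinity>j. cmod (c j)) \<le> B + (1 + W) / 2 * M" using le by (simp add: infsum_eq_suminf[OF con])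
      fix z :: complex assume z: "z \<in> sphere 0 1"
      have "f z = (\<Sum>j. c j * z powi int_decode j)"
        using continuous_eq_fourier_series[OF f _ z] sc by (simp add: c_def)
      then show "f z = (\<Sum>\<^sub>\<infinity>j. c j * z powi int_decode j)"
        using infsum_eq_suminf[OF abs_summable_summable[OF abs_summable_mult_powi[OF con z]], of int_decode] by simp
    qed
  qed
qed

section \<open>Logarithms of functions in the Wiener algebra\<close>

lemma splits_analytic_add:
  assumes "splits_analytic f" "splits_analytic g"
  shows "splits_analytic (\<lambda>z. f z + g z)"
proof -
  obtain u v where uv: "H_infinity u" "H_infinity (\<lambda>z. cnj (v z))" "AE z in circle. f z = u z + v z"
    using assms(1) unfolding splits_analytic_def by blast
  obtain u' v' where uv': "H_infinity u'" "H_infinity (\<lambda>z. cnj (v' z))" "AE z in circle. g z = u' z + v' z"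
    using assms(2) unfolding splits_analytic_def by blast
  have "AE z in circle. f z + g z = (u z + u' z) + (v z + v' z)"
    using uv(3) uv'(3) by eventually_elim simp
  then show ?thesis
    unfolding splits_analytic_def using H_infinity_add[OF uv(1) uv'(1)] H_infinity_add[OF uv(2) uv'(2)]
    by (intro exI[of _ "\<lambda>z. u z + u' z"] exI[of _ "\<lambda>z. v z + v' z"]) simp
qed

lemma splits_analytic_cong:
  assumes "splits_analytic f" "\<And>z. z \<in> sphere 0 1 \<Longrightarrow> f z = g z"
  shows "splits_analytic g"
proof -
  obtain u v where uv: "H_infinity u" "H_infinity (\<lambda>z. cnj (v z))" "AE z in circle. f z = u z + v z"
    using assms(1) unfolding splits_analytic_def by blast
  have "AE z in circle. g z = u z + v z"
    using uv(3) AE_space[of circle] by eventually_elim (use assms(2) in \<open>simp add: space_circle\<close>)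
  then show ?thesis unfolding splits_analytic_def using uv by blast
qed

text \<open>
  Near \<open>t\<close> the continuous logarithm is \<open>f t\<close> plus the principal logarithm of \<open>q s / q t\<close>.
\<close>

lemma has_vector_derivative_log:
  fixes f q :: "real \<Rightarrow> complex"
  assumes f: "isCont f t" and q: "\<And>s. exp (f s) = q s" and D: "(q has_vector_derivative q') (at t)"
  shows "(f has_vector_derivative q' / q t) (at t)"
proof -
  have qt: "q t \<noteq> 0" using q[of t] by (metis exp_not_eq_zero)
  have "((\<lambda>s. Ln (q s / q t)) has_vector_derivative q' / q t * inverse (q t / q t)) (at t)"
    using field_vector_diff_chain_at[of "\<lambda>s. q s / q t" "q' / q t" t Ln "inverse (q t / q t)"]
      has_vector_derivative_divide[OF D, of "q t"] has_field_derivative_Ln[of "q t / q t"] qt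
    by (simp add: o_def)
  then have D': "((\<lambda>s. f t + Ln (q s / q t)) has_vector_derivative q' / q t) (at t)"
    using has_vector_derivative_add[OF has_vector_derivative_const] qt by fastforce
  have "\<forall>\<^sub>F s in nhds t. f s = f t + Ln (q s / q t)"
  proof -
    have "\<forall>\<^sub>F s in nhds t. dist (f s) (f t) < pi"
      using f pi_gt_zero unfolding isCont_def tendsto_at_iff_tendsto_nhds by (rule tendstoD)
    then show ?thesis
    proof eventually_elim
      case (elim s)
      have "\<bar>Im (f s - f t)\<bar> < pi" using elim abs_Im_le_cmod[of "f s - f t"] by (simp add: dist_norm)
      then have "Ln (exp (f s - f t)) = f s - f t" by (intro Ln_exp) auto
      then show ?case by (simp add: exp_diff q)
    qed
  qed
  then have ev: "\<forall>\<^sub>F s in at t. f t + Ln (q s / q t) = f s"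
    by (auto simp: eventually_at_filter elim: eventually_mono)
  have "f t + Ln (q t / q t) = f t" using qt by simp
  then show ?thesis
    using D' ev unfolding has_vector_derivative_def
    by (blast intro: has_derivative_transform_eventually[OF _ _ _ UNIV_I])
qed

text \<open>
  Split \<open>F - a = p + e\<close> into a trigonometric polynomial \<open>p\<close> and a remainder of Wiener norm at most
  \<open>r / 3\<close>. Then \<open>\<bar>p\<bar> \<ge> 2 r / 3\<close>, and with \<open>y = e / p\<close> the logarithm is \<open>g = l + Ln (1 + y)\<close>, where \<open>l\<close> is a
  continuous logarithm of \<open>p\<close>. This \<open>l\<close> is continuously differentiable, so it has an absolutely
  convergent Fourier series. In the series of \<open>Ln (1 + y)\<close> the Wiener norm of \<open>e\<^sup>n\<close> is at most \<open>(r / 3)\<^sup>n\<close>,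
  and that of \<open>p\<^sup>-\<^sup>n\<close> is controlled by the supremum norms of \<open>p\<^sup>-\<^sup>n\<close> and its derivative, that is, by
  \<open>(3 / (2 r))\<^sup>n\<close> up to a factor linear in \<open>n\<close>. The product decays like \<open>n / 2\<^sup>n\<close>.
\<close>

lemma splits_analytic_log_wiener:
  assumes F: "F \<in> wiener_algebra" and r: "0 < r" "\<And>z. z \<in> sphere 0 1 \<Longrightarrow> r \<le> cmod (F z - a)"
    and g: "continuous_on (sphere 0 1) g" "\<And>z. z \<in> sphere 0 1 \<Longrightarrow> F z - a = exp (g z)"
  shows "splits_analytic g"
proof -
  define c where "c = fourier_coeff F"
  have c: "(\<lambda>n. cmod (c n)) summable_on UNIV"
    and F_sum: "\<And>z. z \<in> sphere 0 1 \<Longrightarrow> ((\<lambda>n. c n * z powi n) has_sum F z) UNIV"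
    using F by (auto simp: wiener_algebra_def c_def)
  obtain I where I: "finite I" "(\<Sum>\<^sub>\<infinity>n\<in>UNIV - I. cmod (c n)) \<le> r / 3"
  proof -
    have "((\<lambda>n. cmod (c n)) has_sum (\<Sum>\<^sub>\<infinity>n. cmod (c n))) UNIV" using c by (rule has_sum_infsum)
    then have "\<forall>\<^sub>F X in finite_subsets_at_top UNIV. dist (\<Sum>n\<in>X. cmod (c n)) (\<Sum>\<^sub>\<infinity>n. cmod (c n)) < r / 3"
      unfolding has_sum_def using r(1) by (intro tendstoD) auto
    then obtain I where I: "finite I" "dist (\<Sum>n\<in>I. cmod (c n)) (\<Sum>\<^sub>\<infinity>n. cmod (c n)) < r / 3"
      unfolding eventually_finite_subsets_at_top by blast
    have "(\<Sum>\<^sub>\<infinity>n\<in>UNIV - I. cmod (c n)) = (\<Sum>\<^sub>\<infinity>n. cmod (c n)) - (\<Sum>\<^sub>\<infinity>n\<in>I. cmod (c n))"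
      using c I by (intro infsum_Diff) auto
    also have "\<dots> \<le> dist (\<Sum>n\<in>I. cmod (c n)) (\<Sum>\<^sub>\<infinity>n. cmod (c n))"
      using I(1) by (simp add: dist_real_def)
    finally show thesis using I by (intro that[of I]) auto
  qed
  define p where "p z = (\<Sum>n\<in>I. c n * z powi n) - a" for z
  define p' where "p' z = (\<Sum>n\<in>I. c n * (\<i> * of_int n * z powi n))" for z
  define e where "e z = F z - a - p z" for z
  have cp: "continuous_on (sphere 0 1) p" "continuous_on (sphere 0 1) p'"
    unfolding p_def p'_def
    by (intro continuous_on_diff continuous_on_sum continuous_on_mult continuous_on_const continuous_on_powi_sphere)+
  have Dp: "((\<lambda>t. p (cis t)) has_vector_derivative p' (cis t)) (at t)" for t
  proof -
    have "((\<lambda>t. \<Sum>n\<in>I. c n * cis t powi n) has_vector_derivative p' (cis t)) (at t)"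
      unfolding p'_def by (intro has_vector_derivative_sum has_vector_derivative_mult_right has_vector_derivative_cis_powi)
    from has_vector_derivative_diff[OF this has_vector_derivative_const[of a]]
    show ?thesis by (simp add: p_def)
  qed
  have e: "wiener_le e (r / 3)"
  proof (rule wiener_leI[where h = int_decode and A = UNIV and c = "\<lambda>n. if n \<in> I then 0 else c n" and k = "\<lambda>n. n"])
    show "bij_betw int_decode UNIV UNIV" by (rule bij_int_decode)
    show "(\<lambda>n. cmod (if n \<in> I then 0 else c n)) summable_on UNIV"
      by (rule summable_on_comparison_test[OF c]) auto
    have "(\<Sum>\<^sub>\<infinity>n. cmod (if n \<in> I then 0 else c n)) = (\<Sum>\<^sub>\<infinity>n\<in>UNIV - I. cmod (c n))"
      by (rule infsum_cong_neutral) auto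
    then show "(\<Sum>\<^sub>\<infinity>n. cmod (if n \<in> I then 0 else c n)) \<le> r / 3" using I by simp
    fix z :: complex assume z: "z \<in> sphere 0 1"
    have "(\<Sum>\<^sub>\<infinity>n. (if n \<in> I then 0 else c n) * z powi n) = (\<Sum>\<^sub>\<infinity>n\<in>UNIV - I. c n * z powi n)"
      by (rule infsum_cong_neutral) auto
    also have "\<dots> = (\<Sum>\<^sub>\<infinity>n. c n * z powi n) - (\<Sum>\<^sub>\<infinity>n\<in>I. c n * z powi n)"
      using F_sum[OF z] I by (intro infsum_Diff has_sum_imp_summable[OF F_sum[OF z]] summable_on_finite) auto
    also have "\<dots> = e z" using infsumI[OF F_sum[OF z]] I by (simp add: e_def p_def)
    finally show "e z = (\<Sum>\<^sub>\<infinity>n. (if n \<in> I then 0 else c n) * z powi n)" by simp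
  qed
  have p_ge: "cmod (p z) \<ge> 2 * r / 3" if z: "z \<in> sphere 0 1" for z
  proof -
    have "cmod (F z - a) \<le> cmod (e z) + cmod (p z)"
      using norm_triangle_ineq[of "e z" "p z"] by (simp add: e_def)
    then show ?thesis using r(2)[OF z] cmod_le_wiener_le[OF e z] by simp
  qed
  have p_ne: "p z \<noteq> 0" if "z \<in> sphere 0 1" for z using p_ge[OF that] r(1) by auto
  \<comment> \<open>the supremum bound for \<open>1 / p\<close>\<close>
  define s where "s = 3 / (2 * r)"
  have s: "s > 0" "cmod (inverse (p z)) \<le> s" if "z \<in> sphere 0 1" for z
    using le_imp_inverse_le[OF p_ge[OF that]] r(1) by (auto simp: s_def norm_inverse)
  have "s > 0" using r(1) by (simp add: s_def)
  obtain P where P: "P > 0" "\<And>z. z \<in> sphere 0 1 \<Longrightarrow> cmod (p' z) \<le> P"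
  proof -
    obtain P where P: "\<And>z. z \<in> sphere 0 1 \<Longrightarrow> cmod (p' z) \<le> P"
      using continuous_on_circle_bounded[OF cp(2)] by blast
    show thesis by (rule that[of "\<bar>P\<bar> + 1"]) (use order.trans[OF P, of _ "\<bar>P\<bar> + 1"] in auto)
  qed
  obtain D where D: "D \<ge> 0"
    "\<And>f f' B M. \<lbrakk>continuous_on (sphere 0 1) f; continuous_on (sphere 0 1) f';
      \<And>t. ((\<lambda>t. f (cis t)) has_vector_derivative f' (cis t)) (at t);
      \<And>z. z \<in> sphere 0 1 \<Longrightarrow> cmod (f z) \<le> B; \<And>z. z \<in> sphere 0 1 \<Longrightarrow> cmod (f' z) \<le> M; 0 < M\<rbrakk>
      \<Longrightarrow> wiener_le f (B + D * M)"
    using wiener_le_C1 by metis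
  have inv_pow: "wiener_le (\<lambda>z. inverse (p z) ^ n) (s ^ n * (1 + real n * (D * s * P)))" for n
  proof (cases "n = 0")
    case True
    then show ?thesis using wiener_le_const[of 1] by simp
  next
    case False
    define q' where "q' z = of_nat n * inverse (p z) ^ (n - 1) * (- (inverse (p z) * p' z * inverse (p z)))" for z
    have "wiener_le (\<lambda>z. inverse (p z) ^ n) (s ^ n + D * (real n * s ^ (n + 1) * P))"
    proof (rule D(2)[where f' = q'])
      show "continuous_on (sphere 0 1) (\<lambda>z. inverse (p z) ^ n)" "continuous_on (sphere 0 1) q'"
        unfolding q'_def using p_ne by (intro continuous_intros cp; simp)+
      show "((\<lambda>t. inverse (p (cis t)) ^ n) has_vector_derivative q' (cis t)) (at t)" for t
      proof -
        have ne: "p (cis t) \<noteq> 0" by (intro p_ne) simp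
        have "((\<lambda>w. inverse w ^ n) has_field_derivative
            of_nat n * inverse (p (cis t)) ^ (n - 1) * (- (inverse (p (cis t)) * inverse (p (cis t))))) (at (p (cis t)))"
          using ne by (auto intro!: derivative_eq_intros simp: power2_eq_square)
        from field_vector_diff_chain_at[OF Dp this] show ?thesis
          by (simp add: o_def q'_def mult_ac)
      qed
      show "cmod (inverse (p z) ^ n) \<le> s ^ n" if "z \<in> sphere 0 1" for z
        unfolding norm_power using s(2)[OF that] by (intro power_mono) auto
      show "cmod (q' z) \<le> real n * s ^ (n + 1) * P" if "z \<in> sphere 0 1" for z
      proof -
        have "cmod (q' z) = real n * (cmod (inverse (p z)) ^ (n - 1) * cmod (inverse (p z)) * cmod (inverse (p z)) * cmod (p' z))"
          by (simp add: q'_def norm_mult norm_power mult_ac)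
        also have "\<dots> \<le> real n * (s ^ (n - 1) * s * s * P)"
          using s[OF that] P that by (intro mult_left_mono mult_mono power_mono) auto
        also have "\<dots> = real n * s ^ (n + 1) * P" using False by (cases n) auto
        finally show ?thesis .
      qed
      show "0 < real n * s ^ (n + 1) * P" using False \<open>s > 0\<close> P by simp
    qed
    then show ?thesis by (rule back_subst[of "wiener_le _"]) (simp add: algebra_simps)
  qed
  define y where "y z = e z * inverse (p z)" for z
  have y_le: "cmod (y z) \<le> 1 / 2" if z: "z \<in> sphere 0 1" for z
  proof -
    have "cmod (y z) \<le> (r / 3) * s"
      unfolding y_def norm_mult using cmod_le_wiener_le[OF e z] s[OF z] r(1) by (intro mult_mono) auto
    then show ?thesis using r(1) by (simp add: s_def)
  qed
  define t where "t n z = ((- 1) ^ Suc n / of_nat n) * y z ^ n" for n z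
  define C where "C n = cmod ((- 1) ^ Suc n / of_nat n) * ((1 / 2) ^ n * (1 + real n * (D * s * P)))" for n
  have t: "wiener_le (t n) (C n)" for n
  proof -
    have "wiener_le (\<lambda>z. e z ^ n * inverse (p z) ^ n) ((r / 3) ^ n * (s ^ n * (1 + real n * (D * s * P))))"
      by (intro wiener_le_mult wiener_le_power e inv_pow)
    also have "(r / 3) ^ n * (s ^ n * (1 + real n * (D * s * P))) = (r / 3 * s) ^ n * (1 + real n * (D * s * P))"
      by (simp only: power_mult_distrib mult.assoc)
    also have "r / 3 * s = 1 / 2" using r(1) by (simp add: s_def)
    finally have "wiener_le (\<lambda>z. y z ^ n) ((1 / 2) ^ n * (1 + real n * (D * s * P)))"
      by (simp add: y_def power_mult_distrib)
    then show ?thesis unfolding t_def C_def by (rule wiener_le_cmult)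
  qed
  have C: "summable C"
  proof (rule summable_comparison_test')
    show "summable (\<lambda>n. (1 + D * s * P) * (1 / 2 :: real) ^ n)" by (intro summable_mult summable_geometric) simp
    show "norm (C n) \<le> (1 + D * s * P) * (1 / 2) ^ n" if "n \<ge> 0" for n
    proof (cases "n = 0")
      case False
      have DsP: "D * s * P \<ge> 0" using D(1) \<open>s > 0\<close> P(1) by simp
      have "C n = (1 / 2) ^ n * ((1 + real n * (D * s * P)) / real n)"
        by (simp add: C_def norm_divide norm_power norm_mult)
      also have "(1 + real n * (D * s * P)) / real n = 1 / real n + D * s * P" using False by (simp add: add_divide_distrib)
      also have "(1 / 2) ^ n * (1 / real n + D * s * P) \<le> (1 / 2) ^ n * (1 + D * s * P)"
        using False by (intro mult_left_mono add_right_mono) auto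
      finally show ?thesis using wiener_le_nonneg[OF t[of n]] by (simp add: mult.commute)
    qed (use D(1) \<open>s > 0\<close> P(1) in \<open>simp add: C_def\<close>)
  qed
  have Ln_y: "(\<Sum>n. t n z) = Ln (1 + y z)" if z: "z \<in> sphere 0 1" for z
    using sums_unique[OF Ln_series[of "y z"]] y_le[OF z] by (simp add: t_def)
  have W: "wiener_le (\<lambda>z. Ln (1 + y z)) (suminf C)"
    by (rule wiener_le_cong[OF wiener_le_suminf[OF t C] Ln_y])
  define l where "l z = g z - Ln (1 + y z)" for z
  have re_y: "Re (1 + y z) > 0" if "z \<in> sphere 0 1" for z
    using y_le[OF that] abs_Re_le_cmod[of "y z"] by simp
  have cF: "continuous_on (sphere 0 1) F"
  proof -
    have "continuous_on (sphere 0 1) (\<lambda>z. exp (g z) + a)" by (intro continuous_intros g)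
    then show ?thesis by (rule continuous_on_eq) (simp flip: g(2))
  qed
  have cl: "continuous_on (sphere 0 1) l"
  proof -
    have "continuous_on (sphere 0 1) (\<lambda>z. 1 + y z)"
      unfolding y_def e_def using p_ne by (intro continuous_intros cF cp) auto
    moreover have "1 + y z \<notin> \<real>\<^sub>\<le>\<^sub>0" if "z \<in> sphere 0 1" for z
      using re_y[OF that] by (metis complex_nonpos_Reals_iff not_less)
    ultimately show ?thesis unfolding l_def
      by (intro continuous_on_diff g continuous_on_Ln') auto
  qed
  have exp_l: "exp (l z) = p z" if z: "z \<in> sphere 0 1" for z
  proof -
    have ne: "1 + y z \<noteq> 0" using re_y[OF z] by (metis less_irrefl zero_complex.sel(1))
    have "exp (l z) = (F z - a) / (1 + y z)" using ne by (simp add: l_def exp_diff g(2)[OF z, symmetric])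
    also have "F z - a = p z * (1 + y z)" using p_ne[OF z] by (simp add: y_def e_def field_simps)
    finally show ?thesis using ne by simp
  qed
  have cll: "continuous_on UNIV (\<lambda>t. l (cis t))"
    by (rule continuous_on_compose2[OF cl]) (auto intro!: continuous_intros)
  have Dl: "((\<lambda>t. l (cis t)) has_vector_derivative p' (cis t) / p (cis t)) (at t)" for t
    by (rule has_vector_derivative_log[OF _ _ Dp]) (use cll exp_l in \<open>auto simp: continuous_on_eq_continuous_at\<close>)
  obtain B where B: "\<And>z. z \<in> sphere 0 1 \<Longrightarrow> cmod (l z) \<le> B"
    using continuous_on_circle_bounded[OF cl] by blast
  have "wiener_le l (B + D * (P * s))"
  proof (rule D(2)[where f' = "\<lambda>z. p' z / p z"])
    show "continuous_on (sphere 0 1) (\<lambda>z. p' z / p z)" using p_ne by (intro continuous_intros cp) auto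
    show "cmod (p' z / p z) \<le> P * s" if "z \<in> sphere 0 1" for z
      unfolding divide_inverse norm_mult using P that s[OF that] by (intro mult_mono) auto
    show "0 < P * s" using P \<open>s > 0\<close> by simp
  qed (use cl Dl B in auto)
  then have "splits_analytic (\<lambda>z. l z + Ln (1 + y z))"
    by (intro splits_analytic_add splits_analytic_wiener_le[OF W]) (rule splits_analytic_wiener_le)
  then show ?thesis by (rule splits_analytic_cong) (simp add: l_def)
qed

lemma continuous_on_wiener_algebra:
  assumes "F \<in> wiener_algebra"
  shows "continuous_on (sphere 0 1) F"
proof -
  let ?c = "fourier_coeff F"
  have c: "(\<lambda>n. cmod (?c n)) summable_on UNIV"
    and F: "\<And>z. z \<in> sphere 0 1 \<Longrightarrow> ((\<lambda>n. ?c n * z powi n) has_sum F z) UNIV"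
    using assms by (auto simp: wiener_algebra_def)
  have s: "summable (\<lambda>j. cmod (?c (int_decode j)))"
    using summable_on_reindex_bij_betw[OF bij_int_decode, of "\<lambda>n. cmod (?c n)"] c
    by (simp add: summable_on_UNIV_nonneg_real_iff)
  have "uniform_limit (sphere 0 1) (\<lambda>N z. \<Sum>j<N. ?c (int_decode j) * z powi int_decode j)
      (\<lambda>z. \<Sum>j. ?c (int_decode j) * z powi int_decode j) sequentially"
    by (rule Weierstrass_m_test[OF _ s]) (simp add: norm_mult norm_power_int)
  then have "continuous_on (sphere 0 1) (\<lambda>z. \<Sum>j. ?c (int_decode j) * z powi int_decode j)"
    by (rule uniform_limit_theorem[rotated, OF _ trivial_limit_sequentially])
       (intro always_eventually allI continuous_on_sum continuous_on_mult continuous_on_const continuous_on_powi_sphere)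
  moreover have "(\<Sum>j. ?c (int_decode j) * z powi int_decode j) = F z" if z: "z \<in> sphere 0 1" for z
  proof -
    have "((\<lambda>j. ?c (int_decode j) * z powi int_decode j) has_sum F z) UNIV"
      using has_sum_reindex_bij_betw[OF bij_int_decode, of "\<lambda>n. ?c n * z powi n"] F[OF z] by simp
    then show ?thesis by (metis has_sum_imp_sums sums_unique)
  qed
  ultimately show ?thesis by (rule continuous_on_eq)
qed

section \<open>Rotation invariance of arc length\<close>

lemma nn_integral_circle:
  assumes "h \<in> borel_measurable circle"
  shows "(\<integral>\<^sup>+z. h z \<partial>circle) = (\<integral>\<^sup>+t. h (cis t) * indicator {0..<2 * pi} t \<partial>lborel) / ennreal (2 * pi)"
proof -
  have h: "h \<in> borel_measurable (restrict_space borel (sphere 0 1))"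
    using assms by (simp cong: measurable_cong_sets[OF sets_circle refl])
  have "(\<integral>\<^sup>+z. h z \<partial>circle) = (\<integral>\<^sup>+t. h (cis t) \<partial>uniform_measure lborel {0..<2 * pi})"
    unfolding circle_def using assms[unfolded circle_def] by (rule nn_integral_distr[OF measurable_cis_circle])
  also have "\<dots> = (\<integral>\<^sup>+t. h (cis t) * indicator {0..<2 * pi} t \<partial>lborel) / ennreal (2 * pi)"
    using measurable_compose[OF measurable_cis_circle h]
    by (subst nn_integral_uniform_measure) (auto cong: measurable_cong_sets)
  finally show ?thesis .
qed

lemma nn_integral_lborel_shift:
  fixes s :: real
  assumes "f \<in> borel_measurable borel"
  shows "(\<integral>\<^sup>+t. f (t + s) \<partial>lborel) = (\<integral>\<^sup>+t. f t \<partial>lborel)"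
  using nn_integral_real_affine[OF assms, of 1 s] by (simp add: add.commute)

lemma measurable_rotate_circle: "(\<lambda>z. cis s * z) \<in> circle \<rightarrow>\<^sub>M circle"
proof -
  have "(\<lambda>z. cis s * z) \<in> borel_measurable circle"
    by (intro borel_measurable_circle_continuous continuous_intros)
  then have "(\<lambda>z. cis s * z) \<in> circle \<rightarrow>\<^sub>M restrict_space borel (sphere 0 1)"
    by (intro measurable_restrict_space2) (auto simp: space_circle norm_mult)
  then show ?thesis by (simp cong: measurable_cong_sets[OF refl sets_circle])
qed

text \<open>
  A full period may start anywhere: the piece of \<open>[s, s + 2\<pi>)\<close> beyond \<open>2\<pi>\<close> is moved back to \<open>[0, s)\<close>.
\<close>

lemma nn_integral_rotate_circle:
  assumes h: "h \<in> borel_measurable circle" and s: "0 \<le> s" "s \<le> 2 * pi"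
  shows "(\<integral>\<^sup>+z. h (cis s * z) \<partial>circle) = (\<integral>\<^sup>+z. h z \<partial>circle)"
proof -
  define k where "k t = h (cis t)" for t
  have h': "h \<in> borel_measurable (restrict_space borel (sphere 0 1))"
    using h by (simp cong: measurable_cong_sets[OF sets_circle refl])
  have [measurable]: "k \<in> borel_measurable borel"
    using measurable_compose[OF measurable_cis_circle h'] by (simp add: k_def[abs_def] cong: measurable_cong_sets)
  have per: "k (t + 2 * pi) = k t" for t
    by (simp add: k_def flip: cis_mult)
  let ?J = "\<lambda>a b. \<integral>\<^sup>+t. k t * indicator {a..<b} t \<partial>lborel"
  have split: "?J a c = ?J a b + ?J b c" if "a \<le> b" "b \<le> c" for a b c
  proof -
    have "?J a c = (\<integral>\<^sup>+t. k t * indicator {a..<b} t + k t * indicator {b..<c} t \<partial>lborel)"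
      using that by (intro nn_integral_cong) (auto simp: indicator_def)
    then show ?thesis by (simp add: nn_integral_add)
  qed
  have "(\<integral>\<^sup>+t. k (t + s) * indicator {0..<2 * pi} t \<partial>lborel) = (\<integral>\<^sup>+t. k (t + s) * indicator {s..<2 * pi + s} (t + s) \<partial>lborel)"
    by (intro nn_integral_cong) (auto simp: indicator_def)
  also have "\<dots> = ?J s (2 * pi + s)" by (rule nn_integral_lborel_shift) measurable
  also have "\<dots> = ?J s (2 * pi) + ?J (2 * pi) (2 * pi + s)" using s by (intro split) auto
  also have "?J (2 * pi) (2 * pi + s) = (\<integral>\<^sup>+t. k (t + 2 * pi) * indicator {2 * pi..<2 * pi + s} (t + 2 * pi) \<partial>lborel)"
    by (rule nn_integral_lborel_shift[symmetric]) measurable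
  also have "\<dots> = ?J 0 s" by (intro nn_integral_cong) (auto simp: per indicator_def)
  also have "?J s (2 * pi) + ?J 0 s = ?J 0 (2 * pi)" using split[of 0 s "2 * pi"] s by (simp add: add.commute)
  finally have "(\<integral>\<^sup>+t. k (t + s) * indicator {0..<2 * pi} t \<partial>lborel) = ?J 0 (2 * pi)" .
  moreover have "(\<lambda>z. h (cis s * z)) \<in> borel_measurable circle"
    by (rule measurable_compose[OF measurable_rotate_circle h])
  ultimately show ?thesis
    by (simp add: nn_integral_circle h k_def cis_mult add.commute)
qed

section \<open>The Riesz projection of a Dini-continuous function\<close>

text \<open>
  By rotation \<open>w\<close> may be taken to be 1. The chord \<open>\<bar>cis t - 1\<bar> = 2 sin (t / 2)\<close> lies between \<open>(2 / \<pi>) m\<close> and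
  \<open>m\<close>, where \<open>m\<close> is the smaller of \<open>t\<close> and \<open>2\<pi> - t\<close>, so the integral compares with that of \<open>\<Omega> t / t\<close>.
\<close>

lemma nn_integral_dini_kernel:
  assumes \<Omega>: "mono \<Omega>" "\<And>t. 0 \<le> \<Omega> t"
    and dini: "(\<integral>\<^sup>+t\<in>{0<..<1}. ennreal (\<Omega> t / t) \<partial>lborel) < \<infinity>"
  obtains I where "I \<ge> 0" "\<And>w. w \<in> sphere 0 1 \<Longrightarrow> (\<integral>\<^sup>+z. ennreal (\<Omega> (cmod (z - w)) / cmod (z - w)) \<partial>circle) \<le> ennreal I"
proof -
  have [measurable]: "\<Omega> \<in> borel_measurable borel" using \<Omega>(1) by (rule borel_measurable_mono)
  define q where "q t = ennreal (\<Omega> t / t)" for t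
  have [measurable]: "q \<in> borel_measurable borel" unfolding q_def by measurable
  define J where "J = (\<integral>\<^sup>+t. q t * indicator {0<..<2 * pi} t \<partial>lborel)"
  have "J \<le> (\<integral>\<^sup>+t. q t * indicator {0<..<1} t + ennreal (\<Omega> (2 * pi)) * indicator {1..2 * pi} t \<partial>lborel)"
    unfolding J_def
  proof (rule nn_integral_mono)
    fix t :: real
    have "q t \<le> ennreal (\<Omega> (2 * pi))" if "1 \<le> t" "t \<le> 2 * pi"
    proof -
      have "\<Omega> t / t \<le> \<Omega> t / 1" using that \<Omega>(2) by (intro divide_left_mono) auto
      also have "\<dots> \<le> \<Omega> (2 * pi)" using monoD[OF \<Omega>(1) that(2)] by simp
      finally show ?thesis unfolding q_def by (rule ennreal_leI)
    qed
    then show "q t * indicator {0<..<2 * pi} t \<le> q t * indicator {0<..<1} t + ennreal (\<Omega> (2 * pi)) * indicator {1..2 * pi} t"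
      by (auto simp: indicator_def)
  qed
  also have "\<dots> = (\<integral>\<^sup>+t. q t * indicator {0<..<1} t \<partial>lborel) + ennreal (\<Omega> (2 * pi)) * ennreal (2 * pi - 1)"
  proof -
    have "1 \<le> 2 * pi" using pi_ge_two by linarith
    then show ?thesis by (simp add: nn_integral_add nn_integral_cmult)
  qed
  also have "\<dots> < \<infinity>" using dini by (simp add: q_def ennreal_mult_less_top)
  finally have J: "J < \<infinity>" .
  have chord: "cmod (cis t - 1) = 2 * sin (t / 2)" if "0 \<le> t" "t \<le> 2 * pi" for t
  proof -
    have "(cmod (cis t - 1))\<^sup>2 = (cos t - 1)\<^sup>2 + (sin t)\<^sup>2" by (simp add: cmod_power2)
    also have "\<dots> = 2 - 2 * cos t" using sin_cos_squared_add[of t] by (simp add: power2_eq_square algebra_simps)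
    also have "\<dots> = (2 * sin (t / 2))\<^sup>2" using cos_double_sin[of "t / 2"] by (simp add: power_mult_distrib)
    finally have sq: "(cmod (cis t - 1))\<^sup>2 = (2 * sin (t / 2))\<^sup>2" .
    have "0 \<le> 2 * sin (t / 2)" using that sin_ge_zero[of "t / 2"] by simp
    then show ?thesis by (rule power2_eq_imp_eq[OF sq norm_ge_zero])
  qed
  have half: "\<Omega> (cmod (cis t - 1)) / cmod (cis t - 1) \<le> pi / 2 * (\<Omega> t / t)" if t: "0 < t" "t \<le> pi" for t
  proof -
    have up: "2 * sin (t / 2) \<le> t" using sin_x_le_x[of "t / 2"] t by simp
    have lo: "2 * sin (t / 2) \<ge> 2 / pi * t"
    proof -
      \<comment> \<open>A concave function lies above its chord from 0 to \<open>\<pi> / 2\<close>.\<close>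
      have "concave_on {0..pi} sin" 
        by (rule f''_le0_imp_concave[where f' = cos and f'' = "\<lambda>x. - sin x"])
           (auto intro!: derivative_eq_intros simp: sin_ge_zero)
      then have "sin ((1 - t / pi) *\<^sub>R 0 + (t / pi) *\<^sub>R (pi / 2)) \<ge> (1 - t / pi) * sin 0 + (t / pi) * sin (pi / 2)"
        using t by (intro concave_onD) auto
      then show ?thesis using t by simp
    qed
    have "\<Omega> (2 * sin (t / 2)) / (2 * sin (t / 2)) \<le> \<Omega> t / (2 / pi * t)"
      using t up lo \<Omega>(2) monoD[OF \<Omega>(1) up] by (intro frac_le) auto
    then show ?thesis using t chord[of t] by (simp add: field_simps)
  qed
  define a where "a z = ennreal (\<Omega> (cmod (z - 1)) / cmod (z - 1))" for z
  have a_meas: "(\<lambda>z. ennreal (\<Omega> (cmod (z - w)) / cmod (z - w))) \<in> borel_measurable circle" for w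
  proof -
    have "(\<lambda>z. z - w) \<in> borel_measurable circle" by (intro borel_measurable_circle_continuous continuous_intros)
    then show ?thesis by measurable
  qed
  have "(\<integral>\<^sup>+t. a (cis t) * indicator {0..<2 * pi} t \<partial>lborel)
      \<le> (\<integral>\<^sup>+t. ennreal (pi / 2) * (q t * indicator {0<..<2 * pi} t)
        + ennreal (pi / 2) * (q (2 * pi + -1 * t) * indicator {0<..<2 * pi} (2 * pi + -1 * t)) \<partial>lborel)"
  proof (rule nn_integral_mono)
    fix t :: real
    consider "t = 0" | "0 < t" "t \<le> pi" | "pi < t" "t < 2 * pi" | "t < 0 \<or> t \<ge> 2 * pi" by linarith
    then show "a (cis t) * indicator {0..<2 * pi} t \<le> ennreal (pi / 2) * (q t * indicator {0<..<2 * pi} t)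
        + ennreal (pi / 2) * (q (2 * pi + -1 * t) * indicator {0<..<2 * pi} (2 * pi + -1 * t))"
    proof cases
      case 2
      have "a (cis t) \<le> ennreal (pi / 2 * (\<Omega> t / t))" unfolding a_def by (rule ennreal_leI[OF half[OF 2]])
      also have "\<dots> = ennreal (pi / 2) * q t" unfolding q_def using 2 \<Omega>(2) by (intro ennreal_mult) auto
      finally have "a (cis t) * 1 \<le> ennreal (pi / 2) * q t + 0" by simp
      then show ?thesis using 2 by (auto simp: indicator_def intro: add_increasing2)
    next
      case 3
      have "cmod (cis t - 1) = cmod (cis (2 * pi - t) - 1)"
        using 3 chord[of t] chord[of "2 * pi - t"] sin_pi_minus[of "t / 2"] by (simp add: diff_divide_distrib)
      then have "a (cis t) \<le> ennreal (pi / 2 * (\<Omega> (2 * pi - t) / (2 * pi - t)))"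
        unfolding a_def using 3 half[of "2 * pi - t"] by (intro ennreal_leI) simp
      also have "\<dots> = ennreal (pi / 2) * q (2 * pi - t)" unfolding q_def using 3 \<Omega>(2) by (intro ennreal_mult) auto
      finally have "a (cis t) * 1 \<le> 0 + ennreal (pi / 2) * q (2 * pi - t)" by simp
      then show ?thesis using 3 by (auto simp: indicator_def intro: add_increasing)
    qed (auto simp: a_def)
  qed
  also have "\<dots> = ennreal (pi / 2) * J + ennreal (pi / 2) * J"
  proof -
    have "(\<integral>\<^sup>+t. q (2 * pi + -1 * t) * indicator {0<..<2 * pi} (2 * pi + -1 * t) \<partial>lborel) = J"
      unfolding J_def using nn_integral_real_affine[of "\<lambda>t. q t * indicator {0<..<2 * pi} t" "-1" "2 * pi"] by simp
    then show ?thesis by (simp add: nn_integral_add nn_integral_cmult J_def)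
  qed
  also have "\<dots> < \<infinity>" using J by (simp add: ennreal_mult_less_top)
  finally have fin: "(\<integral>\<^sup>+t. a (cis t) * indicator {0..<2 * pi} t \<partial>lborel) < \<infinity>" .
  have "(\<integral>\<^sup>+z. a z \<partial>circle) < \<infinity>"
  proof -
    have "(\<integral>\<^sup>+z. a z \<partial>circle) \<noteq> top"
      using fin a_meas[of 1] pi_gt_zero
      by (auto simp: nn_integral_circle a_def ennreal_divide_eq_top_iff)
    then show ?thesis by (simp add: less_top)
  qed
  then obtain I where I: "I \<ge> 0" "(\<integral>\<^sup>+z. a z \<partial>circle) = ennreal I"
    by (cases "\<integral>\<^sup>+z. a z \<partial>circle") auto
  show thesis
  proof (rule that[OF I(1)])
    fix w :: complex assume w: "w \<in> sphere 0 1"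
    have w': "0 \<le> Arg2pi w" "Arg2pi w \<le> 2 * pi" "cis (Arg2pi w) = w"
      using Arg2pi[of w] w by (auto simp: is_Arg_def cis_conv_exp)
    have "(\<integral>\<^sup>+z. ennreal (\<Omega> (cmod (z - w)) / cmod (z - w)) \<partial>circle)
        = (\<integral>\<^sup>+z. ennreal (\<Omega> (cmod (w * z - w)) / cmod (w * z - w)) \<partial>circle)"
      using nn_integral_rotate_circle[OF a_meas[of w] w'(1,2)] w'(3) by simp
    also have "\<dots> = (\<integral>\<^sup>+z. a z \<partial>circle)"
    proof (rule nn_integral_cong)
      show "ennreal (\<Omega> (cmod (w * z - w)) / cmod (w * z - w)) = a z" for z
        using w norm_mult[of w "z - 1"] by (simp add: a_def right_diff_distrib)
    qed
    finally show "(\<integral>\<^sup>+z. ennreal (\<Omega> (cmod (z - w)) / cmod (z - w)) \<partial>circle) \<le> ennreal I" by (simp add: I)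
  qed
qed

text \<open>
  The Cauchy integral of \<open>g\<close> at the point \<open>\<rho> w\<close> of the disk.
\<close>

lemma geometric_kernel_coeff:
  assumes g: "continuous_on (sphere 0 1) g" and \<rho>: "0 \<le> \<rho>" "\<rho> < 1" and w: "w \<in> sphere 0 1"
  shows "(\<lambda>n. (of_real \<rho> * w) ^ n * fourier_coeff g (int n)) sums
    (\<integral>z. g z / (1 - of_real \<rho> * w * inverse z) \<partial>circle)"
proof -
  obtain B where B: "\<And>z. z \<in> sphere 0 1 \<Longrightarrow> cmod (g z) \<le> B"
    using continuous_on_circle_bounded[OF g] by blast
  define x where "x z = of_real \<rho> * w * inverse z" for z
  have x: "cmod (x z) = \<rho>" if "z \<in> sphere 0 1" for z
    using that w \<rho> by (simp add: x_def norm_mult norm_inverse)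
  have cx: "continuous_on (sphere 0 1) x" unfolding x_def by (intro continuous_intros) auto
  have x1: "1 - x z \<noteq> 0" if "z \<in> sphere 0 1" for z using x[OF that] \<rho> by auto
  have tm: "(\<integral>z. g z * x z ^ n \<partial>circle) = (of_real \<rho> * w) ^ n * fourier_coeff g (int n)" for n
  proof -
    have "(\<integral>z. g z * x z ^ n \<partial>circle) = (\<integral>z. (of_real \<rho> * w) ^ n * (g z * z powi (- int n)) \<partial>circle)"
      by (simp add: x_def power_mult_distrib power_int_minus power_inverse mult_ac)
    then show ?thesis by (simp add: fourier_coeff_def)
  qed
  have i: "integrable circle (\<lambda>z. g z * x z ^ n)" for n
    by (intro integrable_ess_bounded ess_bounded_continuous continuous_intros g cx)
  have "(\<lambda>N. \<integral>z. (\<Sum>n<N. g z * x z ^ n) \<partial>circle) \<longlonglongrightarrow> (\<integral>z. g z / (1 - x z) \<partial>circle)"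
  proof (rule integral_dominated_convergence[where w = "\<lambda>_. B * (1 / (1 - \<rho>))"])
    show "(\<lambda>z. \<Sum>n<N. g z * x z ^ n) \<in> borel_measurable circle" for N
      by (intro borel_measurable_circle_continuous continuous_intros g cx)
    show "(\<lambda>z. g z / (1 - x z)) \<in> borel_measurable circle"
      by (intro borel_measurable_circle_continuous continuous_intros g cx) (use x1 in auto)
    show "AE z in circle. (\<lambda>N. \<Sum>n<N. g z * x z ^ n) \<longlonglongrightarrow> g z / (1 - x z)"
    proof (rule AE_I2)
      fix z assume "z \<in> space circle"
      then have "cmod (x z) < 1" using x \<rho> by (simp add: space_circle)
      from sums_mult[OF geometric_sums[OF this], of "g z"]
      show "(\<lambda>N. \<Sum>n<N. g z * x z ^ n) \<longlonglongrightarrow> g z / (1 - x z)" by (simp add: sums_def)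
    qed
    show "AE z in circle. norm (\<Sum>n<N. g z * x z ^ n) \<le> B * (1 / (1 - \<rho>))" for N
    proof (rule AE_I2)
      fix z assume z: "z \<in> space circle"
      have "norm (\<Sum>n<N. g z * x z ^ n) \<le> (\<Sum>n<N. cmod (g z) * \<rho> ^ n)"
        using x z by (intro sum_norm_le) (simp add: norm_mult norm_power space_circle)
      also have "\<dots> = cmod (g z) * (\<Sum>n<N. \<rho> ^ n)" by (simp add: sum_distrib_left)
      also have "(\<Sum>n<N. \<rho> ^ n) \<le> (\<Sum>n. \<rho> ^ n)" using \<rho> by (intro sum_le_suminf summable_geometric) auto
      also have "\<dots> = 1 / (1 - \<rho>)" using \<rho> by (intro suminf_geometric) auto
      finally have "norm (\<Sum>n<N. g z * x z ^ n) \<le> cmod (g z) * (1 / (1 - \<rho>))" by (simp add: mult_left_mono)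
      also have "\<dots> \<le> B * (1 / (1 - \<rho>))" using B z \<rho> by (intro mult_right_mono) (auto simp: space_circle)
      finally show "norm (\<Sum>n<N. g z * x z ^ n) \<le> B * (1 / (1 - \<rho>))" .
    qed
  qed simp
  moreover have "(\<integral>z. (\<Sum>n<N. g z * x z ^ n) \<partial>circle) = (\<Sum>n<N. (of_real \<rho> * w) ^ n * fourier_coeff g (int n))" for N
    using i by (subst Bochner_Integration.integral_sum) (auto simp: tm)
  ultimately show ?thesis by (simp add: sums_def x_def)
qed

text \<open>
  The Cauchy integrals on the circles of radius \<open>\<rho> < 1\<close> can be written as
  \<open>g w + \<integral> (g z - g w) / (1 - \<rho> w / z)\<close>. Since \<open>\<bar>z - w\<bar> \<le> 2 \<bar>z - \<rho> w\<bar>\<close>, the integrand is dominated by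
  \<open>2 \<Omega> \<bar>z - w\<bar> / \<bar>z - w\<bar>\<close>, which is integrable uniformly in \<open>w\<close>. So as \<open>\<rho>\<close> tends to 1 they stay
  bounded and converge at every point, to a bounded analytic function with the coefficients of \<open>g\<close>.
\<close>

lemma splits_analytic_dini:
  assumes g: "continuous_on (sphere 0 1) g"
    and \<Omega>: "mono \<Omega>" "\<And>t. 0 \<le> \<Omega> t"
      "\<And>z z'. z \<in> sphere 0 1 \<Longrightarrow> z' \<in> sphere 0 1 \<Longrightarrow> cmod (g z - g z') \<le> \<Omega> (cmod (z - z'))"
    and dini: "(\<integral>\<^sup>+t\<in>{0<..<1}. ennreal (\<Omega> t / t) \<partial>lborel) < \<infinity>"
  shows "splits_analytic g"
proof -
  obtain I where I: "I \<ge> 0"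
    "\<And>w. w \<in> sphere 0 1 \<Longrightarrow> (\<integral>\<^sup>+z. ennreal (\<Omega> (cmod (z - w)) / cmod (z - w)) \<partial>circle) \<le> ennreal I"
    using nn_integral_dini_kernel[OF \<Omega>(1,2) dini] by blast
  obtain B where B: "\<And>z. z \<in> sphere 0 1 \<Longrightarrow> cmod (g z) \<le> B"
    using continuous_on_circle_bounded[OF g] by blast
  have B0: "B \<ge> 0" by (rule order_trans[OF norm_ge_zero B[of 1]]) simp
  have bg: "ess_bounded g" by (rule ess_bounded_continuous[OF g])
  have coeff_g: "cmod (fourier_coeff g n) \<le> B" for n
  proof -
    have "cmod (fourier_coeff g n) \<le> (\<integral>z. cmod (g z * z powi (- n)) \<partial>circle)"
      unfolding fourier_coeff_def by (rule integral_norm_bound)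
    also have "\<dots> \<le> (\<integral>z. B \<partial>circle)"
      by (intro integral_mono integrable_norm integrable_ess_bounded ess_bounded_mult bg ess_bounded_powi)
         (use B in \<open>auto simp: norm_mult norm_circle_powi space_circle\<close>)
    also have "\<dots> = B" by (simp add: measure_def emeasure_circle)
    finally show ?thesis .
  qed
  \<comment> \<open>radii that increase to 1\<close>
  define \<rho> where "\<rho> k = 1 - 1 / (real k + 2)" for k
  have \<rho>: "0 \<le> \<rho> k" "\<rho> k < 1" for k by (auto simp: \<rho>_def field_simps)
  have \<rho>_lim: "\<rho> \<longlonglongrightarrow> 1"
  proof -
    have "(\<lambda>k. 1 / real (k + 2)) \<longlonglongrightarrow> 0" by (rule LIMSEQ_ignore_initial_segment[OF lim_1_over_n])
    then have "(\<lambda>k. 1 / (real k + 2)) \<longlonglongrightarrow> 0" by (simp add: add.commute)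
    from tendsto_diff[OF tendsto_const this, of 1] show ?thesis by (simp add: \<rho>_def[abs_def])
  qed
  define u where "u k w = (\<Sum>n. fourier_coeff g (int n) * of_real (\<rho> k) ^ n * w powi (int n))" for k w
  define D where "D k w z = (g z - g w) / (1 - of_real (\<rho> k) * w * inverse z)" for k w z
  define D' where "D' w z = (g z - g w) / (1 - w * inverse z)" for w z
  define dom where "dom w z = 2 * (\<Omega> (cmod (z - w)) / cmod (z - w))" for w z
  have dom_meas: "dom w \<in> borel_measurable circle" for w
  proof -
    have [measurable]: "\<Omega> \<in> borel_measurable borel" using \<Omega>(1) by (rule borel_measurable_mono)
    have "(\<lambda>z. z - w) \<in> borel_measurable circle" by (intro borel_measurable_circle_continuous continuous_intros)
    then show ?thesis unfolding dom_def by measurable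
  qed
  have dom0: "dom w z \<ge> 0" for w z using \<Omega>(2) by (simp add: dom_def)
  have dom_int: "integrable circle (dom w)" "(\<integral>z. dom w z \<partial>circle) \<le> 2 * I" if w: "w \<in> sphere 0 1" for w
  proof -
    have "(\<integral>\<^sup>+z. ennreal (dom w z) \<partial>circle) = ennreal 2 * (\<integral>\<^sup>+z. ennreal (\<Omega> (cmod (z - w)) / cmod (z - w)) \<partial>circle)"
    proof -
      have "(\<lambda>z. ennreal (\<Omega> (cmod (z - w)) / cmod (z - w))) = (\<lambda>z. ennreal (dom w z / 2))" by (simp add: dom_def)
      then have "(\<lambda>z. ennreal (\<Omega> (cmod (z - w)) / cmod (z - w))) \<in> borel_measurable circle"
        using dom_meas[of w] by simp
      moreover have "(\<integral>\<^sup>+z. ennreal (dom w z) \<partial>circle) = (\<integral>\<^sup>+z. ennreal 2 * ennreal (\<Omega> (cmod (z - w)) / cmod (z - w)) \<partial>circle)"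
        unfolding dom_def using \<Omega>(2) by (intro nn_integral_cong ennreal_mult) auto
      ultimately show ?thesis by (simp only: nn_integral_cmult)
    qed
    also have "\<dots> \<le> ennreal 2 * ennreal I" by (intro mult_left_mono I w) simp
    also have "\<dots> = ennreal (2 * I)" using I by (intro ennreal_mult[symmetric]) auto
    finally have le: "(\<integral>\<^sup>+z. ennreal (dom w z) \<partial>circle) \<le> ennreal (2 * I)" .
    show "integrable circle (dom w)"
      using dom_meas dom0 le by (intro integrableI_nonneg) (auto intro: le_less_trans)
    then show "(\<integral>z. dom w z \<partial>circle) \<le> 2 * I"
      using le dom0 I(1) by (subst (asm) nn_integral_eq_integral) (auto simp: ennreal_le_iff)
  qed
  have D_le: "cmod (D k w z) \<le> dom w z" if w: "w \<in> sphere 0 1" and z: "z \<in> sphere 0 1" for k w z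
  proof (cases "z = w")
    case False
    have zne: "z \<noteq> 0" using z by auto
    have "cmod (z - w) \<le> cmod (z - of_real (\<rho> k) * w) + cmod (of_real (\<rho> k) * w - w)"
      using norm_triangle_ineq[of "z - of_real (\<rho> k) * w" "of_real (\<rho> k) * w - w"] by simp
    also have "cmod (of_real (\<rho> k) * w - w) = 1 - \<rho> k"
    proof -
      have "of_real (\<rho> k) * w - w = of_real (\<rho> k - 1) * w" by (simp add: algebra_simps)
      then have "cmod (of_real (\<rho> k) * w - w) = \<bar>\<rho> k - 1\<bar> * cmod w" by (simp only: norm_mult norm_of_real)
      then show ?thesis using w \<rho>[of k] by simp
    qed
    also have "1 - \<rho> k \<le> cmod (z - of_real (\<rho> k) * w)"
      using norm_triangle_ineq2[of z "of_real (\<rho> k) * w"] z w \<rho>[of k] by (simp add: norm_mult)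
    finally have ge: "cmod (z - w) / 2 \<le> cmod (z - of_real (\<rho> k) * w)" by simp
    have "cmod (1 - of_real (\<rho> k) * w * inverse z) = cmod ((z - of_real (\<rho> k) * w) * inverse z)"
      using zne by (simp add: left_diff_distrib)
    also have "\<dots> = cmod (z - of_real (\<rho> k) * w)" using z by (simp add: norm_mult norm_inverse)
    finally have eq: "cmod (1 - of_real (\<rho> k) * w * inverse z) = cmod (z - of_real (\<rho> k) * w)" .
    have "cmod (D k w z) = cmod (g z - g w) / cmod (z - of_real (\<rho> k) * w)"
      by (simp only: D_def norm_divide eq)
    also have "\<dots> \<le> \<Omega> (cmod (z - w)) / (cmod (z - w) / 2)"
      using \<Omega>(2) \<Omega>(3)[OF z w] ge False by (intro frac_le) auto
    finally show ?thesis by (simp add: dom_def mult.commute)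
  qed (simp add: D_def dom_def)
  have ker_ne: "1 - of_real (\<rho> k) * w * inverse z \<noteq> 0" if w: "w \<in> sphere 0 1" and z: "z \<in> sphere 0 1" for k and w z :: complex
  proof
    assume "1 - of_real (\<rho> k) * w * inverse z = 0"
    then have "cmod (of_real (\<rho> k) * w * inverse z) = 1" by (metis eq_iff_diff_eq_0 norm_one)
    then show False using z w \<rho>[of k] by (simp add: norm_mult norm_inverse)
  qed
  have cD: "continuous_on (sphere 0 1) (D k w)" if w: "w \<in> sphere 0 1" for k w
    unfolding D_def using ker_ne[OF w] by (intro continuous_intros g) auto
  have u_eq: "u k w = g w + (\<integral>z. D k w z \<partial>circle)" if w: "w \<in> sphere 0 1" for k w
  proof -
    let ?K = "\<lambda>h. \<integral>z. h z / (1 - of_real (\<rho> k) * w * inverse z) \<partial>circle"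
    have 1: "u k w = ?K g"
      using sums_unique[OF geometric_kernel_coeff[OF g \<rho> w, of k]]
      by (simp add: u_def power_mult_distrib mult_ac)
    have "(\<lambda>n. (of_real (\<rho> k) * w) ^ n * fourier_coeff (\<lambda>_. g w) (int n)) sums ?K (\<lambda>_. g w)"
      by (rule geometric_kernel_coeff[OF _ \<rho> w]) (intro continuous_intros)
    moreover have "(\<lambda>n. (of_real (\<rho> k) * w) ^ n * fourier_coeff (\<lambda>_. g w) (int n)) = (\<lambda>n. if n = 0 then g w else 0)"
      by (auto simp: fourier_coeff_const)
    ultimately have 2: "?K (\<lambda>_. g w) = g w"
      using sums_unique2[OF _ sums_single[of 0 "\<lambda>_. g w"]] by simp
    have i: "integrable circle (\<lambda>z. h z / (1 - of_real (\<rho> k) * w * inverse z))" if "continuous_on (sphere 0 1) h" for h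
      by (intro integrable_ess_bounded ess_bounded_continuous continuous_intros that) (use ker_ne[OF w] in auto)
    have "(\<integral>z. D k w z \<partial>circle) = ?K g - ?K (\<lambda>_. g w)"
      unfolding D_def diff_divide_distrib by (intro Bochner_Integration.integral_diff i g continuous_on_const)
    then show ?thesis using 1 2 by simp
  qed
  have Hu: "H_infinity (u k)" for k
    unfolding u_def
  proof (rule H_infinity_suminf[where c = "\<lambda>n. B * \<rho> k ^ n"])
    show "H_infinity (\<lambda>w. fourier_coeff g (int n) * of_real (\<rho> k) ^ n * w powi int n)" for n
      by (intro H_infinity_cmult H_infinity_powi) simp
    show "summable (\<lambda>n. B * \<rho> k ^ n)" using \<rho>[of k] by (intro summable_mult summable_geometric) auto
    show "cmod (fourier_coeff g (int n) * of_real (\<rho> k) ^ n * z powi int n) \<le> B * \<rho> k ^ n" if "z \<in> sphere 0 1" for n z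
      using coeff_g[of "int n"] \<rho>[of k] that by (simp add: norm_mult norm_power mult_right_mono)
  qed
  have u_le: "cmod (u k w) \<le> B + 2 * I" if w: "w \<in> sphere 0 1" for k w
  proof -
    have "cmod (\<integral>z. D k w z \<partial>circle) \<le> (\<integral>z. cmod (D k w z) \<partial>circle)" by (rule integral_norm_bound)
    also have "\<dots> \<le> (\<integral>z. dom w z \<partial>circle)"
      by (intro integral_mono integrable_norm integrable_ess_bounded ess_bounded_continuous cD w dom_int D_le)
         (simp add: space_circle)
    finally have "cmod (\<integral>z. D k w z \<partial>circle) \<le> 2 * I" using dom_int(2)[OF w] by simp
    then show ?thesis unfolding u_eq[OF w] using B[OF w] by (intro norm_triangle_mono)
  qed
  define U where "U w = g w + (\<integral>z. D' w z \<partial>circle)" for w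
  have lim: "(\<lambda>k. u k w) \<longlonglongrightarrow> U w" if w: "w \<in> sphere 0 1" for w
  proof -
    have Dlim: "(\<lambda>k. D k w z) \<longlonglongrightarrow> D' w z" if z: "z \<in> sphere 0 1" for z
    proof (cases "z = w")
      case False
      have "z \<noteq> 0" using z by auto
      then have "1 - w * inverse z \<noteq> 0" using False by (simp add: field_simps)
      then have "(\<lambda>k. D k w z) \<longlonglongrightarrow> (g z - g w) / (1 - of_real 1 * w * inverse z)"
        unfolding D_def by (intro tendsto_intros \<rho>_lim) simp
      then show ?thesis by (simp add: D'_def)
    qed (simp add: D_def D'_def)
    have "(\<lambda>k. \<integral>z. D k w z \<partial>circle) \<longlonglongrightarrow> (\<integral>z. D' w z \<partial>circle)"
    proof (rule integral_dominated_convergence[where w = "dom w"])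
      show m: "D k w \<in> borel_measurable circle" for k by (rule borel_measurable_circle_continuous[OF cD[OF w]])
      show "D' w \<in> borel_measurable circle"
        by (rule borel_measurable_LIMSEQ_metric[OF m Dlim]) (simp add: space_circle)
      show "AE z in circle. (\<lambda>k. D k w z) \<longlonglongrightarrow> D' w z" using Dlim by (intro AE_I2) (simp add: space_circle)
      show "AE z in circle. norm (D k w z) \<le> dom w z" for k using D_le[OF w] by (intro AE_I2) (simp add: space_circle)
    qed (rule dom_int[OF w])
    from tendsto_add[OF tendsto_const this, of "g w"] show ?thesis
      by (simp add: U_def u_eq[OF w])
  qed
  have u_AE: "AE z in circle. cmod (u k z) \<le> B + 2 * I" for k
    using u_le by (intro AE_I2) (simp add: space_circle)
  have HU: "H_infinity U" by (rule H_infinity_LIMSEQ[OF Hu u_AE lim])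
  have coeff_u: "fourier_coeff (u k) (int m) = fourier_coeff g (int m) * of_real (\<rho> k) ^ m" for k m
  proof -
    define S where "S N w = (\<Sum>n<N. fourier_coeff g (int n) * of_real (\<rho> k) ^ n * w powi (int n))" for N and w :: complex
    have tm: "cmod (fourier_coeff g (int n) * of_real (\<rho> k) ^ n * z powi int n) \<le> B * \<rho> k ^ n" if "z \<in> sphere 0 1" for n z
      using coeff_g[of "int n"] \<rho>[of k] that by (simp add: norm_mult norm_power mult_right_mono)
    have sg: "summable (\<lambda>n. B * \<rho> k ^ n)" using \<rho>[of k] by (intro summable_mult summable_geometric) auto
    have bS: "ess_bounded (S N)" for N
      unfolding S_def by (rule ess_bounded_sum_powi)
    have "(\<lambda>N. fourier_coeff (S N) (int m)) \<longlonglongrightarrow> fourier_coeff (u k) (int m)"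
    proof (rule fourier_coeff_LIMSEQ[where C = "\<Sum>n. B * \<rho> k ^ n", OF bS])
      show "AE z in circle. cmod (S N z) \<le> (\<Sum>n. B * \<rho> k ^ n)" for N
      proof (rule AE_I2)
        fix z assume "z \<in> space circle"
        then have "cmod (S N z) \<le> (\<Sum>n<N. B * \<rho> k ^ n)"
          unfolding S_def using tm by (intro sum_norm_le) (simp add: space_circle)
        also have "\<dots> \<le> (\<Sum>n. B * \<rho> k ^ n)" using sg B0 \<rho>[of k] by (intro sum_le_suminf) auto
        finally show "cmod (S N z) \<le> (\<Sum>n. B * \<rho> k ^ n)" .
      qed
      show "u k \<in> borel_measurable circle" using H_infinityD(1)[OF Hu[of k]] by (simp add: ess_bounded_def)
      show "(\<lambda>N. S N z) \<longlonglongrightarrow> u k z" if "z \<in> sphere 0 1" for z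
        unfolding S_def u_def by (intro summable_LIMSEQ summable_comparison_test'[OF sg, of 0] tm that)
    qed
    moreover have "fourier_coeff (S N) (int m) = (\<Sum>n<N. if n = m then fourier_coeff g (int n) * of_real (\<rho> k) ^ n else 0)" for N
      unfolding S_def by (simp only: fourier_coeff_sum_powi of_nat_eq_iff)
    then have "fourier_coeff (S N) (int m) = fourier_coeff g (int m) * of_real (\<rho> k) ^ m" if "N \<ge> Suc m" for N
      using that by (simp add: sum.delta)
    then have "(\<lambda>N. fourier_coeff (S N) (int m)) \<longlonglongrightarrow> fourier_coeff g (int m) * of_real (\<rho> k) ^ m"
      by (intro tendsto_eventually eventually_sequentiallyI)
    ultimately show ?thesis by (rule LIMSEQ_unique)
  qed
  have coeff_U: "fourier_coeff U (int m) = fourier_coeff g (int m)" for m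
  proof (rule LIMSEQ_unique)
    show "(\<lambda>k. fourier_coeff (u k) (int m)) \<longlonglongrightarrow> fourier_coeff U (int m)"
      by (rule fourier_coeff_LIMSEQ[OF H_infinityD(1)[OF Hu] u_AE _ lim])
         (use H_infinityD(1)[OF HU] in \<open>auto simp: ess_bounded_def\<close>)
    have "(\<lambda>k. fourier_coeff g (int m) * of_real (\<rho> k) ^ m) \<longlonglongrightarrow> fourier_coeff g (int m) * of_real 1 ^ m"
      by (intro tendsto_intros \<rho>_lim)
    then show "(\<lambda>k. fourier_coeff (u k) (int m)) \<longlonglongrightarrow> fourier_coeff g (int m)" by (simp add: coeff_u)
  qed
  define v where "v z = g z + -1 * U z" for z
  have bv: "ess_bounded v" unfolding v_def
    by (intro ess_bounded_add ess_bounded_mult ess_bounded_const bg H_infinityD(1)[OF HU])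
  have "H_infinity (\<lambda>z. cnj (v z))"
    unfolding H_infinity_def
  proof (intro conjI allI impI ess_bounded_cnj bv)
    fix n :: int assume "n < 0"
    then obtain m where m: "- n = int m" by (metis nonneg_int_cases neg_0_le_iff_le less_imp_le)
    have "fourier_coeff v (- n) = 0"
      unfolding v_def m
      by (simp only: fourier_coeff_add[OF bg ess_bounded_mult[OF ess_bounded_const H_infinityD(1)[OF HU]]]
          fourier_coeff_cmult coeff_U) simp
    then show "fourier_coeff (\<lambda>z. cnj (v z)) n = 0" by (simp add: fourier_coeff_cnj)
  qed
  then show ?thesis
    unfolding splits_analytic_def using HU
    by (intro exI[of _ U] exI[of _ v]) (simp add: v_def)
qed

lemma modulus_of_continuity:
  assumes F: "continuous_on (sphere 0 1) F"
  shows modulus_of_continuity_ge: "\<lbrakk>z \<in> sphere 0 1; z' \<in> sphere 0 1; cmod (z - z') \<le> t\<rbrakk>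
      \<Longrightarrow> cmod (F z - F z') \<le> modulus_of_continuity F t"
    and modulus_of_continuity_nonneg: "0 \<le> t \<Longrightarrow> 0 \<le> modulus_of_continuity F t"
    and modulus_of_continuity_mono: "0 \<le> s \<Longrightarrow> s \<le> t \<Longrightarrow> modulus_of_continuity F s \<le> modulus_of_continuity F t"
proof -
  let ?S = "\<lambda>t. {cmod (F z - F z') | z z'. z \<in> sphere 0 1 \<and> z' \<in> sphere 0 1 \<and> cmod (z - z') \<le> t}"
  obtain B where B: "\<And>z. z \<in> sphere 0 1 \<Longrightarrow> cmod (F z) \<le> B"
    using continuous_on_circle_bounded[OF F] by blast
  have bdd: "bdd_above (?S t)" for t
  proof (rule bdd_aboveI)
    fix x assume "x \<in> ?S t"
    then obtain z z' where "x = cmod (F z - F z')" "z \<in> sphere 0 1" "z' \<in> sphere 0 1" by blast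
    then show "x \<le> B + B" using norm_triangle_ineq4[of "F z" "F z'"] B[of z] B[of z'] by linarith
  qed
  show ge: "cmod (F z - F z') \<le> modulus_of_continuity F t"
    if "z \<in> sphere 0 1" "z' \<in> sphere 0 1" "cmod (z - z') \<le> t" for z z' t
    unfolding modulus_of_continuity_def using that by (intro cSup_upper bdd) blast
  show "0 \<le> modulus_of_continuity F t" if "0 \<le> t" for t using ge[of 1 1 t] that by simp
  show "modulus_of_continuity F s \<le> modulus_of_continuity F t" if "0 \<le> s" "s \<le> t" for s t
    unfolding modulus_of_continuity_def
  proof (rule cSup_subset_mono[OF _ bdd])
    have "cmod (F 1 - F 1) \<in> ?S s" using that by fastforce
    then show "?S s \<noteq> {}" by blast
    show "?S s \<subseteq> ?S t" using that by (blast intro: order_trans)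
  qed
qed

text \<open>
  The logarithm \<open>g\<close> inherits the modulus of continuity of \<open>F\<close> up to a factor \<open>2 / r\<close> at small
  distances, where differences of \<open>g\<close> are principal logarithms. At distances above \<open>\<delta>\<close> a multiple of
  the distance bounds them, and that is harmless for the Dini integral.
\<close>

lemma splits_analytic_log_dini:
  assumes F: "F \<in> dini_algebra" and r: "0 < r" "\<And>z. z \<in> sphere 0 1 \<Longrightarrow> r \<le> cmod (F z - a)"
    and g: "continuous_on (sphere 0 1) g" "\<And>z. z \<in> sphere 0 1 \<Longrightarrow> F z - a = exp (g z)"
  shows "splits_analytic g"
proof -
  have cF: "continuous_on (sphere 0 1) F"
    and dini: "(\<integral>\<^sup>+t\<in>{0<..<1}. ennreal (modulus_of_continuity F t / t) \<partial>lborel) < \<infinity>"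
    using F by (auto simp: dini_algebra_def)
  obtain B where B: "\<And>z. z \<in> sphere 0 1 \<Longrightarrow> cmod (g z) \<le> B"
    using continuous_on_circle_bounded[OF g(1)] by blast
  have B0: "B \<ge> 0" by (rule order_trans[OF norm_ge_zero B[of 1]]) simp
  have "uniformly_continuous_on (sphere 0 1) g" "uniformly_continuous_on (sphere 0 1) F"
    using g cF by (auto intro: compact_uniformly_continuous)
  then obtain d1 d2 where d1: "d1 > 0" "\<And>z z'. z \<in> sphere 0 1 \<Longrightarrow> z' \<in> sphere 0 1 \<Longrightarrow> dist z z' < d1 \<Longrightarrow> dist (g z) (g z') < 1"
    and d2: "d2 > 0" "\<And>z z'. z \<in> sphere 0 1 \<Longrightarrow> z' \<in> sphere 0 1 \<Longrightarrow> dist z z' < d2 \<Longrightarrow> dist (F z) (F z') < r / 2"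
    unfolding uniformly_continuous_on_def using r(1) by (metis half_gt_zero zero_less_one)
  define \<delta> where "\<delta> = min d1 d2"
  have "\<delta> > 0" using d1 d2 by (simp add: \<delta>_def)
  \<comment> \<open>The truncation \<open>max t 0\<close> makes this monotone on the whole line: for \<open>t < 0\<close> the modulus of
    continuity would be the supremum of the empty set.\<close>
  define \<Omega> where "\<Omega> t = 2 / r * modulus_of_continuity F (max t 0) + 2 * B / \<delta> * max t 0" for t
  have \<Omega>0: "0 \<le> \<Omega> t" for t
    unfolding \<Omega>_def using r(1) B0 \<open>\<delta> > 0\<close> modulus_of_continuity_nonneg[OF cF, of "max t 0"] by simp
  have "mono \<Omega>"
  proof (rule monoI)
    fix s t :: real assume "s \<le> t"
    then have "max s 0 \<le> max t 0" by simp
    then show "\<Omega> s \<le> \<Omega> t"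
      unfolding \<Omega>_def using r(1) B0 \<open>\<delta> > 0\<close>
      by (intro add_mono mult_left_mono modulus_of_continuity_mono[OF cF]) auto
  qed
  moreover have "cmod (g z - g z') \<le> \<Omega> (cmod (z - z'))" if z: "z \<in> sphere 0 1" and z': "z' \<in> sphere 0 1" for z z'
  proof (cases "cmod (z - z') < \<delta>")
    case True
    define y where "y = (F z - F z') / (F z' - a)"
    have ne: "F z' - a \<noteq> 0" using less_le_trans[OF r(1) r(2)[OF z']] by (simp only: zero_less_norm_iff not_False_eq_True)
    have Fd: "cmod (F z - F z') < r / 2" and gd: "cmod (g z - g z') < 1"
      using d1(2)[OF z z'] d2(2)[OF z z'] True by (auto simp: \<delta>_def dist_norm)
    have y_le: "cmod y \<le> cmod (F z - F z') / r"
      unfolding y_def norm_divide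
      by (rule divide_left_mono[OF r(2)[OF z'] norm_ge_zero]) (use ne r(1) in simp)
    also have "\<dots> < 1 / 2" using Fd r(1) by (simp add: field_simps)
    finally have y2: "cmod y < 1 / 2" .
    have "exp (g z - g z') = (F z - a) / (F z' - a)" using g(2) z z' by (simp add: exp_diff)
    also have "\<dots> = 1 + y" using ne by (simp add: y_def field_simps)
    finally have e: "exp (g z - g z') = 1 + y" .
    have "\<bar>Im (g z - g z')\<bar> < pi" using gd abs_Im_le_cmod[of "g z - g z'"] pi_gt3 by linarith
    then have "Ln (exp (g z - g z')) = g z - g z'" by (intro Ln_exp) auto
    then have "cmod (g z - g z') = cmod (Ln (1 + y))" by (simp only: e)
    also have "\<dots> \<le> 2 * cmod y" by (rule norm_Ln_le[OF y2])
    also have "\<dots> \<le> 2 / r * cmod (F z - F z')" using y_le by simp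
    also have "\<dots> \<le> 2 / r * modulus_of_continuity F (max (cmod (z - z')) 0)"
      using r(1) modulus_of_continuity_ge[OF cF z z'] by (intro mult_left_mono) auto
    also have "\<dots> \<le> \<Omega> (cmod (z - z'))" unfolding \<Omega>_def using B0 \<open>\<delta> > 0\<close> by simp
    finally show ?thesis .
  next
    case False
    have "cmod (g z - g z') \<le> 2 * B" using norm_triangle_ineq4[of "g z" "g z'"] B[OF z] B[OF z'] by linarith
    also have "\<dots> = 2 * B / \<delta> * \<delta>" using \<open>\<delta> > 0\<close> by simp
    also have "\<dots> \<le> 2 * B / \<delta> * max (cmod (z - z')) 0" using False B0 \<open>\<delta> > 0\<close> by (intro mult_left_mono) auto
    also have "\<dots> \<le> \<Omega> (cmod (z - z'))"
      unfolding \<Omega>_def using r(1) modulus_of_continuity_nonneg[OF cF, of "max (cmod (z - z')) 0"] by simp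
    finally show ?thesis .
  qed
  moreover have "(\<integral>\<^sup>+t\<in>{0<..<1}. ennreal (\<Omega> t / t) \<partial>lborel) < \<infinity>"
  proof -
    let ?m = "\<lambda>t. modulus_of_continuity F (max t 0)"
    have [measurable]: "?m \<in> borel_measurable borel"
      by (rule borel_measurable_mono) (auto intro!: monoI modulus_of_continuity_mono[OF cF])
    have "(\<integral>\<^sup>+t\<in>{0<..<1}. ennreal (\<Omega> t / t) \<partial>lborel)
        = (\<integral>\<^sup>+t. ennreal (2 / r) * (ennreal (?m t / t) * indicator {0<..<1} t) + ennreal (2 * B / \<delta>) * indicator {0<..<1} t \<partial>lborel)"
    proof (rule nn_integral_cong)
      fix t :: real
      show "ennreal (\<Omega> t / t) * indicator {0<..<1} t
          = ennreal (2 / r) * (ennreal (?m t / t) * indicator {0<..<1} t) + ennreal (2 * B / \<delta>) * indicator {0<..<1} t"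
      proof (cases "t \<in> {0<..<1}")
        case True
        have "\<Omega> t / t = 2 / r * (?m t / t) + 2 * B / \<delta>" using True by (simp add: \<Omega>_def add_divide_distrib)
        also have "ennreal \<dots> = ennreal (2 / r) * ennreal (?m t / t) + ennreal (2 * B / \<delta>)"
          using True r(1) B0 \<open>\<delta> > 0\<close> modulus_of_continuity_nonneg[OF cF, of t]
          by (simp add: ennreal_plus ennreal_mult[symmetric] del: ennreal_plus[symmetric])
        finally show ?thesis using True by simp
      qed simp
    qed
    also have "\<dots> = ennreal (2 / r) * (\<integral>\<^sup>+t\<in>{0<..<1}. ennreal (?m t / t) \<partial>lborel) + ennreal (2 * B / \<delta>) * 1"
      by (subst nn_integral_add) (simp_all add: nn_integral_cmult)
    also have "(\<integral>\<^sup>+t\<in>{0<..<1}. ennreal (?m t / t) \<partial>lborel) = (\<integral>\<^sup>+t\<in>{0<..<1}. ennreal (modulus_of_continuity F t / t) \<partial>lborel)"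
      by (intro nn_integral_cong) (auto simp: indicator_def)
    finally show ?thesis using dini by (simp add: ennreal_mult_less_top)
  qed
  ultimately show ?thesis using splits_analytic_dini[OF g(1), of \<Omega>] \<Omega>0 by blast
qed

section \<open>A nilpotent semigroup on the Hardy space\<close>

definition arc_from :: "real \<Rightarrow> complex set"
  where "arc_from t = cis ` {t..<2 * pi}"

lemma sets_arc_from: "arc_from t \<in> sets circle"
proof -
  have "{t..<2 * pi} = (\<Union>n. {t..2 * pi - 1 / real (Suc n)})"
  proof (intro equalityI subsetI)
    fix x assume x: "x \<in> {t..<2 * pi}"
    then have "0 < 2 * pi - x" by simp
    then obtain n where "1 / real (Suc n) < 2 * pi - x" using nat_approx_posE by blast
    then show "x \<in> (\<Union>n. {t..2 * pi - 1 / real (Suc n)})" using x by (auto intro!: exI[of _ n])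
  next
    fix x assume "x \<in> (\<Union>n. {t..2 * pi - 1 / real (Suc n)})"
    then obtain n where "t \<le> x" "x \<le> 2 * pi - 1 / real (Suc n)" by auto
    moreover have "1 / real (Suc n) > 0" by simp
    ultimately have "t \<le> x" "x < 2 * pi" by linarith+
    then show "x \<in> {t..<2 * pi}" by simp
  qed
  then have eq: "arc_from t = (\<Union>n. cis ` {t..2 * pi - 1 / real (Suc n)})"
    by (simp only: arc_from_def image_UN)
  have "compact (cis ` {t..2 * pi - 1 / real (Suc n)})" for n
    by (intro compact_continuous_image continuous_intros) auto
  then have "cis ` {t..2 * pi - 1 / real (Suc n)} \<in> sets borel" for n
    by (intro borel_closed compact_imp_closed)
  then have "arc_from t \<in> sets borel" unfolding eq by (intro sets.countable_UN) auto
  moreover have "arc_from t \<subseteq> sphere 0 1" by (auto simp: arc_from_def)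
  ultimately show ?thesis
    by (auto simp: sets_circle sets_restrict_space intro!: image_eqI[of _ _ "arc_from t"])
qed

lemma cis_in_arc_from_iff:
  assumes "0 \<le> \<theta>" "\<theta> < 2 * pi" "0 \<le> t"
  shows "cis \<theta> \<in> arc_from t \<longleftrightarrow> t \<le> \<theta>"
proof
  assume "cis \<theta> \<in> arc_from t"
  then obtain s where s: "t \<le> s" "s < 2 * pi" "cis \<theta> = cis s" by (auto simp: arc_from_def)
  have "Arg2pi (cis \<theta>) = \<theta>" "Arg2pi (cis s) = s"
    using assms s by (auto intro!: Arg2pi_unique[of 1] simp: cis_conv_exp)
  then have "\<theta> = s" unfolding s(3) by (rule trans[OF sym])
  then show "t \<le> \<theta>" using s(1) by (simp only:)
qed (use assms in \<open>auto simp: arc_from_def\<close>)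

lemma circle_cisE:
  assumes "z \<in> sphere 0 1"
  obtains \<theta> where "0 \<le> \<theta>" "\<theta> < 2 * pi" "z = cis \<theta>"
  using Arg2pi[of z] assms by (intro that[of "Arg2pi z"]) (auto simp: is_Arg_def cis_conv_exp)

lemma nn_integral_rotate_circle':
  assumes h: "h \<in> borel_measurable circle"
  shows "(\<integral>\<^sup>+z. h (cis s * z) \<partial>circle) = (\<integral>\<^sup>+z. h z \<partial>circle)"
proof -
  obtain \<theta> where "0 \<le> \<theta>" "\<theta> < 2 * pi" "cis s = cis \<theta>"
    using circle_cisE[of "cis s"] by auto
  then show ?thesis using nn_integral_rotate_circle[OF h, of \<theta>] by simp
qed

text \<open>
  Translation by \<open>t\<close> on the interval from 0 to \<open>2\<pi>\<close>, where whatever leaves the interval is lost. At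
  \<open>t = 2\<pi>\<close> nothing is left.
\<close>

definition truncated_rotation :: "real \<Rightarrow> (complex \<Rightarrow> complex) \<Rightarrow> complex \<Rightarrow> complex"
  where "truncated_rotation t f z = (if z \<in> arc_from t then f (cis (- t) * z) else 0)"

lemma measurable_truncated_rotation:
  assumes "f \<in> borel_measurable circle"
  shows "truncated_rotation t f \<in> borel_measurable circle"
proof -
  have "(\<lambda>z. f (cis (- t) * z)) \<in> borel_measurable circle"
    by (rule measurable_compose[OF measurable_rotate_circle assms])
  then show ?thesis
    unfolding truncated_rotation_def using sets_arc_from by (intro measurable_If_set) auto
qed

lemma nn_integral_truncated_rotation_le:
  assumes "f \<in> borel_measurable circle"
  shows "(\<integral>\<^sup>+z. ennreal ((cmod (truncated_rotation t f z))\<^sup>2) \<partial>circle) \<le> (\<integral>\<^sup>+z. ennreal ((cmod (f z))\<^sup>2) \<partial>circle)"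
proof -
  have "(\<integral>\<^sup>+z. ennreal ((cmod (truncated_rotation t f z))\<^sup>2) \<partial>circle) \<le> (\<integral>\<^sup>+z. ennreal ((cmod (f (cis (- t) * z)))\<^sup>2) \<partial>circle)"
    by (intro nn_integral_mono) (simp add: truncated_rotation_def)
  also have "\<dots> = (\<integral>\<^sup>+z. ennreal ((cmod (f z))\<^sup>2) \<partial>circle)"
  proof (rule nn_integral_rotate_circle'[where h = "\<lambda>z. ennreal ((cmod (f z))\<^sup>2)"])
    have [measurable]: "f \<in> borel_measurable circle" by fact
    show "(\<lambda>z. ennreal ((cmod (f z))\<^sup>2)) \<in> borel_measurable circle" by measurable
  qed
  finally show ?thesis .
qed

lemma square_integrable_truncated_rotation:
  assumes f: "square_integrable f"
  shows "square_integrable (truncated_rotation t f)"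
proof -
  have [measurable]: "f \<in> borel_measurable circle" using f by (simp add: square_integrable_def)
  have m [measurable]: "truncated_rotation t f \<in> borel_measurable circle"
    by (rule measurable_truncated_rotation) measurable
  have "(\<integral>\<^sup>+z. ennreal ((cmod (f z))\<^sup>2) \<partial>circle) < \<infinity>"
    using f by (simp add: square_integrable_def integrable_iff_bounded)
  with nn_integral_truncated_rotation_le[of f t]
  have "(\<integral>\<^sup>+z. ennreal ((cmod (truncated_rotation t f z))\<^sup>2) \<partial>circle) < \<infinity>"
    by (auto intro: le_less_trans)
  then show ?thesis by (simp add: square_integrable_def integrable_iff_bounded m)
qed

lemma truncated_rotation_diff:
  "truncated_rotation t f z - truncated_rotation t g z = truncated_rotation t (\<lambda>z. f z - g z) z"
  by (simp add: truncated_rotation_def)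

lift_definition truncated_rotation_L2 :: "real \<Rightarrow> circle_L2 \<Rightarrow> circle_L2" is truncated_rotation
proof (elim conjE, intro conjI square_integrable_truncated_rotation)
  fix t f g
  assume fg: "square_integrable f" "square_integrable g" "AE z in circle. f z = g z"
  define h where "h z = f z - g z" for z
  have [measurable]: "h \<in> borel_measurable circle"
    unfolding h_def using fg by (intro borel_measurable_diff) (simp_all add: square_integrable_def)
  have "AE z in circle. ennreal ((cmod (h z))\<^sup>2) = 0" using fg(3) by eventually_elim (simp add: h_def)
  then have "(\<integral>\<^sup>+z. ennreal ((cmod (h z))\<^sup>2) \<partial>circle) = 0" by (subst nn_integral_0_iff_AE) measurable
  then have "(\<integral>\<^sup>+z. ennreal ((cmod (truncated_rotation t h z))\<^sup>2) \<partial>circle) = 0"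
    using nn_integral_truncated_rotation_le[of h t] by simp
  moreover have [measurable]: "truncated_rotation t h \<in> borel_measurable circle"
    by (rule measurable_truncated_rotation) measurable
  ultimately have "AE z in circle. ennreal ((cmod (truncated_rotation t h z))\<^sup>2) = 0"
    by (subst (asm) nn_integral_0_iff_AE) measurable
  then show "AE z in circle. truncated_rotation t f z = truncated_rotation t g z"
    by eventually_elim (simp add: h_def[abs_def] flip: truncated_rotation_diff)
qed

lemma truncated_rotation_L2_abs:
  "square_integrable f \<Longrightarrow> truncated_rotation_L2 t (abs_circle_L2 f) = abs_circle_L2 (truncated_rotation t f)"
  by (simp add: truncated_rotation_L2.abs_eq)

lemma norm_truncated_rotation_L2: "norm (truncated_rotation_L2 t f) \<le> norm f"
proof -
  obtain u where u: "square_integrable u" "f = abs_circle_L2 u" by (rule abs_circle_L2_cases)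
  have tu: "square_integrable (truncated_rotation t u)" by (rule square_integrable_truncated_rotation[OF u(1)])
  have "(\<integral>\<^sup>+z. ennreal ((cmod (truncated_rotation t u z))\<^sup>2) \<partial>circle) \<le> (\<integral>\<^sup>+z. ennreal ((cmod (u z))\<^sup>2) \<partial>circle)"
    using u(1) by (intro nn_integral_truncated_rotation_le) (simp add: square_integrable_def)
  then have "ennreal (\<integral>z. (cmod (truncated_rotation t u z))\<^sup>2 \<partial>circle) \<le> ennreal (\<integral>z. (cmod (u z))\<^sup>2 \<partial>circle)"
    using u(1) tu by (simp add: nn_integral_eq_integral square_integrable_def)
  then have "(\<integral>z. (cmod (truncated_rotation t u z))\<^sup>2 \<partial>circle) \<le> (\<integral>z. (cmod (u z))\<^sup>2 \<partial>circle)"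
    by (simp add: ennreal_le_iff)
  then show ?thesis using u tu by (simp add: truncated_rotation_L2_abs norm_circle_L2_abs)
qed

lemma truncated_rotation_L2_add: "truncated_rotation_L2 t (f + g) = truncated_rotation_L2 t f + truncated_rotation_L2 t g"
proof -
  obtain u v where "square_integrable u" "f = abs_circle_L2 u" "square_integrable v" "g = abs_circle_L2 v"
    by (metis abs_circle_L2_cases)
  moreover have "truncated_rotation t (\<lambda>z. u z + v z) = (\<lambda>z. truncated_rotation t u z + truncated_rotation t v z)" for u v
    by (simp add: truncated_rotation_def fun_eq_iff)
  ultimately show ?thesis
    by (simp add: truncated_rotation_L2_abs plus_circle_L2.abs_eq square_integrable_add square_integrable_truncated_rotation)
qed

lemma truncated_rotation_L2_scaleC: "truncated_rotation_L2 t (c *\<^sub>C f) = c *\<^sub>C truncated_rotation_L2 t f"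
proof -
  obtain u where "square_integrable u" "f = abs_circle_L2 u" by (rule abs_circle_L2_cases)
  moreover have "truncated_rotation t (\<lambda>z. c * u z) = (\<lambda>z. c * truncated_rotation t u z)" for u
    by (simp add: truncated_rotation_def fun_eq_iff)
  ultimately show ?thesis
    by (simp add: truncated_rotation_L2_abs scaleC_circle_L2.abs_eq square_integrable_cmult square_integrable_truncated_rotation)
qed

lemma bounded_clinear_truncated_rotation_L2: "bounded_clinear (truncated_rotation_L2 t)"
  unfolding bounded_clinear_def
  by (auto intro!: bounded_linear_intro[where K = 1]
      simp: truncated_rotation_L2_add truncated_rotation_L2_scaleC scaleR_eq_scaleC norm_truncated_rotation_L2)

lemma truncated_rotation_L2_semigroup:
  assumes "0 \<le> s" "0 \<le> t"
  shows "truncated_rotation_L2 t (truncated_rotation_L2 s f) = truncated_rotation_L2 (t + s) f"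
proof -
  obtain u where u: "square_integrable u" "f = abs_circle_L2 u" by (rule abs_circle_L2_cases)
  have "truncated_rotation t (truncated_rotation s u) z = truncated_rotation (t + s) u z" if z: "z \<in> sphere 0 1" for z
  proof -
    obtain \<theta> where \<theta>: "0 \<le> \<theta>" "\<theta> < 2 * pi" "z = cis \<theta>" using circle_cisE[OF z] .
    have m: "z \<in> arc_from t \<and> cis (- t) * z \<in> arc_from s \<longleftrightarrow> z \<in> arc_from (t + s)"
      using \<theta> assms cis_in_arc_from_iff[of \<theta> t] cis_in_arc_from_iff[of \<theta> "t + s"] cis_in_arc_from_iff[of "\<theta> - t" s]
      by (cases "t \<le> \<theta>") (auto simp: cis_mult)
    have e: "cis (- s) * (cis (- t) * z) = cis (- (t + s)) * z" by (simp add: cis_mult mult.assoc[symmetric] add.commute)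
    have "truncated_rotation t (truncated_rotation s u) z
        = (if z \<in> arc_from t \<and> cis (- t) * z \<in> arc_from s then u (cis (- s) * (cis (- t) * z)) else 0)"
      by (simp add: truncated_rotation_def)
    then show ?thesis by (simp only: m e truncated_rotation_def)
  qed
  then have "AE z in circle. truncated_rotation t (truncated_rotation s u) z = truncated_rotation (t + s) u z"
    by (intro AE_I2) (simp only: space_circle)
  then show ?thesis
    using u by (simp add: truncated_rotation_L2_abs square_integrable_truncated_rotation abs_circle_L2_eq_iff)
qed

lemma truncated_rotation_L2_nilpotent: "truncated_rotation_L2 (2 * pi) f = 0"
proof -
  obtain u where u: "square_integrable u" "f = abs_circle_L2 u" by (rule abs_circle_L2_cases)
  have "truncated_rotation (2 * pi) u = (\<lambda>_. 0)" by (simp add: truncated_rotation_def arc_from_def fun_eq_iff)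
  then show ?thesis using u by (simp add: truncated_rotation_L2_abs zero_circle_L2_def)
qed

lemma measure_circle_minus_arc_from:
  assumes "0 \<le> t" "t \<le> 2 * pi"
  shows "(\<integral>z. indicator (- arc_from t) z \<partial>circle) = t / (2 * pi)"
proof -
  have S: "space circle - arc_from t \<in> sets circle" using sets_arc_from by auto
  have m: "indicator (space circle - arc_from t) \<in> borel_measurable circle" using S by measurable
  have "emeasure circle (space circle - arc_from t) = (\<integral>\<^sup>+z. indicator (space circle - arc_from t) z \<partial>circle)"
    using S by simp
  also have "\<dots> = (\<integral>\<^sup>+\<theta>. indicator (space circle - arc_from t) (cis \<theta>) * indicator {0..<2 * pi} \<theta> \<partial>lborel) / ennreal (2 * pi)"
    by (rule nn_integral_circle) (use S in measurable)
  also have "(\<integral>\<^sup>+\<theta>. indicator (space circle - arc_from t) (cis \<theta>) * indicator {0..<2 * pi} \<theta> \<partial>lborel)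
      = (\<integral>\<^sup>+\<theta>. indicator {0..<t} \<theta> \<partial>lborel)"
    using assms by (intro nn_integral_cong) (auto simp: indicator_def space_circle cis_in_arc_from_iff)
  also have "\<dots> = ennreal t" using assms by simp
  also have "ennreal t / ennreal (2 * pi) = ennreal (t / (2 * pi))" using assms by (simp add: divide_ennreal)
  finally have "measure circle (space circle - arc_from t) = t / (2 * pi)" using assms by (simp add: measure_def)
  moreover have "- arc_from t \<inter> space circle = space circle - arc_from t" by auto
  ultimately show ?thesis by simp
qed

text \<open>
  On the arc a power of \<open>z\<close> is only multiplied by a unimodular constant, and the rest of the circle has
  length proportional to \<open>t\<close>.
\<close>

lemma truncated_rotation_L2_powi:
  assumes "0 \<le> t" "t \<le> 2 * pi"
  shows "(norm (truncated_rotation_L2 t (powi_L2 k) - powi_L2 k))\<^sup>2 \<le> (cmod (cis (- (of_int k * t)) - 1))\<^sup>2 + t / (2 * pi)"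
proof -
  let ?d = "\<lambda>z. truncated_rotation t (\<lambda>z. z powi k) z - z powi k"
  have sq: "square_integrable (\<lambda>z. z powi k)" "square_integrable (truncated_rotation t (\<lambda>z. z powi k))"
    by (intro square_integrable_truncated_rotation square_integrable_powi)+
  have sqd: "square_integrable ?d"
    using square_integrable_add[OF sq(2) square_integrable_cmult[OF sq(1), of "-1"]] by simp
  have "truncated_rotation_L2 t (powi_L2 k) - powi_L2 k = abs_circle_L2 ?d"
    using sq by (simp add: powi_L2.abs_eq powi_L2_def truncated_rotation_L2_abs diff_circle_L2_abs)
  then have "(norm (truncated_rotation_L2 t (powi_L2 k) - powi_L2 k))\<^sup>2 = (\<integral>z. (cmod (?d z))\<^sup>2 \<partial>circle)"
    using sqd by (simp add: norm_circle_L2_abs)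
  also have "\<dots> \<le> (\<integral>z. (cmod (cis (- (of_int k * t)) - 1))\<^sup>2 + indicator (- arc_from t) z \<partial>circle)"
  proof (rule integral_mono)
    show "integrable circle (\<lambda>z. (cmod (?d z))\<^sup>2)" using sqd by (simp add: square_integrable_def)
    have S: "space circle - arc_from t \<in> sets circle" using sets_arc_from by auto
    have "integrable circle (indicator (space circle - arc_from t) :: complex \<Rightarrow> real)"
      using S by (simp add: integrable_indicator_iff less_top[symmetric])
    then have "integrable circle (indicator (- arc_from t) :: complex \<Rightarrow> real)"
      by (rule iffD1[OF Bochner_Integration.integrable_cong, rotated 2]) (auto simp: indicator_def)
    then show "integrable circle (\<lambda>z. (cmod (cis (- (of_int k * t)) - 1))\<^sup>2 + indicator (- arc_from t) z)" by simp
    fix z assume "z \<in> space circle"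
    then have z: "cmod z = 1" by (simp add: space_circle)
    show "(cmod (?d z))\<^sup>2 \<le> (cmod (cis (- (of_int k * t)) - 1))\<^sup>2 + indicator (- arc_from t) z"
    proof (cases "z \<in> arc_from t")
      case True
      have "?d z = (cis (- (of_int k * t)) - 1) * z powi k"
        using True by (simp add: truncated_rotation_def power_int_mult_distrib cis_power_int left_diff_distrib)
      then have "cmod (?d z) = cmod (cis (- (of_int k * t)) - 1)" using z by (simp add: norm_mult norm_power_int)
      then show ?thesis using True by simp
    next
      case False
      then show ?thesis using z by (simp add: truncated_rotation_def norm_power_int)
    qed
  qed
  also have "\<dots> = (cmod (cis (- (of_int k * t)) - 1))\<^sup>2 + t / (2 * pi)"
  proof -
    have S: "space circle - arc_from t \<in> sets circle" using sets_arc_from by auto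
    have "integrable circle (indicator (space circle - arc_from t) :: complex \<Rightarrow> real)"
      using S by (simp add: integrable_indicator_iff less_top[symmetric])
    then have "integrable circle (indicator (- arc_from t) :: complex \<Rightarrow> real)"
      by (rule iffD1[OF Bochner_Integration.integrable_cong, rotated 2]) (auto simp: indicator_def)
    then have "(\<integral>z. c + indicator (- arc_from t) z \<partial>circle) = (\<integral>z. c \<partial>circle) + (\<integral>z. indicator (- arc_from t) z \<partial>circle)" for c :: real
      by (intro Bochner_Integration.integral_add) auto
    moreover have "(\<integral>z. c \<partial>circle) = c" for c :: real by (simp add: measure_def emeasure_circle)
    ultimately show ?thesis by (simp only: measure_circle_minus_arc_from[OF assms])
  qed
  finally show ?thesis .
qed

text \<open>
  Strong continuity holds on powers of \<open>z\<close>, hence on trigonometric polynomials, and extends to their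
  closure because the operators are contractions.
\<close>

lemma c0_semigroup_truncated_rotation: "c0_semigroup (\<lambda>t. truncated_rotation_L2 (2 * pi * t))"
  unfolding c0_semigroup_def
proof (intro conjI allI impI)
  show "bounded_clinear (truncated_rotation_L2 (2 * pi * t))" for t by (rule bounded_clinear_truncated_rotation_L2)
  show "truncated_rotation_L2 (2 * pi * t) \<circ> truncated_rotation_L2 (2 * pi * s) = truncated_rotation_L2 (2 * pi * (t + s))"
    if "t > 0" "s > 0" for t s
    using that by (auto simp: fun_eq_iff truncated_rotation_L2_semigroup distrib_left)
  let ?T = "\<lambda>t. truncated_rotation_L2 (2 * pi * t)"
  define S where "S = {x. ((\<lambda>t. norm (?T t x - x)) \<longlongrightarrow> 0) (at_right 0)}"
  have S_add: "x + y \<in> S" if "x \<in> S" "y \<in> S" for x y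
  proof -
    have "((\<lambda>t. norm (?T t x - x) + norm (?T t y - y)) \<longlongrightarrow> 0 + 0) (at_right 0)"
      using that unfolding S_def by (intro tendsto_add) auto
    moreover have "norm (?T t (x + y) - (x + y)) \<le> norm (?T t x - x) + norm (?T t y - y)" for t
      unfolding truncated_rotation_L2_add add_diff_add by (rule norm_triangle_ineq)
    ultimately show ?thesis
      unfolding S_def using Lim_null_comparison[of "\<lambda>t. norm (?T t (x + y) - (x + y))" "\<lambda>t. norm (?T t x - x) + norm (?T t y - y)"]
      by (simp add: always_eventually)
  qed
  have powi: "powi_L2 k \<in> S" for k
  proof -
    have "((\<lambda>t. sqrt ((cmod (cis (- (of_int k * (2 * pi * t))) - 1))\<^sup>2 + t)) \<longlongrightarrow> sqrt ((cmod (cis (- (of_int k * (2 * pi * 0))) - 1))\<^sup>2 + 0)) (at_right 0)"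
      by (intro tendsto_intros)
    then have lim: "((\<lambda>t. sqrt ((cmod (cis (- (of_int k * (2 * pi * t))) - 1))\<^sup>2 + t)) \<longlongrightarrow> 0) (at_right 0)" by simp
    have "((\<lambda>t. norm (?T t (powi_L2 k) - powi_L2 k)) \<longlongrightarrow> 0) (at_right 0)"
    proof (rule Lim_null_comparison[OF _ lim])
      have "norm (?T t (powi_L2 k) - powi_L2 k) \<le> sqrt ((cmod (cis (- (of_int k * (2 * pi * t))) - 1))\<^sup>2 + t)" if "0 < t" "t < 1" for t
        using truncated_rotation_L2_powi[of "2 * pi * t" k] that by (intro real_le_rsqrt) simp
      then show "\<forall>\<^sub>F t in at_right 0. norm (norm (?T t (powi_L2 k) - powi_L2 k)) \<le> sqrt ((cmod (cis (- (of_int k * (2 * pi * t))) - 1))\<^sup>2 + t)"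
        unfolding eventually_at_right_field by (intro exI[of _ 1]) simp
    qed
    then show ?thesis by (simp add: S_def)
  qed
  have S_scale: "c *\<^sub>C x \<in> S" if "x \<in> S" for c x
  proof -
    have neg: "- (c *\<^sub>C y) = c *\<^sub>C (- y)" for y :: circle_L2
      using scaleC_add_right[of c y "- y"] by (simp add: eq_neg_iff_add_eq_0 neg_eq_iff_add_eq_0)
    have "norm (?T t (c *\<^sub>C x) - c *\<^sub>C x) = cmod c * norm (?T t x - x)" for t
    proof -
      have "?T t (c *\<^sub>C x) - c *\<^sub>C x = c *\<^sub>C (?T t x - x)"
        unfolding truncated_rotation_L2_scaleC diff_conv_add_uminus neg scaleC_add_right ..
      then show ?thesis by (simp add: norm_scaleC)
    qed
    then show ?thesis using that tendsto_mult[OF tendsto_const[of "cmod c"], of "\<lambda>t. norm (?T t x - x)" 0 "at_right 0"] by (simp add: S_def)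
  qed
  have zero: "0 \<in> S"
    using S_scale[OF powi[of 0], of 0] norm_scaleC[of 0 "powi_L2 0"] by simp
  have dense: "x \<in> closure S" for x
    unfolding closure_sequential
  proof (intro exI conjI allI)
    show "(\<lambda>N. \<Sum>n<N. coeff_L2 x (int_decode n) *\<^sub>C powi_L2 (int_decode n)) \<longlonglongrightarrow> x"
      using fourier_expansion_L2[of x] by (simp add: sums_def)
    show "(\<Sum>n<N. coeff_L2 x (int_decode n) *\<^sub>C powi_L2 (int_decode n)) \<in> S" for N
      by (induction N) (auto intro: zero S_add S_scale powi)
  qed
  fix x
  show "((\<lambda>t. norm (?T t x - x)) \<longlongrightarrow> 0) (at_right 0)"
  proof (rule tendsto_on_closure[where \<delta> = 1 and M = 1 and S = S])
    show "linear (?T t)" for t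
      using bounded_clinear_truncated_rotation_L2[of "2 * pi * t"] bounded_linear.linear by (auto simp: bounded_clinear_def)
  qed (use dense norm_truncated_rotation_L2 in \<open>auto simp: S_def\<close>)
qed

text \<open>
  With \<open>k\<close> and \<open>l\<close> taken to be \<open>int\<close> and \<open>int_decode\<close>, this identifies the Hardy space with the whole
  space of square integrable functions by renumbering the orthonormal basis.
\<close>

definition reindex_L2 :: "(nat \<Rightarrow> int) \<Rightarrow> (nat \<Rightarrow> int) \<Rightarrow> circle_L2 \<Rightarrow> circle_L2"
  where "reindex_L2 k l f = (\<Sum>n. coeff_L2 f (k n) *\<^sub>C powi_L2 (l n))"

lemma reindex_L2:
  assumes "inj k" "inj l"
  shows coeff_reindex_L2: "coeff_L2 (reindex_L2 k l f) m = (if m \<in> range l then coeff_L2 f (k (inv l m)) else 0)"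
    and bounded_clinear_reindex_L2: "bounded_clinear (reindex_L2 k l)"
proof -
  have s: "(\<lambda>n. coeff_L2 f (k n) *\<^sub>C powi_L2 (l n)) sums reindex_L2 k l f" for f
    unfolding reindex_L2_def by (intro summable_sums summable_powi_L2 summable_coeff_L2 assms)
  show c: "coeff_L2 (reindex_L2 k l f) m = (if m \<in> range l then coeff_L2 f (k (inv l m)) else 0)" for f m
    by (rule coeff_L2_powi_sums[OF assms(2) s])
  have add: "reindex_L2 k l (f + g) = reindex_L2 k l f + reindex_L2 k l g" for f g
    by (rule circle_L2_eqI) (simp add: c coeff_L2_add)
  have scale: "reindex_L2 k l (a *\<^sub>C f) = a *\<^sub>C reindex_L2 k l f" for a f
    by (rule circle_L2_eqI) (simp add: c coeff_L2_scaleC)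
  have norm: "norm (reindex_L2 k l f) \<le> norm f" for f
  proof (rule LIMSEQ_le_const2)
    show "(\<lambda>N. norm (\<Sum>n<N. coeff_L2 f (k n) *\<^sub>C powi_L2 (l n))) \<longlonglongrightarrow> norm (reindex_L2 k l f)"
      using s[of f] by (intro tendsto_norm) (simp add: sums_def)
    have "norm (\<Sum>n<N. coeff_L2 f (k n) *\<^sub>C powi_L2 (l n)) \<le> norm f" for N
    proof (rule power2_le_imp_le)
      show "(norm (\<Sum>n<N. coeff_L2 f (k n) *\<^sub>C powi_L2 (l n)))\<^sup>2 \<le> (norm f)\<^sup>2"
        using bessel_inequality_L2[of "{..<N}" k f] inj_on_subset[OF assms(1)] inj_on_subset[OF assms(2)]
        by (simp add: sum_powi_L2_norm)
    qed simp
    then show "\<exists>N. \<forall>n\<ge>N. norm (\<Sum>n<n. coeff_L2 f (k n) *\<^sub>C powi_L2 (l n)) \<le> norm f" by blast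
  qed
  show "bounded_clinear (reindex_L2 k l)"
    unfolding bounded_clinear_def
    by (auto intro!: bounded_linear_intro[where K = 1] simp: add scale scaleR_eq_scaleC norm)
qed

lemma c0_semigroup_conjugate:
  assumes T: "c0_semigroup T" and J: "bounded_clinear J" and J': "bounded_clinear J'"
    and inv: "\<And>x. J' (J x) = x" "\<And>y. J (J' y) = y"
  shows "c0_semigroup (\<lambda>t. J' \<circ> T t \<circ> J)"
  unfolding c0_semigroup_def
proof (intro conjI allI impI)
  show "bounded_clinear (J' \<circ> T t \<circ> J)" if "t > 0" for t
  proof -
    have Tt: "bounded_clinear (T t)" using T that by (simp add: c0_semigroup_def)
    then have "bounded_linear (\<lambda>x. J' (T t (J x)))"
      using J J' unfolding bounded_clinear_def
      by (intro bounded_linear_compose[of J', OF _ bounded_linear_compose[of "T t" J]]) simp_all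
    then show ?thesis
      using J J' Tt unfolding bounded_clinear_def o_def by simp
  qed
  show "(J' \<circ> T t \<circ> J) \<circ> (J' \<circ> T s \<circ> J) = J' \<circ> T (t + s) \<circ> J" if "t > 0" "s > 0" for t s
    using T that unfolding c0_semigroup_def by (simp add: fun_eq_iff inv)
  fix x
  have "((\<lambda>t. norm (T t (J x) - J x)) \<longlongrightarrow> 0) (at_right 0)" using T by (simp add: c0_semigroup_def)
  then have "((\<lambda>t. T t (J x)) \<longlongrightarrow> J x) (at_right 0)"
    by (subst Lim_null) (simp add: tendsto_norm_zero_iff)
  then have "((\<lambda>t. J' (T t (J x))) \<longlongrightarrow> J' (J x)) (at_right 0)"
    by (rule bounded_linear.tendsto[OF conjunct1[OF J'[unfolded bounded_clinear_def]]])
  then show "((\<lambda>t. norm ((J' \<circ> T t \<circ> J) x - x)) \<longlongrightarrow> 0) (at_right 0)"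
    by (subst (asm) Lim_null) (simp add: inv tendsto_norm_zero_iff)
qed

lemma c0_embeddable_zero_hardy2: "c0_embeddable (\<lambda>_ :: hardy2. 0)"
proof -
  define J where "J f = reindex_L2 int int_decode (Rep_hardy2 f)" for f
  define J' where "J' f = Abs_hardy2 (reindex_L2 int_decode int f)" for f
  have inj: "inj int" "inj int_decode" by (simp_all add: inj_int_decode)
  have Rep_J': "Rep_hardy2 (J' f) = reindex_L2 int_decode int f" for f
    unfolding J'_def by (rule Abs_hardy2_inverse) (auto simp: coeff_reindex_L2[OF inj(2,1)])
  have bJ: "bounded_clinear J"
  proof -
    have "bounded_linear Rep_hardy2"
      by (rule bounded_linear_intro[where K = 1])
         (simp_all add: plus_hardy2.rep_eq scaleR_hardy2.rep_eq norm_hardy2.rep_eq)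
    then show ?thesis
      using bounded_clinear_reindex_L2[OF inj] bounded_linear_compose[of "reindex_L2 int int_decode" Rep_hardy2]
      unfolding bounded_clinear_def J_def[abs_def] by (simp add: scaleC_hardy2.rep_eq)
  qed
  have bJ': "bounded_clinear J'"
  proof -
    interpret R: bounded_linear "reindex_L2 int_decode int"
      using bounded_clinear_reindex_L2[OF inj(2,1)] by (simp add: bounded_clinear_def)
    obtain K where K: "\<And>f. norm (reindex_L2 int_decode int f) \<le> norm f * K" using R.bounded by blast
    have scale: "reindex_L2 int_decode int (c *\<^sub>C f) = c *\<^sub>C reindex_L2 int_decode int f" for c f
      using bounded_clinear_reindex_L2[OF inj(2,1)] by (simp add: bounded_clinear_def)
    have "bounded_linear J'"
      by (rule bounded_linear_intro[where K = K])
         (simp_all add: Rep_hardy2_inject[symmetric] Rep_J' plus_hardy2.rep_eq scaleR_hardy2.rep_eq norm_hardy2.rep_eq R.add R.scaleR K)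
    then show ?thesis
      by (simp add: bounded_clinear_def Rep_hardy2_inject[symmetric] Rep_J' scaleC_hardy2.rep_eq scale)
  qed
  have J'J: "J' (J f) = f" for f
  proof (rule hardy2_eqI)
    fix n :: int assume "n \<ge> 0"
    then obtain m where "n = int m" by (metis nonneg_int_cases)
    then show "coeff_L2 (Rep_hardy2 (J' (J f))) n = coeff_L2 (Rep_hardy2 f) n"
      by (simp add: Rep_J' J_def coeff_reindex_L2 inj inv_f_f)
  qed
  have JJ': "J (J' f) = f" for f
  proof (rule circle_L2_eqI)
    show "coeff_L2 (J (J' f)) n = coeff_L2 f n" for n
      by (simp add: Rep_J' J_def coeff_reindex_L2 inj inv_f_f surj_int_decode surj_f_inv_f)
  qed
  have J'0: "J' 0 = 0" using bJ' by (simp add: bounded_clinear_def linear_simps)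
  show ?thesis
    unfolding c0_embeddable_def
  proof (intro exI conjI)
    show "c0_semigroup (\<lambda>t. J' \<circ> truncated_rotation_L2 (2 * pi * t) \<circ> J)"
      by (rule c0_semigroup_conjugate[OF c0_semigroup_truncated_rotation bJ bJ' J'J JJ'])
    show "J' \<circ> truncated_rotation_L2 (2 * pi * 1) \<circ> J = (\<lambda>_. 0)"
      by (simp add: fun_eq_iff truncated_rotation_L2_nilpotent J'0)
  qed
qed

section \<open>Embedding Toeplitz operators into semigroups\<close>

theorem theoremF:
  fixes F :: "complex \<Rightarrow> complex"
  assumes "F \<in> wiener_algebra \<or> F \<in> dini_algebra"
    and "\<exists>C a r. C \<in> components (- op_spectrum (toeplitz F)) \<and> \<not> bounded C \<and>
      0 < r \<and> ball a r \<subseteq> C \<and> 0 \<in> frontier (ball a r)"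
  shows "c0_embeddable (toeplitz F)"
proof -
  have F: "continuous_on (sphere 0 1) F"
    using assms(1) continuous_on_wiener_algebra by (auto simp: dini_algebra_def)
  obtain C a r where C: "C \<in> components (- op_spectrum (toeplitz F))" "\<not> bounded C"
    and r: "0 < r" and sub: "ball a r \<subseteq> C" and fr: "0 \<in> frontier (ball a r)"
    using assms(2) by blast
  have a: "cmod a = r" using fr r by (simp add: frontier_ball)
  show ?thesis
  proof (cases "\<exists>z0\<in>sphere 0 1. F z0 \<noteq> 0")
    case False
    then have "AE z in circle. F z = 0" by (intro AE_I2) (simp add: space_circle)
    then have "toeplitz F = toeplitz (\<lambda>_. 0)"
      by (intro toeplitz_cong_AE ess_bounded_continuous[OF F] ess_bounded_const)
    also have "\<dots> = (\<lambda>_. 0)"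
    proof
      show "toeplitz (\<lambda>_. 0) f = 0" for f
        using norm_scaleC[of 0 f] by (simp add: toeplitz_const)
    qed
    finally show ?thesis using c0_embeddable_zero_hardy2 by simp
  next
    case True
    then obtain z0 where z0: "z0 \<in> sphere 0 1" "F z0 \<noteq> 0" by blast
    have notin: "F z \<notin> C" if "z \<in> sphere 0 1" for z
      using range_subset_op_spectrum_toeplitz[OF F that] in_components_subset[OF C(1)] by blast
    have "a \<in> C" using sub r by auto
    then obtain g where g: "continuous_on (sphere 0 1) g" "\<And>z. z \<in> sphere 0 1 \<Longrightarrow> F z - a = exp (g z)"
      using continuous_log_unbounded_component[OF F in_components_connected[OF C(1)] C(2) _ notin] by blast
    have ge: "r \<le> cmod (F z - a)" if "z \<in> sphere 0 1" for z
    proof -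
      have "F z \<notin> ball a r" using notin[OF that] sub by blast
      then show ?thesis by (simp add: dist_norm norm_minus_commute)
    qed
    have "splits_analytic g"
      using assms(1) splits_analytic_log_wiener[OF _ r ge g] splits_analytic_log_dini[OF _ r ge g] by blast
    then show ?thesis
      using c0_embeddable_toeplitz_if_log_splits[OF F C sub a r g(1) _ _ z0] g(2) by blast
  qed
qed

end
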